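(* Let $A$ be a monomial algebra over a field $K$ and let $S\subseteq A$ be the set of non-zero monomials which are not infinitely right prolongable. Then $N=\mathrm{Span}_K S$ is a two-sided ideal of $A$ and $A/N$ is a right prolongable monomial algebra. Moreover: (i) if $|S|=\infty$, then $A$ has an infinite-dimensional invariant subspace spanned by monomials, and $A$ is exhaustively amenable as a right module over itself; (ii) if $|S|<\infty$, then the following are equivalent: $A$ is exhaustively amenable as a right module over itself; $A/N$ is exhaustively amenable as a right module over itself; both $A$ and $A/N$ have Følner sequences (each as a right module over itself) consisting of spaces spanned by monomials.
   Context: Algebras are associative and unital. A monomial algebra is an algebra $A=K\langle x_1,\dots,x_d\rangle/I$ where $I$ is an ideal generated by monomials $x_{i_1}\cdots x_{i_r}$; monomials of $A$ are the images of words in $x_1,\dots,x_d$ (including the empty word $1$). A non-zero monomial $u\in A$ is right prolongable if there is a non-empty monomial $v$ with $uv\neq0$; it is infinitely right prolongable if there are arbitrarily long monomials $v$ with $uv\neq0$. $A$ is right prolongable if all its non-zero monomials are right prolongable. A subspace $L\le A$ is invariant if $La\subseteq L$ for all $a\in A$. For a right $A$-module $M$, a finite-dimensional subspace $V\leq A$ and $\varepsilon>0$, a finite-dimensional subspace $L\leq M$ is $(V,\varepsilon)$-invariant if $\dim_K LV<(1+\varepsilon)\dim_K L$, where $LV$ is the span of all products $\ell v$. $M$ is exhaustively amenable if for every finite-dimensional $V\leq A$, every $\varepsilon>0$ and every finite-dimensional $W\leq M$ there is a $(V,\varepsilon)$-invariant subspace of $M$ containing $W$. A Følner sequence of $A$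 as a right module over itself is taken with respect to a finite-dimensional generating subspace $V$ with $1\in V$, $A=K\langle V\rangle$ (the statement is meant for any such $V$): it is a chain of finite-dimensional non-zero subspaces $L_1\subseteq L_2\subseteq\cdots$ of $A$ with $A=\bigcup_nL_n$ and $\dim_K L_nV/\dim_K L_n\to1$. By convention, the zero algebra (which occurs as $A/N$ when $A$ is finite-dimensional) is regarded as a right prolongable monomial algebra, as exhaustively amenable over itself, and as having such a Følner sequence. *)

theory Defs
  imports Complex_Main "HOL-Algebra.QuotRing" "Jordan_Normal_Form.Missing_VectorSpace"
begin

text \<open>
  Algebras, vector spaces and ideals are carrier-based (HOL-Algebra, and the \<open>vectorspace\<close> locale
  of the AFP entry VectorSpace). The \<open>algebra\<close> locale of HOL-Algebra is commutative, so it does not apply here.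
\<close>

locale assoc_algebra = vectorspace K A + ring A
  for K :: "('k, 'm) ring_scheme" and A :: "('k, 'a) module" +
  assumes smult_mult_left:
      "\<lbrakk>c \<in> carrier K; a \<in> carrier A; b \<in> carrier A\<rbrakk>
        \<Longrightarrow> (c \<odot>\<^bsub>A\<^esub> a) \<otimes>\<^bsub>A\<^esub> b = c \<odot>\<^bsub>A\<^esub> (a \<otimes>\<^bsub>A\<^esub> b)"
    and smult_mult_right:
      "\<lbrakk>c \<in> carrier K; a \<in> carrier A; b \<in> carrier A\<rbrakk>
        \<Longrightarrow> a \<otimes>\<^bsub>A\<^esub> (c \<odot>\<^bsub>A\<^esub> b) = c \<odot>\<^bsub>A\<^esub> (a \<otimes>\<^bsub>A\<^esub> b)"

text \<open>\<^const>\<open>FactRing\<close> has no scalar multiplication; this is \<open>A Quot I\<close> extended by the induced one.\<close>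

definition quot_algebra :: "('k, 'a) module \<Rightarrow> 'a set \<Rightarrow> ('k, 'a set) module" where
  "quot_algebra A I =
    \<lparr>carrier = carrier (A Quot I), mult = mult (A Quot I), one = one (A Quot I),
     zero = zero (A Quot I), add = add (A Quot I),
     smult = (\<lambda>c C. \<Union>a\<in>C. I +>\<^bsub>A\<^esub> (c \<odot>\<^bsub>A\<^esub> a))\<rparr>"

definition algebra_iso ::
  "('k, 'm) ring_scheme \<Rightarrow> ('k, 'a) module \<Rightarrow> ('k, 'b) module \<Rightarrow> ('a \<Rightarrow> 'b) set" where
  "algebra_iso K A B = {\<phi> \<in> ring_iso A B.
     \<forall>c\<in>carrier K. \<forall>a\<in>carrier A. \<phi> (c \<odot>\<^bsub>A\<^esub> a) = c \<odot>\<^bsub>B\<^esub> \<phi> a}"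

text \<open>
  The free algebra on a finite set \<open>X\<close> of letters: finitely supported \<open>K\<close>-valued functions on the
  words over \<open>X\<close>, with the convolution product coming from concatenation (the sum runs over the
  factorisations \<open>w = take i w @ drop i w\<close>).
\<close>

definition free_algebra :: "('k, 'm) ring_scheme \<Rightarrow> 'x set \<Rightarrow> ('k, 'x list \<Rightarrow> 'k) module" where
  "free_algebra K X =
    \<lparr>carrier = {f. range f \<subseteq> carrier K \<and> finite {w. f w \<noteq> \<zero>\<^bsub>K\<^esub>} \<and> {w. f w \<noteq> \<zero>\<^bsub>K\<^esub>} \<subseteq> lists X},
     mult = (\<lambda>f g w. \<Oplus>\<^bsub>K\<^esub>i\<in>{..length w}. f (take i w) \<otimes>\<^bsub>K\<^esub> g (drop i w)),
     one = (\<lambda>w. if w = [] then \<one>\<^bsub>K\<^esub> else \<zero>\<^bsub>K\<^esub>),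
     zero = (\<lambda>w. \<zero>\<^bsub>K\<^esub>),
     add = (\<lambda>f g w. f w \<oplus>\<^bsub>K\<^esub> g w),
     smult = (\<lambda>c f w. c \<otimes>\<^bsub>K\<^esub> f w)\<rparr>"

definition free_word :: "('k, 'm) ring_scheme \<Rightarrow> 'x list \<Rightarrow> 'x list \<Rightarrow> 'k" where
  "free_word K u = (\<lambda>w. if w = u then \<one>\<^bsub>K\<^esub> else \<zero>\<^bsub>K\<^esub>)"

definition monomial_relations ::
  "('k, 'm) ring_scheme \<Rightarrow> 'x set \<Rightarrow> 'x list set \<Rightarrow> ('x list \<Rightarrow> 'k) set" where
  "monomial_relations K X R = Idl\<^bsub>free_algebra K X\<^esub> (free_word K ` R)"

text \<open>
  A monomial algebra comes with its presentation: \<open>x i\<close> is the image in \<open>A\<close> of the letter \<open>i\<close>, and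
  \<open>A\<close> is identified with the quotient of the free algebra by an ideal generated by words. The number
  of generators is \<open>card X\<close> (zero is allowed), the \<open>x i\<close> may vanish, and \<open>A\<close> may be the zero algebra
  (take the empty word as a relation).
\<close>

definition monomial_algebra ::
  "('k, 'm) ring_scheme \<Rightarrow> 'x set \<Rightarrow> ('x \<Rightarrow> 'a) \<Rightarrow> ('k, 'a) module \<Rightarrow> bool" where
  "monomial_algebra K X x A \<longleftrightarrow>
     finite X \<and> assoc_algebra K A \<and>
     (\<exists>R \<subseteq> lists X.
        \<exists>\<phi> \<in> algebra_iso K (quot_algebra (free_algebra K X) (monomial_relations K X R)) A.
          \<forall>i\<in>X. \<phi> (monomial_relations K X R +>\<^bsub>free_algebra K X\<^esub> free_word K [i]) = x i)"

primrec word_image :: "('k, 'a) module \<Rightarrow> ('x \<Rightarrow> 'a) \<Rightarrow> 'x list \<Rightarrow> 'a" where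
  "word_image A x [] = \<one>\<^bsub>A\<^esub>"
| "word_image A x (i # w) = x i \<otimes>\<^bsub>A\<^esub> word_image A x w"

definition monomials :: "('k, 'a) module \<Rightarrow> 'x set \<Rightarrow> ('x \<Rightarrow> 'a) \<Rightarrow> 'a set" where
  "monomials A X x = word_image A x ` lists X"

text \<open>
  The length of a monomial is that of a word representing it; for a non-zero monomial of a monomial
  algebra this word is unique, and \<open>v \<noteq> 0\<close> whenever \<open>u v \<noteq> 0\<close>.
\<close>

definition right_prolongable_monomial ::
  "('k, 'a) module \<Rightarrow> 'x set \<Rightarrow> ('x \<Rightarrow> 'a) \<Rightarrow> 'a \<Rightarrow> bool" where
  "right_prolongable_monomial A X x u \<longleftrightarrow>
     (\<exists>w\<in>lists X. w \<noteq> [] \<and> u \<otimes>\<^bsub>A\<^esub> word_image A x w \<noteq> \<zero>\<^bsub>A\<^esub>)"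

definition inf_right_prolongable_monomial ::
  "('k, 'a) module \<Rightarrow> 'x set \<Rightarrow> ('x \<Rightarrow> 'a) \<Rightarrow> 'a \<Rightarrow> bool" where
  "inf_right_prolongable_monomial A X x u \<longleftrightarrow>
     (\<forall>n. \<exists>w\<in>lists X. n \<le> length w \<and> u \<otimes>\<^bsub>A\<^esub> word_image A x w \<noteq> \<zero>\<^bsub>A\<^esub>)"

definition right_prolongable :: "('k, 'a) module \<Rightarrow> 'x set \<Rightarrow> ('x \<Rightarrow> 'a) \<Rightarrow> bool" where
  "right_prolongable A X x \<longleftrightarrow>
     (\<forall>u\<in>monomials A X x. u \<noteq> \<zero>\<^bsub>A\<^esub> \<longrightarrow> right_prolongable_monomial A X x u)"

text \<open>Qualified, since \<open>HOL.Modules\<close> also has a \<open>module.span\<close>.\<close>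

abbreviation lspan ::
  "('k, 'm) ring_scheme \<Rightarrow> ('k, 'b) module \<Rightarrow> 'b set \<Rightarrow> 'b set" where
  "lspan K M \<equiv> LinearCombinations.module.span K M"

abbreviation sdim :: "('k, 'm) ring_scheme \<Rightarrow> ('k, 'b) module \<Rightarrow> 'b set \<Rightarrow> nat" where
  "sdim K M L \<equiv> vectorspace.dim K (M\<lparr>carrier := L\<rparr>)"

abbreviation sfin_dim :: "('k, 'm) ring_scheme \<Rightarrow> ('k, 'b) module \<Rightarrow> 'b set \<Rightarrow> bool" where
  "sfin_dim K M L \<equiv> vectorspace.fin_dim K (M\<lparr>carrier := L\<rparr>)"

definition fd_subspace :: "('k, 'm) ring_scheme \<Rightarrow> ('k, 'b) module \<Rightarrow> 'b set \<Rightarrow> bool" where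
  "fd_subspace K M L \<longleftrightarrow> subspace K L M \<and> sfin_dim K M L"

definition invariant_subspace :: "('k, 'm) ring_scheme \<Rightarrow> ('k, 'a) module \<Rightarrow> 'a set \<Rightarrow> bool" where
  "invariant_subspace K A L \<longleftrightarrow>
     subspace K L A \<and> (\<forall>l\<in>L. \<forall>a\<in>carrier A. l \<otimes>\<^bsub>A\<^esub> a \<in> L)"

definition spanned_by_monomials ::
  "('k, 'm) ring_scheme \<Rightarrow> 'x set \<Rightarrow> ('x \<Rightarrow> 'a) \<Rightarrow> ('k, 'a) module \<Rightarrow> 'a set \<Rightarrow> bool" where
  "spanned_by_monomials K X x A L \<longleftrightarrow> (\<exists>T \<subseteq> monomials A X x. L = lspan K A T)"

text \<open>
  A right \<open>A\<close>-module is a vector space \<open>M\<close> together with the map \<open>act :: M \<times> A \<rightarrow> M\<close>; the algebra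
  as a right module over itself is \<open>M = A\<close>, \<open>act = mult A\<close>.
\<close>

definition subspace_prod ::
  "('k, 'm) ring_scheme \<Rightarrow> ('k, 'b) module \<Rightarrow> ('b \<Rightarrow> 'a \<Rightarrow> 'b) \<Rightarrow> 'b set \<Rightarrow> 'a set \<Rightarrow> 'b set" where
  "subspace_prod K M act L V = lspan K M {act l v | l v. l \<in> L \<and> v \<in> V}"

definition almost_invariant ::
  "('k, 'm) ring_scheme \<Rightarrow> ('k, 'b) module \<Rightarrow> ('b \<Rightarrow> 'a \<Rightarrow> 'b) \<Rightarrow> 'a set \<Rightarrow> real \<Rightarrow> 'b set \<Rightarrow> bool"
  where
  "almost_invariant K M act V \<epsilon> L \<longleftrightarrow>
     fd_subspace K M L \<and>
     real (sdim K M (subspace_prod K M act L V)) < (1 + \<epsilon>) * real (sdim K M L)"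

definition exhaustively_amenable_module ::
  "('k, 'm) ring_scheme \<Rightarrow> ('k, 'a) module \<Rightarrow> ('k, 'b) module \<Rightarrow> ('b \<Rightarrow> 'a \<Rightarrow> 'b) \<Rightarrow> bool" where
  "exhaustively_amenable_module K A M act \<longleftrightarrow>
     (\<forall>V \<epsilon> W. fd_subspace K A V \<and> \<epsilon> > 0 \<and> fd_subspace K M W
        \<longrightarrow> (\<exists>L. almost_invariant K M act V \<epsilon> L \<and> W \<subseteq> L))"

text \<open>
  For the zero algebra both notions below hold by convention: the defining conditions fail there,
  as no subspace has positive dimension.
\<close>

definition exhaustively_amenable :: "('k, 'm) ring_scheme \<Rightarrow> ('k, 'a) module \<Rightarrow> bool" where
  "exhaustively_amenable K A \<longleftrightarrow>
     carrier A = {\<zero>\<^bsub>A\<^esub>} \<or> exhaustively_amenable_module K A A (mult A)"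

definition generating_subspace ::
  "('k, 'm) ring_scheme \<Rightarrow> ('k, 'a) module \<Rightarrow> 'a set \<Rightarrow> bool" where
  "generating_subspace K A V \<longleftrightarrow>
     fd_subspace K A V \<and> \<one>\<^bsub>A\<^esub> \<in> V \<and>
     (\<forall>B. subspace K B A \<and> \<one>\<^bsub>A\<^esub> \<in> B \<and> (\<forall>a\<in>B. \<forall>b\<in>B. a \<otimes>\<^bsub>A\<^esub> b \<in> B) \<and> V \<subseteq> B
        \<longrightarrow> B = carrier A)"

definition folner_sequence ::
  "('k, 'm) ring_scheme \<Rightarrow> ('k, 'a) module \<Rightarrow> 'a set \<Rightarrow> (nat \<Rightarrow> 'a set) \<Rightarrow> bool" where
  "folner_sequence K A V L \<longleftrightarrow>
     (\<forall>n. fd_subspace K A (L n) \<and> L n \<noteq> {\<zero>\<^bsub>A\<^esub>}) \<and> incseq L \<and> (\<Union>n. L n) = carrier A \<and>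
     (\<lambda>n. real (sdim K A (subspace_prod K A (mult A) (L n) V)) / real (sdim K A (L n)))
        \<longlonglongrightarrow> 1"

definition has_monomial_folner_sequence ::
  "('k, 'm) ring_scheme \<Rightarrow> 'x set \<Rightarrow> ('x \<Rightarrow> 'a) \<Rightarrow> ('k, 'a) module \<Rightarrow> 'a set \<Rightarrow> bool" where
  "has_monomial_folner_sequence K X x A V \<longleftrightarrow>
     carrier A = {\<zero>\<^bsub>A\<^esub>} \<or>
     (\<exists>L. folner_sequence K A V L \<and> (\<forall>n. spanned_by_monomials K X x A (L n)))"

end

theory Submission
  imports Defs
begin

text \<open>
  A monomial algebra has the words with non-zero image as a basis, and the product of two basis words
  is a basis word or zero. A word is called dead below if its image is non-zero and not
  infinitely right prolongable. A non-zero product of a dead word with any word, on either side, is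
  dead again, so the dead words span a two-sided ideal \<open>N\<close>. The quotient has the remaining non-zero
  words as a basis, and it is right prolongable because the alphabet is finite: if \<open>w\<close> is infinitely
  prolongable, then so is \<open>w i\<close> for some letter \<open>i\<close>.

  If there are infinitely many dead words, then \<open>N\<close> is the invariant subspace sought. Each dead word
  generates a finite-dimensional right ideal, so \<open>A\<close> has invariant subspaces of arbitrarily large finite
  dimension. Adding one of them to a given subspace \<open>W\<close> makes the growth \<open>W V\<close> negligible
  (\<open>large_invariant_subspaces_imp_exhaustively_amenable\<close>).

  If there are finitely many, then \<open>N\<close> is finite-dimensional. Taking images and preimages along
  \<open>A \<rightarrow> A/N\<close> changes dimensions by at most \<open>dim N\<close>. This is negligible once the subspaces are large, and
  a non-zero right prolongable algebra is infinite-dimensional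
  (\<open>algebra_epi.exhaustively_amenable_iff\<close>).

  The link with Folner sequences holds for every monomial algebra and is applied to both \<open>A\<close> and
  \<open>A/N\<close>. Given a Folner sequence \<open>L\<^sub>1 \<subseteq> L\<^sub>2 \<subseteq> \<dots>\<close> with respect to \<open>V\<close>, the elements \<open>a\<close> for which
  \<open>L\<^sub>n + L\<^sub>n a\<close> exceeds \<open>L\<^sub>n\<close> by \<open>o(dim L\<^sub>n)\<close> dimensions form a subalgebra containing \<open>V\<close>, hence are all
  of \<open>A\<close>; so every finite-dimensional subspace acts on \<open>L\<^sub>n\<close> with small growth
  (\<open>folner_sequence_imp_exhaustively_amenable\<close>). Conversely, order the words compatibly with right
  multiplication and replace a subspace \<open>L\<close> by the span of its leading words. This keeps the dimension,
  keeps the words already in \<open>L\<close>, and does not increase \<open>dim (L V)\<close> when \<open>V\<close> is spanned by words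
  (\<open>lead_words_prod\<close>). Almost invariant subspaces can therefore be chosen monomial and increasing.
\<close>


section \<open>Finite-dimensional subspaces of an algebra\<close>

context assoc_algebra
begin

lemma subspaceI:
  assumes "W \<subseteq> carrier A" "\<zero>\<^bsub>A\<^esub> \<in> W"
    and "\<And>v w. v \<in> W \<Longrightarrow> w \<in> W \<Longrightarrow> v \<oplus>\<^bsub>A\<^esub> w \<in> W"
    and "\<And>c v. c \<in> carrier K \<Longrightarrow> v \<in> W \<Longrightarrow> c \<odot>\<^bsub>A\<^esub> v \<in> W"
  shows "subspace K W A"
proof -
  have "vectorspace K A" "module K A" by unfold_locales
  then show ?thesis
    unfolding subspace_def submodule_def using assms by auto
qed

lemma subspaceD:
  assumes "subspace K W A"
  shows "W \<subseteq> carrier A" "\<zero>\<^bsub>A\<^esub> \<in> W"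
    and "\<And>v w. v \<in> W \<Longrightarrow> w \<in> W \<Longrightarrow> v \<oplus>\<^bsub>A\<^esub> w \<in> W"
    and "\<And>c v. c \<in> carrier K \<Longrightarrow> v \<in> W \<Longrightarrow> c \<odot>\<^bsub>A\<^esub> v \<in> W"
  using assms unfolding subspace_def submodule_def by auto

lemma span_subset_subspace: "subspace K W A \<Longrightarrow> F \<subseteq> W \<Longrightarrow> span F \<subseteq> W"
  by (rule span_is_subset) auto

lemma span_subspace_id: "subspace K W A \<Longrightarrow> span W = W"
  using span_subset_subspace[of W W] in_own_span[of W] subspaceD(1)[of W] by blast

lemma fd_subspaceD: "fd_subspace K A W \<Longrightarrow> subspace K W A"
  by (simp add: fd_subspace_def)

lemma fd_subspace_span:
  assumes "finite F" "F \<subseteq> carrier A"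
  shows "fd_subspace K A (span F)" and "sdim K A (span F) \<le> card F"
proof -
  have sub: "subspace K (span F) A" using assms by (simp add: span_is_subspace)
  interpret W: vectorspace K "vs (span F)" using subspace_is_vs[OF sub] .
  have F: "F \<subseteq> span F" using in_own_span assms by blast
  have gen: "W.span F = carrier (vs (span F))"
    using span_li_not_depend(1)[OF F is_module[OF sub]] by simp
  show "fd_subspace K A (span F)"
    unfolding fd_subspace_def W.fin_dim_def using sub assms(1) F gen by auto
  show "sdim K A (span F) \<le> card F"
    using W.gen_ge_dim[OF assms(1) _ gen] F by simp
qed

lemma fd_subspace_basis:
  assumes "fd_subspace K A W"
  obtains F where "finite F" "F \<subseteq> W" "F \<subseteq> carrier A" "span F = W" "lin_indpt F" "card F = sdim K A W"
proof -
  have sub: "subspace K W A" using assms by (simp add: fd_subspace_def)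
  interpret W: vectorspace K "vs W" using subspace_is_vs[OF sub] .
  obtain F where F: "finite F" "W.basis F"
    using assms W.finite_basis_exists unfolding fd_subspace_def by auto
  have FW: "F \<subseteq> W" using F unfolding W.basis_def by simp
  have "span F = W" "lin_indpt F"
    using span_li_not_depend[OF FW is_module[OF sub]] F(2) unfolding W.basis_def by simp_all
  moreover have "card F = sdim K A W" using W.dim_basis[OF F] by simp
  moreover have "F \<subseteq> carrier A" using FW subspaceD(1)[OF sub] by blast
  ultimately show ?thesis using that[of F] F(1) FW by blast
qed

lemma lin_indpt_card_le_sdim:
  assumes "fd_subspace K A W" "F \<subseteq> W" "lin_indpt F"
  shows "finite F" "card F \<le> sdim K A W"
proof -
  have sub: "subspace K W A" using assms by (simp add: fd_subspace_def)
  interpret W: vectorspace K "vs W" using subspace_is_vs[OF sub] .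
  have "W.lin_indpt F"
    using span_li_not_depend(2)[OF assms(2) is_module[OF sub]] assms(3) by simp
  then show "finite F" "card F \<le> sdim K A W"
    using W.li_le_dim[of F] assms unfolding fd_subspace_def by simp_all
qed

lemma sdim_span_lin_indpt:
  assumes "finite F" "F \<subseteq> carrier A" "lin_indpt F"
  shows "sdim K A (span F) = card F"
  using fd_subspace_span[OF assms(1,2)] lin_indpt_card_le_sdim[of "span F" F]
    in_own_span[OF assms(2)] assms(3) by force

lemma fd_subspace_mono:
  assumes W': "fd_subspace K A W'" and sub: "subspace K W A" and le: "W \<subseteq> W'"
  shows "fd_subspace K A W" "sdim K A W \<le> sdim K A W'"
proof -
  interpret W: vectorspace K "vs W" using subspace_is_vs[OF sub] .
  have li: "W.lin_indpt F \<longleftrightarrow> lin_indpt F" if "F \<subseteq> W" for F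
    using span_li_not_depend(2)[OF that is_module[OF sub]] by simp
  have bound: "finite F \<and> card F \<le> sdim K A W'"
    if "F \<subseteq> W" "W.lin_indpt F" for F
    using lin_indpt_card_le_sdim[OF W', of F] that li le by auto
  have "W.lin_indpt {}" by (auto simp: W.lin_dep_def)
  then obtain F where F: "finite F" "maximal F (\<lambda>F. F \<subseteq> W \<and> W.lin_indpt F)"
    using maximal_exists[of "\<lambda>F. F \<subseteq> W \<and> W.lin_indpt F" "sdim K A W'" "{}"] bound by auto
  have "W.basis F" using W.max_li_is_basis[of F] F(2) by simp
  then have "sdim K A W = card F" "W.fin_dim"
    using W.dim_basis[OF F(1)] F(1) unfolding W.fin_dim_def W.basis_def by auto
  moreover have "card F \<le> sdim K A W'" using bound F(2) unfolding maximal_def by auto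
  ultimately show "fd_subspace K A W" "sdim K A W \<le> sdim K A W'"
    using sub unfolding fd_subspace_def by simp_all
qed

text \<open>Steinitz exchange, applied to bases of \<open>W\<close> and \<open>W'\<close>.\<close>

lemma fd_subspace_extend:
  assumes W': "fd_subspace K A W'" and W: "fd_subspace K A W" and le: "W \<subseteq> W'"
  obtains F where "finite F" "F \<subseteq> carrier A" "card F \<le> sdim K A W' - sdim K A W"
    "span (W \<union> F) = W'"
proof -
  obtain B where B: "finite B" "B \<subseteq> W" "span B = W" "lin_indpt B" "card B = sdim K A W"
    using fd_subspace_basis[OF W] .
  obtain B' where B': "finite B'" "B' \<subseteq> carrier A" "span B' = W'" "card B' = sdim K A W'"
    using fd_subspace_basis[OF W'] .
  obtain C where C: "finite C" "C \<subseteq> carrier A" "C \<subseteq> span B'"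
      "int (card C) \<le> int (card B') - int (card B)" "span (B \<union> C) = span B'"
    using replacement[OF B(1) B'(1,2) B(4)] B(2) le B'(3) by blast
  have sW': "subspace K W' A" using W' by (rule fd_subspaceD)
  have "span (B \<union> C) \<subseteq> span (W \<union> C)" using B(2) span_is_monotone[of "B \<union> C" "W \<union> C"] by blast
  moreover have "span (W \<union> C) \<subseteq> W'"
    by (rule span_subset_subspace[OF sW']) (use le C(3) B'(3) in auto)
  ultimately have "span (W \<union> C) = W'" using C(5) B'(3) by auto
  then show ?thesis using that[of C] C B(5) B'(4) by auto
qed

lemma fd_subspace_span_Un:
  assumes "fd_subspace K A W" "finite F" "F \<subseteq> carrier A"
  shows "fd_subspace K A (span (W \<union> F))" "sdim K A (span (W \<union> F)) \<le> sdim K A W + card F"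
proof -
  obtain B where B: "finite B" "B \<subseteq> W" "B \<subseteq> carrier A" "span B = W" "card B = sdim K A W"
    using fd_subspace_basis[OF assms(1)] .
  have BF: "finite (B \<union> F)" "B \<union> F \<subseteq> carrier A" using B assms by auto
  have "span (W \<union> F) = span (B \<union> F)"
  proof
    have "W \<subseteq> span (B \<union> F)" using B(4) span_is_monotone[of B "B \<union> F"] by auto
    moreover have "F \<subseteq> span (B \<union> F)" using in_own_span[OF BF(2)] by auto
    ultimately show "span (W \<union> F) \<subseteq> span (B \<union> F)"
      using span_subset_subspace[OF span_is_subspace[OF BF(2)]] by auto
    show "span (B \<union> F) \<subseteq> span (W \<union> F)"
      using B(2) by (intro span_is_monotone) auto
  qed
  then show "fd_subspace K A (span (W \<union> F))" "sdim K A (span (W \<union> F)) \<le> sdim K A W + card F"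
    using fd_subspace_span[OF BF] card_Un_le[of B F] B(5) by auto
qed

lemma sdim_pos:
  assumes "fd_subspace K A W" "W \<noteq> {\<zero>\<^bsub>A\<^esub>}"
  shows "sdim K A W > 0"
proof -
  obtain F where F: "finite F" "span F = W" "card F = sdim K A W"
    using fd_subspace_basis[OF assms(1)] by metis
  show ?thesis
  proof (rule ccontr)
    assume "\<not> sdim K A W > 0"
    then have "F = {}" using F by auto
    then show False using F(2) assms(2) span_empty by auto
  qed
qed

lemma fd_subspace_subset_UN:
  assumes "fd_subspace K A W" "incseq L" "\<And>n. subspace K (L n) A" "(\<Union>n. L n) = carrier A"
  shows "\<exists>N. \<forall>n\<ge>N. W \<subseteq> L n"
proof -
  obtain F where F: "finite F" "F \<subseteq> carrier A" "span F = W" using fd_subspace_basis[OF assms(1)] .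
  have "\<exists>N. F \<subseteq> L N" using F(1,2)
  proof (induction F)
    case (insert a F)
    then obtain N where "F \<subseteq> L N" by auto
    moreover obtain N' where "a \<in> L N'" using insert.prems assms(4) by auto
    ultimately have "insert a F \<subseteq> L (max N N')"
      using incseqD[OF assms(2), of N "max N N'"] incseqD[OF assms(2), of N' "max N N'"] by auto
    then show ?case by blast
  qed auto
  then obtain N where N: "F \<subseteq> L N" by blast
  have "W \<subseteq> L n" if "n \<ge> N" for n
    using span_subset_subspace[OF assms(3)[of n], of F] N F(3) incseqD[OF assms(2) that] by auto
  then show ?thesis by blast
qed

section \<open>Products of subspaces and almost invariance\<close>

text \<open>That a product lies in a given subspace is a linear condition on each factor, so it has to be
  checked on spanning sets only.\<close>

lemma subspace_left_transporter:
  assumes "subspace K M A" "b \<in> carrier A"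
  shows "subspace K {a \<in> carrier A. a \<otimes>\<^bsub>A\<^esub> b \<in> M} A"
  using assms subspaceD[OF assms(1)]
  by (intro subspaceI) (auto simp: l_distr smult_mult_left)

lemma subspace_right_transporter:
  assumes "subspace K M A" "a \<in> carrier A"
  shows "subspace K {b \<in> carrier A. a \<otimes>\<^bsub>A\<^esub> b \<in> M} A"
  using assms subspaceD[OF assms(1)]
  by (intro subspaceI) (auto simp: r_distr smult_mult_right)

lemma span_mult_in_subspace:
  assumes M: "subspace K M A" and F: "F \<subseteq> carrier A" and G: "G \<subseteq> carrier A"
    and FG: "\<And>f g. f \<in> F \<Longrightarrow> g \<in> G \<Longrightarrow> f \<otimes>\<^bsub>A\<^esub> g \<in> M"
    and a: "a \<in> span F" and b: "b \<in> span G"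
  shows "a \<otimes>\<^bsub>A\<^esub> b \<in> M"
proof -
  have "f \<otimes>\<^bsub>A\<^esub> b \<in> M" if "f \<in> F" for f
    using span_subset_subspace[OF subspace_right_transporter[OF M, of f], of G] that F G FG b by blast
  then show ?thesis
    using span_subset_subspace[OF subspace_left_transporter[OF M, of b], of F] F G a b
      span_is_subset2[OF G] by blast
qed

abbreviation prodsp :: "'a set \<Rightarrow> 'a set \<Rightarrow> 'a set" where
  "prodsp L V \<equiv> subspace_prod K A (mult A) L V"

lemma prodsp_carrier:
  assumes "L \<subseteq> carrier A" "V \<subseteq> carrier A"
  shows "subspace K (prodsp L V) A"
  unfolding subspace_prod_def by (rule span_is_subspace) (use assms in auto)

lemma mult_in_prodsp:
  assumes "L \<subseteq> carrier A" "V \<subseteq> carrier A" "l \<in> L" "v \<in> V"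
  shows "l \<otimes>\<^bsub>A\<^esub> v \<in> prodsp L V"
proof -
  have "{l \<otimes>\<^bsub>A\<^esub> v | l v. l \<in> L \<and> v \<in> V} \<subseteq> carrier A" using assms by auto
  from in_own_span[OF this] show ?thesis unfolding subspace_prod_def using assms by blast
qed

lemma prodsp_subset:
  assumes "subspace K M A" "\<And>l v. l \<in> L \<Longrightarrow> v \<in> V \<Longrightarrow> l \<otimes>\<^bsub>A\<^esub> v \<in> M"
  shows "prodsp L V \<subseteq> M"
  unfolding subspace_prod_def by (rule span_subset_subspace) (use assms in auto)

lemma prodsp_span_subset:
  assumes "subspace K M A" "F \<subseteq> carrier A" "G \<subseteq> carrier A"
    and "\<And>f g. f \<in> F \<Longrightarrow> g \<in> G \<Longrightarrow> f \<otimes>\<^bsub>A\<^esub> g \<in> M"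
  shows "prodsp (span F) (span G) \<subseteq> M"
  using span_mult_in_subspace[OF assms] by (intro prodsp_subset[OF assms(1)])

lemma fd_prodsp:
  assumes "fd_subspace K A L" "fd_subspace K A V"
  shows "fd_subspace K A (prodsp L V)"
proof -
  obtain F where F: "finite F" "F \<subseteq> carrier A" "span F = L" using fd_subspace_basis[OF assms(1)] .
  obtain G where G: "finite G" "G \<subseteq> carrier A" "span G = V" using fd_subspace_basis[OF assms(2)] .
  let ?P = "(\<lambda>(f, g). f \<otimes>\<^bsub>A\<^esub> g) ` (F \<times> G)"
  have P: "finite ?P" "?P \<subseteq> carrier A" using F G by auto
  have "prodsp (span F) (span G) \<subseteq> span ?P"
    by (rule prodsp_span_subset[OF span_is_subspace[OF P(2)] F(2) G(2)])
       (use in_own_span[OF P(2)] in auto)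
  then show ?thesis
    using fd_subspace_mono(1)[OF fd_subspace_span(1)[OF P] prodsp_carrier]
      F(3) G(3) span_is_subset2 F(2) G(2) by blast
qed

lemma prodsp_mono:
  assumes "L' \<subseteq> carrier A" "V' \<subseteq> carrier A" "L \<subseteq> L'" "V \<subseteq> V'"
  shows "prodsp L V \<subseteq> prodsp L' V'"
  by (rule prodsp_subset[OF prodsp_carrier[OF assms(1,2)]])
     (use assms mult_in_prodsp[OF assms(1,2)] in blast)

lemma subset_prodsp:
  assumes "L \<subseteq> carrier A" "V \<subseteq> carrier A" "\<one>\<^bsub>A\<^esub> \<in> V"
  shows "L \<subseteq> prodsp L V"
  using mult_in_prodsp[OF assms(1,2) _ assms(3)] assms(1) r_one by (metis subset_eq)

text \<open>If \<open>L\<close> is invariant, then \<open>(L + W) V \<subseteq> L + W V\<close>. This exceeds \<open>L\<close> by at most \<open>dim (W V)\<close> dimensions,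
  a bound that does not depend on \<open>L\<close>.\<close>

lemma large_invariant_subspaces_imp_exhaustively_amenable:
  assumes large: "\<And>m. \<exists>L. invariant_subspace K A L \<and> fd_subspace K A L \<and> m \<le> sdim K A L"
  shows "exhaustively_amenable_module K A A (mult A)"
  unfolding exhaustively_amenable_module_def
proof (intro allI impI)
  fix V W :: "'a set" and \<epsilon> :: real
  assume "fd_subspace K A V \<and> \<epsilon> > 0 \<and> fd_subspace K A W"
  then have V: "fd_subspace K A V" and \<epsilon>: "\<epsilon> > 0" and W: "fd_subspace K A W" by auto
  obtain P where P: "finite P" "P \<subseteq> carrier A" "span P = prodsp W V"
    using fd_subspace_basis[OF fd_prodsp[OF W V]] .
  obtain m :: nat where m: "real (card P) < \<epsilon> * real m"
    using reals_Archimedean3[OF \<epsilon>] by (metis mult.commute)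
  obtain L where L: "invariant_subspace K A L" "fd_subspace K A L" "m \<le> sdim K A L"
    using large by blast
  obtain F where F: "finite F" "F \<subseteq> carrier A" "span F = W" using fd_subspace_basis[OF W] .
  have sub: "subspace K L A" and LA: "L \<subseteq> carrier A" using L(2) fd_subspaceD subspaceD(1) by blast+
  have VA: "V \<subseteq> carrier A" and WA: "W \<subseteq> carrier A"
    using V W fd_subspaceD subspaceD(1) by blast+
  let ?L = "span (L \<union> F)"
  have LF: "L \<union> F \<subseteq> carrier A" "L \<union> P \<subseteq> carrier A" using LA F P by auto
  have fdL: "fd_subspace K A ?L" using fd_subspace_span_Un(1)[OF L(2) F(1,2)] .
  have "prodsp ?L (span V) \<subseteq> span (L \<union> P)"
  proof (rule prodsp_span_subset[OF span_is_subspace[OF LF(2)] LF(1) VA])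
    fix f g assume f: "f \<in> L \<union> F" and g: "g \<in> V"
    have "f \<otimes>\<^bsub>A\<^esub> g \<in> L \<union> span P"
    proof (cases "f \<in> L")
      case True
      then show ?thesis using L(1) g VA unfolding invariant_subspace_def by blast
    next
      case False
      then have "f \<in> W" using f F in_own_span by blast
      then show ?thesis using mult_in_prodsp[OF WA VA _ g] P(3) by auto
    qed
    then show "f \<otimes>\<^bsub>A\<^esub> g \<in> span (L \<union> P)"
      using in_own_span[OF LF(2)] span_is_monotone[of P "L \<union> P"] by auto
  qed
  then have "prodsp ?L V \<subseteq> span (L \<union> P)"
    using span_subspace_id[OF fd_subspaceD[OF V]] by simp
  then have "sdim K A (prodsp ?L V) \<le> sdim K A L + card P"
    using fd_subspace_mono(2)[OF fd_subspace_span_Un(1)[OF L(2) P(1,2)]]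
      fd_subspace_span_Un(2)[OF L(2) P(1,2)] prodsp_carrier[of ?L V] VA fdL fd_subspaceD subspaceD(1)
    by (meson order_trans)
  moreover have "sdim K A L \<le> sdim K A ?L"
    using fd_subspace_mono(2)[OF fdL sub] in_own_span[OF LF(1)] by blast
  moreover have "real (card P) < \<epsilon> * real (sdim K A L)"
    using m L(3) \<epsilon> by (smt (verit) mult_left_mono of_nat_mono)
  ultimately have "real (sdim K A (prodsp ?L V)) < real (sdim K A ?L) + \<epsilon> * real (sdim K A ?L)"
    using \<epsilon> by (smt (verit) mult_left_mono of_nat_mono of_nat_add)
  then have "almost_invariant K A (mult A) V \<epsilon> ?L"
    unfolding almost_invariant_def using fdL by (simp add: algebra_simps)
  moreover have "W \<subseteq> ?L" using F(3) span_is_monotone[of F "L \<union> F"] by auto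
  ultimately show "\<exists>L. almost_invariant K A (mult A) V \<epsilon> L \<and> W \<subseteq> L" by blast
qed

end


section \<open>Ideals, homomorphisms and quotients of algebras\<close>

lemma (in assoc_algebra) subspace_imp_ideal:
  assumes I: "subspace K I A"
    and l: "\<And>a i. a \<in> carrier A \<Longrightarrow> i \<in> I \<Longrightarrow> a \<otimes>\<^bsub>A\<^esub> i \<in> I"
    and r: "\<And>a i. a \<in> carrier A \<Longrightarrow> i \<in> I \<Longrightarrow> i \<otimes>\<^bsub>A\<^esub> a \<in> I"
  shows "ideal I A"
proof (rule idealI)
  show "ring A" by unfold_locales
  have neg: "\<ominus>\<^bsub>A\<^esub> a \<in> I" if "a \<in> I" for a
    using subspaceD[OF I] that smult_minus_1[of a] by (metis a_inv_closed one_closed subsetD R.a_inv_closed R.one_closed)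
  show "subgroup I (add_monoid A)"
    by (rule add.subgroupI) (use subspaceD[OF I] neg in \<open>auto simp: a_inv_def\<close>)
qed (use l r in auto)

lemma (in assoc_algebra) ideal_imp_subspace:
  assumes "ideal I A"
  shows "subspace K I A"
proof (rule subspaceI)
  interpret I: ideal I A by fact
  show "I \<subseteq> carrier A" "\<zero>\<^bsub>A\<^esub> \<in> I" by (auto simp: I.Icarr I.zero_closed)
  show "v \<oplus>\<^bsub>A\<^esub> w \<in> I" if "v \<in> I" "w \<in> I" for v w using that by simp
  fix c v assume c: "c \<in> carrier K" and v: "v \<in> I"
  have "c \<odot>\<^bsub>A\<^esub> v = (c \<odot>\<^bsub>A\<^esub> \<one>\<^bsub>A\<^esub>) \<otimes>\<^bsub>A\<^esub> v"
    using c v I.Icarr by (simp add: smult_mult_left)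
  then show "c \<odot>\<^bsub>A\<^esub> v \<in> I" using c v I.I_l_closed by simp
qed

locale algebra_epi = A: assoc_algebra K A + B: assoc_algebra K B
  for K :: "('k, 'm) ring_scheme" and A :: "('k, 'a) module" and B :: "('k, 'b) module" +
  fixes h :: "'a \<Rightarrow> 'b"
  assumes surj: "h ` carrier A = carrier B"
    and add: "\<lbrakk>a \<in> carrier A; b \<in> carrier A\<rbrakk> \<Longrightarrow> h (a \<oplus>\<^bsub>A\<^esub> b) = h a \<oplus>\<^bsub>B\<^esub> h b"
    and mult: "\<lbrakk>a \<in> carrier A; b \<in> carrier A\<rbrakk> \<Longrightarrow> h (a \<otimes>\<^bsub>A\<^esub> b) = h a \<otimes>\<^bsub>B\<^esub> h b"
    and one: "h \<one>\<^bsub>A\<^esub> = \<one>\<^bsub>B\<^esub>"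
    and smult: "\<lbrakk>c \<in> carrier K; a \<in> carrier A\<rbrakk> \<Longrightarrow> h (c \<odot>\<^bsub>A\<^esub> a) = c \<odot>\<^bsub>B\<^esub> h a"
begin

lemma closed [simp]: "a \<in> carrier A \<Longrightarrow> h a \<in> carrier B"
  using surj by auto

lemma zero: "h \<zero>\<^bsub>A\<^esub> = \<zero>\<^bsub>B\<^esub>"
  using smult[of "\<zero>\<^bsub>K\<^esub>" "\<zero>\<^bsub>A\<^esub>"] by simp

lemma ring_hom_ring: "ring_hom_ring A B h"
proof -
  have "ring A" "ring B" by unfold_locales
  then show ?thesis
    by (rule ring_hom_ringI) (auto simp: add mult one)
qed

lemma word_image: "u \<in> lists X \<Longrightarrow> x \<in> X \<rightarrow> carrier A \<Longrightarrow>
    word_image A x u \<in> carrier A \<and> word_image B (h \<circ> x) u = h (word_image A x u)"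
  by (induction u) (auto simp: one mult Pi_def)

end

text \<open>All axioms of an algebra except the existence of negatives are identities, so they pass to
  the image of an algebra under a surjection that respects the operations.\<close>

lemma algebra_image:
  fixes K :: "('k, 'm) ring_scheme" and A :: "('k, 'a) module" and B :: "('k, 'b) module"
  assumes "assoc_algebra K A" and surj: "h ` carrier A = carrier B"
    and add: "\<And>a b. \<lbrakk>a \<in> carrier A; b \<in> carrier A\<rbrakk> \<Longrightarrow> h (a \<oplus>\<^bsub>A\<^esub> b) = h a \<oplus>\<^bsub>B\<^esub> h b"
    and mult: "\<And>a b. \<lbrakk>a \<in> carrier A; b \<in> carrier A\<rbrakk> \<Longrightarrow> h (a \<otimes>\<^bsub>A\<^esub> b) = h a \<otimes>\<^bsub>B\<^esub> h b"
    and one: "h \<one>\<^bsub>A\<^esub> = \<one>\<^bsub>B\<^esub>"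
    and zero: "h \<zero>\<^bsub>A\<^esub> = \<zero>\<^bsub>B\<^esub>"
    and smult: "\<And>c a. \<lbrakk>c \<in> carrier K; a \<in> carrier A\<rbrakk> \<Longrightarrow> h (c \<odot>\<^bsub>A\<^esub> a) = c \<odot>\<^bsub>B\<^esub> h a"
  shows "algebra_epi K A B h"
proof -
  interpret A: assoc_algebra K A by fact
  have lift: "\<exists>a\<in>carrier A. b = h a" if "b \<in> carrier B" for b using that surj by auto
  have hc: "h a \<in> carrier B" if "a \<in> carrier A" for a using that surj by auto
  note ops = add[symmetric] mult[symmetric] one[symmetric] zero[symmetric] smult[symmetric]
  have neg: "\<exists>v'\<in>carrier B. v \<oplus>\<^bsub>B\<^esub> v' = \<zero>\<^bsub>B\<^esub>" if v: "v \<in> carrier B" for v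
  proof -
    obtain a where a: "a \<in> carrier A" "v = h a" using lift[OF v] by blast
    have "v \<oplus>\<^bsub>B\<^esub> h (\<ominus>\<^bsub>A\<^esub> a) = \<zero>\<^bsub>B\<^esub>" using a by (simp add: ops A.r_neg)
    then show ?thesis using a hc by (meson A.a_inv_closed)
  qed
  have vs: "vectorspace K B"
  proof (rule vs_criteria)
    show "field K" by unfold_locales
    show "\<forall>v\<in>carrier B. \<exists>v'\<in>carrier B. v \<oplus>\<^bsub>B\<^esub> v' = \<zero>\<^bsub>B\<^esub>" using neg by blast
  qed (auto dest!: lift simp: ops hc A.a_ac A.smult_l_distr A.smult_r_distr A.smult_assoc1)
  then interpret B: vectorspace K B .
  have "ring B"
  proof (rule ringI)
    show "abelian_group B" by unfold_locales
    show "Group.monoid B"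
      by (rule monoidI) (auto dest!: lift simp: ops hc A.m_assoc)
  qed (auto dest!: lift simp: ops hc A.l_distr A.r_distr)
  then interpret B: ring B .
  have "assoc_algebra K B"
    by unfold_locales (auto dest!: lift simp: ops hc A.smult_mult_left A.smult_mult_right)
  then interpret B: assoc_algebra K B .
  show ?thesis
    by unfold_locales (use surj add mult one smult in auto)
qed

context assoc_algebra
begin

context
  fixes I :: "'a set"
  assumes I: "ideal I A"
begin

interpretation I: ideal I A by (rule I)

text \<open>All elements of a coset give the same member of the union that defines the scalar multiplication
  of \<^const>\<open>quot_algebra\<close>.\<close>

lemma coset_smult:
  assumes "c \<in> carrier K" "a \<in> carrier A"
  shows "c \<odot>\<^bsub>quot_algebra A I\<^esub> (I +>\<^bsub>A\<^esub> a) = I +>\<^bsub>A\<^esub> (c \<odot>\<^bsub>A\<^esub> a)"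
proof -
  have sub: "subspace K I A" using ideal_imp_subspace I .
  have "I +>\<^bsub>A\<^esub> (c \<odot>\<^bsub>A\<^esub> b) = I +>\<^bsub>A\<^esub> (c \<odot>\<^bsub>A\<^esub> a)" if b: "b \<in> I +>\<^bsub>A\<^esub> a" for b
  proof -
    obtain i where i: "i \<in> I" "b = i \<oplus>\<^bsub>A\<^esub> a" using b by (auto simp: a_r_coset_def')
    then have "c \<odot>\<^bsub>A\<^esub> b = c \<odot>\<^bsub>A\<^esub> i \<oplus>\<^bsub>A\<^esub> c \<odot>\<^bsub>A\<^esub> a"
      using assms I.Icarr by (simp add: smult_r_distr)
    then have "c \<odot>\<^bsub>A\<^esub> b \<in> I +>\<^bsub>A\<^esub> (c \<odot>\<^bsub>A\<^esub> a)"
      using subspaceD(4)[OF sub assms(1) i(1)] by (auto simp: a_r_coset_def')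
    then have "I +>\<^bsub>A\<^esub> (c \<odot>\<^bsub>A\<^esub> a) = I +>\<^bsub>A\<^esub> (c \<odot>\<^bsub>A\<^esub> b)"
      by (rule I.a_repr_independence'[OF _ smult_closed[OF assms]])
    then show ?thesis by (rule sym)
  qed
  then have "(\<Union>b\<in>I +>\<^bsub>A\<^esub> a. I +>\<^bsub>A\<^esub> (c \<odot>\<^bsub>A\<^esub> b)) = (\<Union>b\<in>I +>\<^bsub>A\<^esub> a. I +>\<^bsub>A\<^esub> (c \<odot>\<^bsub>A\<^esub> a))"
    by (intro SUP_cong refl)
  moreover have "a \<in> I +>\<^bsub>A\<^esub> a" by (rule I.a_rcos_self[OF assms(2)])
  ultimately show ?thesis by (auto simp only: quot_algebra_def module.simps)
qed

lemma quot_algebra_epi: "algebra_epi K A (quot_algebra A I) ((+>\<^bsub>A\<^esub>) I)"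
proof (rule algebra_image)
  show "assoc_algebra K A" by unfold_locales
  note h = I.rcos_ring_hom
  show "(+>\<^bsub>A\<^esub>) I ` carrier A = carrier (quot_algebra A I)"
    by (auto simp: quot_algebra_def FactRing_def A_RCOSETS_def')
  show "I +>\<^bsub>A\<^esub> \<zero>\<^bsub>A\<^esub> = \<zero>\<^bsub>quot_algebra A I\<^esub>"
    using I.a_rcos_const[OF I.zero_closed] by (simp add: quot_algebra_def FactRing_def)
  show "I +>\<^bsub>A\<^esub> (a \<oplus>\<^bsub>A\<^esub> b) = (I +>\<^bsub>A\<^esub> a) \<oplus>\<^bsub>quot_algebra A I\<^esub> (I +>\<^bsub>A\<^esub> b)"
    if "a \<in> carrier A" "b \<in> carrier A" for a b
    using ring_hom_memE(3)[OF h that] by (simp only: quot_algebra_def ring.simps module.simps)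
  show "I +>\<^bsub>A\<^esub> (a \<otimes>\<^bsub>A\<^esub> b) = (I +>\<^bsub>A\<^esub> a) \<otimes>\<^bsub>quot_algebra A I\<^esub> (I +>\<^bsub>A\<^esub> b)"
    if "a \<in> carrier A" "b \<in> carrier A" for a b
    using ring_hom_memE(2)[OF h that] by (simp only: quot_algebra_def monoid.simps)
  show "I +>\<^bsub>A\<^esub> \<one>\<^bsub>A\<^esub> = \<one>\<^bsub>quot_algebra A I\<^esub>"
    using ring_hom_memE(4)[OF h] by (simp only: quot_algebra_def monoid.simps)
  show "I +>\<^bsub>A\<^esub> (c \<odot>\<^bsub>A\<^esub> a) = c \<odot>\<^bsub>quot_algebra A I\<^esub> (I +>\<^bsub>A\<^esub> a)"
    if "c \<in> carrier K" "a \<in> carrier A" for c a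
    using coset_smult[OF that] by (rule sym)
qed

lemma coset_eq_zero_iff:
  "a \<in> carrier A \<Longrightarrow> I +>\<^bsub>A\<^esub> a = \<zero>\<^bsub>quot_algebra A I\<^esub> \<longleftrightarrow> a \<in> I"
  using I.a_rcos_self I.a_rcos_const
  by (auto simp: quot_algebra_def FactRing_def)

end
end

section \<open>The free algebra\<close>

context field
begin

definition conv :: "('x list \<Rightarrow> 'a) \<Rightarrow> ('x list \<Rightarrow> 'a) \<Rightarrow> 'x list \<Rightarrow> 'a" where
  "conv f g = (\<lambda>w. \<Oplus>i\<in>{..length w}. f (take i w) \<otimes> g (drop i w))"

lemma free_algebra_simps [simp]:
  "mult (free_algebra R X) = conv" "one (free_algebra R X) = free_word R []"
  "zero (free_algebra R X) = (\<lambda>w. \<zero>)" "add (free_algebra R X) = (\<lambda>f g w. f w \<oplus> g w)"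
  "smult (free_algebra R X) = (\<lambda>c f w. c \<otimes> f w)"
  by (simp_all add: free_algebra_def conv_def fun_eq_iff free_word_def)

lemma free_algebra_carrier:
  "f \<in> carrier (free_algebra R X) \<longleftrightarrow>
     (\<forall>w. f w \<in> carrier R) \<and> finite {w. f w \<noteq> \<zero>} \<and> (\<forall>w. f w \<noteq> \<zero> \<longrightarrow> w \<in> lists X)"
  by (auto simp: free_algebra_def)

lemma free_word_carrier [simp]: "u \<in> lists X \<Longrightarrow> free_word R u \<in> carrier (free_algebra R X)"
  by (auto simp: free_algebra_carrier free_word_def)

lemma free_algebra_vectorspace: "vectorspace R (free_algebra R X)"
proof (rule vs_criteria)
  show "field R" by unfold_locales
  show "\<forall>v w. v \<in> carrier (free_algebra R X) \<and> w \<in> carrier (free_algebra R X) \<longrightarrow>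
          v \<oplus>\<^bsub>free_algebra R X\<^esub> w \<in> carrier (free_algebra R X)"
  proof (intro allI impI)
    fix v w assume vw: "v \<in> carrier (free_algebra R X) \<and> w \<in> carrier (free_algebra R X)"
    then have "finite ({u. v u \<noteq> \<zero>} \<union> {u. w u \<noteq> \<zero>})" by (simp add: free_algebra_carrier)
    moreover have "{u. v u \<oplus> w u \<noteq> \<zero>} \<subseteq> {u. v u \<noteq> \<zero>} \<union> {u. w u \<noteq> \<zero>}" by auto
    ultimately have "finite {u. v u \<oplus> w u \<noteq> \<zero>}" by (rule rev_finite_subset)
    then show "v \<oplus>\<^bsub>free_algebra R X\<^esub> w \<in> carrier (free_algebra R X)"
      using vw by (simp add: free_algebra_carrier) (metis l_zero zero_closed)
  qed
  have sm: "(\<lambda>w. c \<otimes> f w) \<in> carrier (free_algebra R X)"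
    if "c \<in> carrier R" "f \<in> carrier (free_algebra R X)" for c f
  proof -
    have "{u. c \<otimes> f u \<noteq> \<zero>} \<subseteq> {u. f u \<noteq> \<zero>}" using that by auto
    then show ?thesis using that rev_finite_subset by (fastforce simp: free_algebra_carrier)
  qed
  then show "\<forall>c v. c \<in> carrier R \<and> v \<in> carrier (free_algebra R X) \<longrightarrow>
          c \<odot>\<^bsub>free_algebra R X\<^esub> v \<in> carrier (free_algebra R X)" by simp
  show "\<forall>v\<in>carrier (free_algebra R X). \<exists>v'\<in>carrier (free_algebra R X).
          v \<oplus>\<^bsub>free_algebra R X\<^esub> v' = \<zero>\<^bsub>free_algebra R X\<^esub>"
  proof
    fix v assume v: "v \<in> carrier (free_algebra R X)"
    have "v w \<oplus> \<ominus> \<one> \<otimes> v w = \<zero>" for w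
      using v by (simp add: free_algebra_carrier l_minus r_neg)
    then show "\<exists>v'\<in>carrier (free_algebra R X). v \<oplus>\<^bsub>free_algebra R X\<^esub> v' = \<zero>\<^bsub>free_algebra R X\<^esub>"
      using sm[of "\<ominus> \<one>" v] v by (intro bexI[of _ "\<lambda>w. \<ominus> \<one> \<otimes> v w"]) auto
  qed
qed (auto simp: free_algebra_carrier fun_eq_iff a_ac m_assoc l_distr r_distr)

text \<open>A subspace that contains every word of the support of \<open>f\<close> contains \<open>f\<close>. Applied to the
  subspace where an identity holds, this reduces linear identities to words.\<close>

lemma free_algebra_in_subspace:
  assumes W: "submodule R W (free_algebra R X)"
    and f: "f \<in> carrier (free_algebra R X)"
    and words: "\<And>w. f w \<noteq> \<zero> \<Longrightarrow> free_word R w \<in> W"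
  shows "f \<in> W"
proof -
  have "\<And>f. f \<in> carrier (free_algebra R X) \<Longrightarrow> (\<And>w. f w \<noteq> \<zero> \<Longrightarrow> free_word R w \<in> W)
      \<Longrightarrow> {w. f w \<noteq> \<zero>} = T \<Longrightarrow> f \<in> W" if "finite T" for T
    using that
  proof (induction T rule: finite_induct)
    case empty
    then have "f = \<zero>\<^bsub>free_algebra R X\<^esub>" by auto
    then show ?case using submodule.zero_closed[OF W] by (simp only:)
  next
    case (insert u T)
    let ?g = "f(u := \<zero>)"
    have fin: "finite {w. ?g w \<noteq> \<zero>}"
      by (rule finite_subset[of _ "insert u T"]) (use insert in auto)
    have g: "?g \<in> carrier (free_algebra R X)"
      using insert.prems(1) fin by (auto simp: free_algebra_carrier)
    have "{w. ?g w \<noteq> \<zero>} = T" using insert by auto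
    moreover have "free_word R w \<in> W" if "?g w \<noteq> \<zero>" for w
      using insert.prems(2)[of w] that by (simp split: if_splits)
    ultimately have gW: "?g \<in> W" using insert.IH[OF g] by blast
    have u: "f u \<noteq> \<zero>" "f u \<in> carrier R"
      using insert.prems by (auto simp: free_algebra_carrier)
    have "(\<lambda>w. f u \<otimes> free_word R u w) \<in> W"
      using submodule.smult_closed[OF W u(2) insert.prems(2)[OF u(1)]] by simp
    then have "(\<lambda>w. ?g w \<oplus> f u \<otimes> free_word R u w) \<in> W"
      using submodule.m_closed[OF W gW] by simp
    moreover have "(\<lambda>w. ?g w \<oplus> f u \<otimes> free_word R u w) = f"
      using insert.prems(1) by (auto simp: free_algebra_carrier free_word_def)
    ultimately show ?case by simp
  qed
  then show ?thesis using f words by (auto simp: free_algebra_carrier)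
qed

lemma free_algebra_linear_induct [consumes 1, case_names zero add smult word]:
  assumes f: "f \<in> carrier (free_algebra R X)"
    and "P (\<lambda>w. \<zero>)"
    and "\<And>f g. f \<in> carrier (free_algebra R X) \<Longrightarrow> g \<in> carrier (free_algebra R X) \<Longrightarrow> P f \<Longrightarrow> P g
           \<Longrightarrow> P (\<lambda>w. f w \<oplus> g w)"
    and "\<And>c f. c \<in> carrier R \<Longrightarrow> f \<in> carrier (free_algebra R X) \<Longrightarrow> P f \<Longrightarrow> P (\<lambda>w. c \<otimes> f w)"
    and "\<And>u. u \<in> lists X \<Longrightarrow> P (free_word R u)"
  shows "P f"
proof -
  interpret F: vectorspace R "free_algebra R X" by (rule free_algebra_vectorspace)
  have m: "module R (free_algebra R X)" by unfold_locales
  have "submodule R {f \<in> carrier (free_algebra R X). P f} (free_algebra R X)"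
    unfolding submodule_def
    using assms(2-4) m F.M.a_closed F.smult_closed F.M.zero_closed by auto
  moreover have "free_word R w \<in> {f \<in> carrier (free_algebra R X). P f}" if "f w \<noteq> \<zero>" for w
  proof -
    have "w \<in> lists X" using f that by (simp add: free_algebra_carrier)
    then show ?thesis using assms(5)[of w] free_word_carrier[of w X] by (intro CollectI conjI)
  qed
  ultimately have "f \<in> {f \<in> carrier (free_algebra R X). P f}"
    by (rule free_algebra_in_subspace[OF _ f])
  then show ?thesis by simp
qed

lemma conv_nonzero:
  assumes "conv f g w \<noteq> \<zero>" "f \<in> carrier (free_algebra R X)" "g \<in> carrier (free_algebra R X)"
  obtains i where "f (take i w) \<noteq> \<zero>" "g (drop i w) \<noteq> \<zero>"
proof (rule ccontr)
  assume none: "\<not> thesis"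
  have "f (take i w) \<otimes> g (drop i w) = \<zero>" for i
  proof -
    have "f (take i w) = \<zero> \<or> g (drop i w) = \<zero>" using none that by blast
    then show ?thesis using assms(2,3) by (auto simp: free_algebra_carrier)
  qed
  then have "conv f g w = \<zero>" unfolding conv_def by (intro add.finprod_one_eqI) simp
  then show False using assms(1) by simp
qed

lemma conv_closed:
  assumes "f \<in> carrier (free_algebra R X)" "g \<in> carrier (free_algebra R X)"
  shows "conv f g \<in> carrier (free_algebra R X)"
proof -
  have nz: "\<exists>i. f (take i w) \<noteq> \<zero> \<and> g (drop i w) \<noteq> \<zero>" if "conv f g w \<noteq> \<zero>" for w
    using conv_nonzero[OF that assms] by blast
  have "{w. conv f g w \<noteq> \<zero>} \<subseteq> (\<lambda>(u, v). u @ v) ` ({u. f u \<noteq> \<zero>} \<times> {v. g v \<noteq> \<zero>})"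
    using nz by (force simp: image_iff)
  then have "finite {w. conv f g w \<noteq> \<zero>}"
    by (rule finite_subset) (use assms in \<open>auto simp: free_algebra_carrier\<close>)
  moreover have "w \<in> lists X" if nzw: "conv f g w \<noteq> \<zero>" for w
  proof -
    obtain i where "take i w \<in> lists X" "drop i w \<in> lists X"
      using nz[OF nzw] assms unfolding free_algebra_carrier by metis
    then show ?thesis by (metis append_in_lists_conv append_take_drop_id)
  qed
  moreover have "conv f g w \<in> carrier R" for w
    unfolding conv_def using assms by (auto simp: free_algebra_carrier)
  ultimately show ?thesis by (simp add: free_algebra_carrier)
qed

lemma conv_add_left:
  assumes "\<And>w. f w \<in> carrier R" "\<And>w. g w \<in> carrier R" "\<And>w. h w \<in> carrier R"
  shows "conv (\<lambda>w. f w \<oplus> g w) h = (\<lambda>w. conv f h w \<oplus> conv g h w)"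
  unfolding conv_def using assms by (auto simp: fun_eq_iff l_distr finsum_addf)

lemma conv_add_right:
  assumes "\<And>w. f w \<in> carrier R" "\<And>w. g w \<in> carrier R" "\<And>w. h w \<in> carrier R"
  shows "conv f (\<lambda>w. g w \<oplus> h w) = (\<lambda>w. conv f g w \<oplus> conv f h w)"
  unfolding conv_def using assms by (auto simp: fun_eq_iff r_distr finsum_addf)

lemma conv_smult_left:
  assumes "c \<in> carrier R" "\<And>w. f w \<in> carrier R" "\<And>w. g w \<in> carrier R"
  shows "conv (\<lambda>w. c \<otimes> f w) g = (\<lambda>w. c \<otimes> conv f g w)"
  unfolding conv_def using assms
  by (auto simp: fun_eq_iff finsum_rdistr m_assoc intro!: finsum_cong')

lemma conv_smult_right:
  assumes "c \<in> carrier R" "\<And>w. f w \<in> carrier R" "\<And>w. g w \<in> carrier R"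
  shows "conv f (\<lambda>w. c \<otimes> g w) = (\<lambda>w. c \<otimes> conv f g w)"
  unfolding conv_def using assms
  by (auto simp: fun_eq_iff finsum_rdistr m_lcomm intro!: finsum_cong')

lemma conv_zero:
  assumes "\<And>w. f w \<in> carrier R"
  shows "conv f (\<lambda>w. \<zero>) = (\<lambda>w. \<zero>)" "conv (\<lambda>w. \<zero>) f = (\<lambda>w. \<zero>)"
  unfolding conv_def using assms by (auto simp: fun_eq_iff)

lemma conv_words: "conv (free_word R u) (free_word R v) = free_word R (u @ v)"
proof
  fix w
  show "conv (free_word R u) (free_word R v) w = free_word R (u @ v) w"
  proof (cases "w = u @ v")
    case True
    have "free_word R u (take i w) \<otimes> free_word R v (drop i w) =
        (if length u = i then \<one> else \<zero>)" if "i \<in> {..length w}" for i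
    proof (cases "length u = i")
      case False
      then have "take i w \<noteq> u" using that by auto
      then show ?thesis using False by (simp add: free_word_def)
    qed (use True in \<open>auto simp: free_word_def\<close>)
    then have "conv (free_word R u) (free_word R v) w =
        (\<Oplus>i\<in>{..length w}. if length u = i then \<one> else \<zero>)"
      unfolding conv_def by (intro finsum_cong') auto
    also have "\<dots> = \<one>"
      using finsum_singleton[of "length u" "{..length w}" "\<lambda>_. \<one>"] True by simp
    finally show ?thesis using True by (simp add: free_word_def)
  next
    case False
    then have "take i w \<noteq> u \<or> drop i w \<noteq> v" for i by (metis append_take_drop_id)
    then have "free_word R u (take i w) \<otimes> free_word R v (drop i w) = \<zero>" for i
      using False by (auto simp: free_word_def)
    then have "conv (free_word R u) (free_word R v) w = \<zero>"
      unfolding conv_def by (intro add.finprod_one_eqI) simp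
    then show ?thesis using False by (simp add: free_word_def)
  qed
qed

text \<open>Both sides of the associative law are linear in each factor, so the law reduces to the
  associativity of concatenation.\<close>

lemma free_algebra_assoc_algebra: "assoc_algebra R (free_algebra R X)"
proof -
  interpret F: vectorspace R "free_algebra R X" by (rule free_algebra_vectorspace)
  let ?F = "carrier (free_algebra R X)"
  have c [simp]: "f w \<in> carrier R" if "f \<in> ?F" for f w
    using that by (simp add: free_algebra_carrier)
  have w [simp]: "free_word R u v \<in> carrier R" for u v :: "'d list"
    by (simp add: free_word_def)
  have cc [simp]: "conv f g w \<in> carrier R" if "f \<in> ?F" "g \<in> ?F" for f g w
    using conv_closed[OF that] by simp
  note lin = conv_add_left conv_add_right conv_smult_left conv_smult_right conv_zero
  have one_l: "conv (free_word R []) f = f" if "f \<in> ?F" for f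
    using that by (induction rule: free_algebra_linear_induct) (simp_all add: lin conv_words)
  have one_r: "conv f (free_word R []) = f" if "f \<in> ?F" for f
    using that by (induction rule: free_algebra_linear_induct) (simp_all add: lin conv_words)
  have a3: "conv (conv (free_word R u) (free_word R v)) h =
      conv (free_word R u) (conv (free_word R v) h)"
    if "h \<in> ?F" "u \<in> lists X" "v \<in> lists X" for h u v
    using that
  proof (induction rule: free_algebra_linear_induct)
    case (add f g)
    then show ?case
      using cc[OF conv_closed[OF free_word_carrier free_word_carrier]] by (simp add: lin)
  next
    case (smult c f)
    then show ?case
      using cc[OF conv_closed[OF free_word_carrier free_word_carrier]] by (simp add: lin)
  qed (simp_all add: lin conv_words)
  have a2: "conv (conv (free_word R u) g) h = conv (free_word R u) (conv g h)"
    if "g \<in> ?F" "h \<in> ?F" "u \<in> lists X" for g h u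
    using that by (induction rule: free_algebra_linear_induct) (simp_all add: lin a3)
  have a1: "conv (conv f g) h = conv f (conv g h)" if "f \<in> ?F" "g \<in> ?F" "h \<in> ?F" for f g h
    using that by (induction rule: free_algebra_linear_induct) (simp_all add: lin a2 conv_closed)
  have "ring (free_algebra R X)"
  proof (rule ringI)
    show "abelian_group (free_algebra R X)" by unfold_locales
    show "Group.monoid (free_algebra R X)"
      by (rule monoidI) (simp_all add: conv_closed one_l one_r a1)
  qed (simp_all add: lin)
  then interpret F: ring "free_algebra R X" .
  show ?thesis by unfold_locales (simp_all add: lin)
qed

text \<open>An ideal generated by words contains every word that occurs in one of its elements: the elements
  of the free algebra all of whose words lie in the ideal already form an ideal.\<close>

lemma monomial_relations_support:
  assumes rel: "Rel \<subseteq> lists X" and f: "f \<in> monomial_relations R X Rel" and w: "f w \<noteq> \<zero>"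
  shows "free_word R w \<in> monomial_relations R X Rel"
proof -
  interpret F: assoc_algebra R "free_algebra R X" by (rule free_algebra_assoc_algebra)
  let ?F = "carrier (free_algebra R X)"
  define I where "I = monomial_relations R X Rel"
  have gen: "free_word R ` Rel \<subseteq> ?F" by (intro image_subsetI free_word_carrier subsetD[OF rel])
  have I: "ideal I (free_algebra R X)"
    unfolding I_def monomial_relations_def using F.genideal_ideal[OF gen] .
  interpret I: ideal I "free_algebra R X" by (rule I)
  define J where "J = {f \<in> ?F. \<forall>w. f w \<noteq> \<zero> \<longrightarrow> free_word R w \<in> I}"
  have split_mem: "free_word R w \<in> I"
    if "free_word R (take i w) \<in> I \<or> free_word R (drop i w) \<in> I"
      and "take i w \<in> lists X" "drop i w \<in> lists X" for i w
    using I.I_l_closed[of "free_word R (drop i w)" "free_word R (take i w)"]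
      I.I_r_closed[of "free_word R (take i w)" "free_word R (drop i w)"] that
    by (auto simp: conv_words)
  have "ideal J (free_algebra R X)"
  proof (rule F.subspace_imp_ideal)
    show "subspace R J (free_algebra R X)"
    proof (rule F.subspaceI)
      show "J \<subseteq> ?F" by (auto simp: J_def)
      show "\<zero>\<^bsub>free_algebra R X\<^esub> \<in> J" using F.M.zero_closed by (simp add: J_def)
      fix g h assume "g \<in> J" "h \<in> J"
      then show "g \<oplus>\<^bsub>free_algebra R X\<^esub> h \<in> J"
        using F.M.a_closed[of g h] unfolding J_def by simp (metis l_zero zero_closed)
    next
      fix c g assume "c \<in> carrier R" "g \<in> J"
      then show "c \<odot>\<^bsub>free_algebra R X\<^esub> g \<in> J"
        using F.smult_closed[of c g] unfolding J_def by simp (metis r_null)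
    qed
    fix a g assume a: "a \<in> ?F" and g: "g \<in> J"
    then have gF: "g \<in> ?F" by (simp add: J_def)
    have sup: "u \<in> lists X" if "f \<in> ?F" "f u \<noteq> \<zero>" for f u
      using that by (simp add: free_algebra_carrier)
    have "free_word R w \<in> I" if nzw: "conv a g w \<noteq> \<zero>" for w
    proof -
      obtain i where "a (take i w) \<noteq> \<zero>" "g (drop i w) \<noteq> \<zero>" using conv_nonzero[OF nzw a gF] .
      then show ?thesis using g a gF sup by (intro split_mem[of i]) (auto simp: J_def)
    qed
    then show "a \<otimes>\<^bsub>free_algebra R X\<^esub> g \<in> J" using conv_closed[OF a gF] by (simp add: J_def)
    have "free_word R w \<in> I" if nzw: "conv g a w \<noteq> \<zero>" for w
    proof -
      obtain i where "g (take i w) \<noteq> \<zero>" "a (drop i w) \<noteq> \<zero>" using conv_nonzero[OF nzw gF a] .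
      then show ?thesis using g a gF sup by (intro split_mem[of i]) (auto simp: J_def)
    qed
    then show "g \<otimes>\<^bsub>free_algebra R X\<^esub> a \<in> J" using conv_closed[OF gF a] by (simp add: J_def)
  qed
  moreover have "free_word R ` Rel \<subseteq> J"
  proof -
    have "free_word R ` Rel \<subseteq> I"
      unfolding I_def monomial_relations_def using F.genideal_self[OF gen] .
    then show ?thesis using gen by (auto simp: J_def free_word_def split: if_splits)
  qed
  ultimately have "I \<subseteq> J"
    unfolding I_def monomial_relations_def by (intro F.genideal_minimal)
  then show ?thesis using f w unfolding I_def J_def by auto
qed

end


section \<open>Monomial algebras as algebras with a basis of words\<close>

context assoc_algebra
begin

lemma word_image_closed:
  "u \<in> lists X \<Longrightarrow> x \<in> X \<rightarrow> carrier A \<Longrightarrow> word_image A x u \<in> carrier A"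
  by (induction u) (auto simp: Pi_def)

lemma word_image_append:
  assumes u: "u \<in> lists X" and v: "v \<in> lists X" and x: "x \<in> X \<rightarrow> carrier A"
  shows "word_image A x (u @ v) = word_image A x u \<otimes>\<^bsub>A\<^esub> word_image A x v"
  using u
proof (induction u rule: lists.induct)
  case Nil
  then show ?case using word_image_closed[OF v x] by simp
next
  case (Cons i u)
  have "x i \<in> carrier A" using x Cons by auto
  then show ?case
    using Cons word_image_closed[OF v x] word_image_closed[OF Cons.hyps(2) x] by (simp add: m_assoc)
qed

definition word_eval :: "('x \<Rightarrow> 'a) \<Rightarrow> ('x list \<Rightarrow> 'k) \<Rightarrow> 'a" where
  "word_eval x f = (\<Oplus>\<^bsub>A\<^esub>w\<in>{w. f w \<noteq> \<zero>\<^bsub>K\<^esub>}. f w \<odot>\<^bsub>A\<^esub> word_image A x w)"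

context
  fixes X :: "'x set" and x :: "'x \<Rightarrow> 'a"
  assumes x: "x \<in> X \<rightarrow> carrier A"
begin

lemma word_eval_superset:
  assumes "f \<in> carrier (free_algebra K X)" "finite T" "{w. f w \<noteq> \<zero>\<^bsub>K\<^esub>} \<subseteq> T" "T \<subseteq> lists X"
  shows "word_eval x f = (\<Oplus>\<^bsub>A\<^esub>w\<in>T. f w \<odot>\<^bsub>A\<^esub> word_image A x w)"
  unfolding word_eval_def
proof (rule add.finprod_mono_neutral_cong_left[OF assms(2,3)])
  show "f i \<odot>\<^bsub>A\<^esub> word_image A x i = \<zero>\<^bsub>A\<^esub>" if "i \<in> T - {w. f w \<noteq> \<zero>\<^bsub>K\<^esub>}" for i
  proof -
    have "i \<in> lists X" "f i = \<zero>\<^bsub>K\<^esub>" using that assms(4) by auto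
    then show ?thesis using word_image_closed[OF _ x] by simp
  qed
  show "(\<lambda>w. f w \<odot>\<^bsub>A\<^esub> word_image A x w) \<in> T \<rightarrow> carrier A"
  proof
    fix w assume "w \<in> T"
    then have "word_image A x w \<in> carrier A" using assms(4) word_image_closed[OF _ x] by blast
    then show "f w \<odot>\<^bsub>A\<^esub> word_image A x w \<in> carrier A"
      using assms(1) by (simp add: free_algebra_carrier)
  qed
qed simp

lemma word_eval_closed:
  assumes "f \<in> carrier (free_algebra K X)"
  shows "word_eval x f \<in> carrier A"
  unfolding word_eval_def
proof (intro finsum_closed Pi_I)
  fix w assume "w \<in> {w. f w \<noteq> \<zero>\<^bsub>K\<^esub>}"
  then have "w \<in> lists X" "f w \<in> carrier K" using assms by (simp_all add: free_algebra_carrier)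
  then show "f w \<odot>\<^bsub>A\<^esub> word_image A x w \<in> carrier A" using word_image_closed[OF _ x] by simp
qed

lemma word_eval_add:
  assumes f: "f \<in> carrier (free_algebra K X)" and g: "g \<in> carrier (free_algebra K X)"
  shows "word_eval x (\<lambda>w. f w \<oplus>\<^bsub>K\<^esub> g w) = word_eval x f \<oplus>\<^bsub>A\<^esub> word_eval x g"
proof -
  interpret F: assoc_algebra K "free_algebra K X" by (rule free_algebra_assoc_algebra)
  let ?T = "{w. f w \<noteq> \<zero>\<^bsub>K\<^esub>} \<union> {w. g w \<noteq> \<zero>\<^bsub>K\<^esub>}"
  have T: "finite ?T" "?T \<subseteq> lists X" using f g by (auto simp: free_algebra_carrier)
  have fg: "(\<lambda>w. f w \<oplus>\<^bsub>K\<^esub> g w) \<in> carrier (free_algebra K X)"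
    using F.M.a_closed[OF f g] by simp
  have c: "f w \<in> carrier K" "g w \<in> carrier K" for w using f g by (auto simp: free_algebra_carrier)
  have wi: "word_image A x w \<in> carrier A" if "w \<in> ?T" for w
    using that T word_image_closed[OF _ x] by blast
  have "word_eval x (\<lambda>w. f w \<oplus>\<^bsub>K\<^esub> g w)
      = (\<Oplus>\<^bsub>A\<^esub>w\<in>?T. (f w \<oplus>\<^bsub>K\<^esub> g w) \<odot>\<^bsub>A\<^esub> word_image A x w)"
    by (rule word_eval_superset[OF fg T(1) _ T(2)]) auto
  also have "\<dots> = (\<Oplus>\<^bsub>A\<^esub>w\<in>?T. f w \<odot>\<^bsub>A\<^esub> word_image A x w \<oplus>\<^bsub>A\<^esub> g w \<odot>\<^bsub>A\<^esub> word_image A x w)"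
    using c wi by (intro finsum_cong') (auto simp: smult_l_distr)
  also have "\<dots> = (\<Oplus>\<^bsub>A\<^esub>w\<in>?T. f w \<odot>\<^bsub>A\<^esub> word_image A x w) \<oplus>\<^bsub>A\<^esub>
      (\<Oplus>\<^bsub>A\<^esub>w\<in>?T. g w \<odot>\<^bsub>A\<^esub> word_image A x w)"
    using c wi by (intro finsum_addf) auto
  also have "\<dots> = word_eval x f \<oplus>\<^bsub>A\<^esub> word_eval x g"
    using word_eval_superset[OF f T(1) _ T(2)] word_eval_superset[OF g T(1) _ T(2)] by simp
  finally show ?thesis .
qed

lemma word_eval_smult:
  assumes c: "c \<in> carrier K" and f: "f \<in> carrier (free_algebra K X)"
  shows "word_eval x (\<lambda>w. c \<otimes>\<^bsub>K\<^esub> f w) = c \<odot>\<^bsub>A\<^esub> word_eval x f"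
proof -
  interpret F: assoc_algebra K "free_algebra K X" by (rule free_algebra_assoc_algebra)
  let ?T = "{w. f w \<noteq> \<zero>\<^bsub>K\<^esub>}"
  have T: "finite ?T" "?T \<subseteq> lists X" using f by (auto simp: free_algebra_carrier)
  have cf: "(\<lambda>w. c \<otimes>\<^bsub>K\<^esub> f w) \<in> carrier (free_algebra K X)"
    using F.smult_closed[OF c f] by simp
  have k: "f w \<in> carrier K" for w using f by (auto simp: free_algebra_carrier)
  have wi: "word_image A x w \<in> carrier A" if "w \<in> ?T" for w
    using that T word_image_closed[OF _ x] by blast
  have "word_eval x (\<lambda>w. c \<otimes>\<^bsub>K\<^esub> f w)
      = (\<Oplus>\<^bsub>A\<^esub>w\<in>?T. (c \<otimes>\<^bsub>K\<^esub> f w) \<odot>\<^bsub>A\<^esub> word_image A x w)"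
    by (rule word_eval_superset[OF cf T(1) _ T(2)]) (use c k in auto)
  also have "\<dots> = (\<Oplus>\<^bsub>A\<^esub>w\<in>?T. c \<odot>\<^bsub>A\<^esub> (f w \<odot>\<^bsub>A\<^esub> word_image A x w))"
    using c k wi by (intro finsum_cong') (auto simp: smult_assoc1)
  also have "\<dots> = c \<odot>\<^bsub>A\<^esub> word_eval x f"
    unfolding word_eval_def using c k wi T(1) by (subst finsum_smult) auto
  finally show ?thesis .
qed

lemma word_eval_zero: "word_eval x (\<lambda>w. \<zero>\<^bsub>K\<^esub>) = \<zero>\<^bsub>A\<^esub>"
  by (simp add: word_eval_def)

lemma word_eval_word: "u \<in> lists X \<Longrightarrow> word_eval x (free_word K u) = word_image A x u"
proof -
  assume u: "u \<in> lists X"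
  have "{w. free_word K u w \<noteq> \<zero>\<^bsub>K\<^esub>} = {u}" by (auto simp: free_word_def)
  then show ?thesis
    using word_image_closed[OF u x] by (simp add: word_eval_def free_word_def)
qed

text \<open>By linearity in both factors it suffices to compare words.\<close>

lemma word_eval_mult:
  assumes f: "f \<in> carrier (free_algebra K X)" and g: "g \<in> carrier (free_algebra K X)"
  shows "word_eval x (conv f g) = word_eval x f \<otimes>\<^bsub>A\<^esub> word_eval x g"
proof -
  note lin = conv_add_left conv_add_right conv_smult_left conv_smult_right conv_zero
    word_eval_add word_eval_smult word_eval_zero
  have c [simp]: "f w \<in> carrier K" if "f \<in> carrier (free_algebra K X)" for f w
    using that by (simp add: free_algebra_carrier)
  have w [simp]: "free_word K u v \<in> carrier K" for u v :: "'x list"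
    by (simp add: free_word_def)
  have *: "word_eval x (conv (free_word K u) g) = word_image A x u \<otimes>\<^bsub>A\<^esub> word_eval x g"
    if u: "u \<in> lists X" for u
    using g
  proof (induction rule: free_algebra_linear_induct)
    case zero
    then show ?case using word_image_closed[OF u x] by (simp add: lin)
  next
    case (add f g)
    then show ?case using word_image_closed[OF u x] conv_closed[OF free_word_carrier[OF u]]
      by (simp add: lin word_eval_closed r_distr)
  next
    case (smult c f)
    then show ?case using word_image_closed[OF u x] conv_closed[OF free_word_carrier[OF u]]
      by (simp add: lin word_eval_closed smult_mult_right)
  next
    case (word v)
    then have "u @ v \<in> lists X" using u by simp
    then show ?case using word u word_image_append[OF u word x] word_eval_word by (simp only: conv_words)
  qed
  show ?thesis
    using f
  proof (induction rule: free_algebra_linear_induct)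
    case zero
    then show ?case using g by (simp add: lin word_eval_closed)
  next
    case (add f f')
    then show ?case using g conv_closed[OF _ g] by (simp add: lin word_eval_closed l_distr)
  next
    case (smult c f)
    then show ?case using g conv_closed[OF _ g] by (simp add: lin word_eval_closed smult_mult_left)
  next
    case (word u)
    then show ?case using * word_eval_word by simp
  qed
qed

lemma word_eval_in_subspace:
  assumes M: "subspace K M A" and f: "f \<in> carrier (free_algebra K X)"
    and words: "\<And>w. f w \<noteq> \<zero>\<^bsub>K\<^esub> \<Longrightarrow> word_image A x w \<in> M"
  shows "word_eval x f \<in> M"
proof -
  interpret F: assoc_algebra K "free_algebra K X" by (rule free_algebra_assoc_algebra)
  let ?W = "{g \<in> carrier (free_algebra K X). word_eval x g \<in> M}"
  have "subspace K ?W (free_algebra K X)"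
  proof (rule F.subspaceI)
    show "\<zero>\<^bsub>free_algebra K X\<^esub> \<in> ?W"
      using F.M.zero_closed subspaceD(2)[OF M] by (simp add: word_eval_zero)
    show "g \<oplus>\<^bsub>free_algebra K X\<^esub> g' \<in> ?W" if "g \<in> ?W" "g' \<in> ?W" for g g'
      using that F.M.a_closed[of g g'] subspaceD(3)[OF M] by (simp add: word_eval_add)
    show "c \<odot>\<^bsub>free_algebra K X\<^esub> g \<in> ?W" if "c \<in> carrier K" "g \<in> ?W" for c g
      using that F.smult_closed[of c g] subspaceD(4)[OF M] by (simp add: word_eval_smult)
  qed auto
  then have "f \<in> ?W"
  proof (intro free_algebra_in_subspace[OF _ f])
    fix w assume w: "f w \<noteq> \<zero>\<^bsub>K\<^esub>"
    then have "w \<in> lists X" using f by (simp add: free_algebra_carrier)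
    then show "free_word K w \<in> ?W" using words[OF w] word_eval_word[of w] free_word_carrier[of w X]
      by simp
  qed simp
  then show ?thesis by simp
qed

lemma word_eval_in_span:
  assumes "f \<in> carrier (free_algebra K X)" "{w. f w \<noteq> \<zero>\<^bsub>K\<^esub>} \<subseteq> U" "U \<subseteq> lists X"
  shows "word_eval x f \<in> span (word_image A x ` U)"
proof (rule word_eval_in_subspace[OF _ assms(1)])
  have U: "word_image A x ` U \<subseteq> carrier A" using assms(3) word_image_closed[OF _ x] by blast
  show "subspace K (span (word_image A x ` U)) A" by (rule span_is_subspace[OF U])
  show "word_image A x w \<in> span (word_image A x ` U)" if "f w \<noteq> \<zero>\<^bsub>K\<^esub>" for w
    using in_own_span[OF U] that assms(2) by blast
qed

lemma in_span_words:
  assumes U: "U \<subseteq> lists X" and a: "a \<in> span (word_image A x ` U)"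
  obtains f where "f \<in> carrier (free_algebra K X)" "{w. f w \<noteq> \<zero>\<^bsub>K\<^esub>} \<subseteq> U" "word_eval x f = a"
proof -
  interpret F: assoc_algebra K "free_algebra K X" by (rule free_algebra_assoc_algebra)
  let ?F = "{f \<in> carrier (free_algebra K X). {w. f w \<noteq> \<zero>\<^bsub>K\<^esub>} \<subseteq> U}"
  have "subspace K (word_eval x ` ?F) A"
  proof (rule subspaceI)
    show "word_eval x ` ?F \<subseteq> carrier A" using word_eval_closed by blast
    show "\<zero>\<^bsub>A\<^esub> \<in> word_eval x ` ?F"
      using F.M.zero_closed word_eval_zero[symmetric] by (intro image_eqI[of _ _ "\<lambda>w. \<zero>\<^bsub>K\<^esub>"]) auto
    fix v w assume "v \<in> word_eval x ` ?F" "w \<in> word_eval x ` ?F"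
    then obtain f g where f: "f \<in> ?F" "v = word_eval x f" and g: "g \<in> ?F" "w = word_eval x g" by blast
    have "{w. f w \<oplus>\<^bsub>K\<^esub> g w \<noteq> \<zero>\<^bsub>K\<^esub>} \<subseteq> {w. f w \<noteq> \<zero>\<^bsub>K\<^esub>} \<union> {w. g w \<noteq> \<zero>\<^bsub>K\<^esub>}" by auto
    then have "(\<lambda>w. f w \<oplus>\<^bsub>K\<^esub> g w) \<in> ?F" using f g F.M.a_closed[of f g] by auto
    then show "v \<oplus>\<^bsub>A\<^esub> w \<in> word_eval x ` ?F"
      using f g word_eval_add[of f g] by (intro image_eqI[of _ _ "\<lambda>w. f w \<oplus>\<^bsub>K\<^esub> g w"]) auto
  next
    fix c v assume c: "c \<in> carrier K" and "v \<in> word_eval x ` ?F"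
    then obtain f where f: "f \<in> ?F" "v = word_eval x f" by blast
    have "{w. c \<otimes>\<^bsub>K\<^esub> f w \<noteq> \<zero>\<^bsub>K\<^esub>} \<subseteq> {w. f w \<noteq> \<zero>\<^bsub>K\<^esub>}" using c by auto
    then have "(\<lambda>w. c \<otimes>\<^bsub>K\<^esub> f w) \<in> ?F" using f F.smult_closed[OF c, of f] by auto
    then show "c \<odot>\<^bsub>A\<^esub> v \<in> word_eval x ` ?F"
      using f c word_eval_smult[OF c, of f] by (intro image_eqI[of _ _ "\<lambda>w. c \<otimes>\<^bsub>K\<^esub> f w"]) auto
  qed
  moreover have "word_image A x ` U \<subseteq> word_eval x ` ?F"
  proof
    fix a assume "a \<in> word_image A x ` U"
    then obtain u where u: "u \<in> U" "a = word_image A x u" by blast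
    then have uX: "u \<in> lists X" using U by blast
    have "free_word K u \<in> ?F" using free_word_carrier[OF uX] u by (auto simp: free_word_def)
    then show "a \<in> word_eval x ` ?F"
      using u word_eval_word[OF uX] by (intro image_eqI[of _ _ "free_word K u"]) auto
  qed
  ultimately have "a \<in> word_eval x ` ?F" using a span_subset_subspace by blast
  then show ?thesis using that by blast
qed

end

end

text \<open>The evaluation of the free algebra at the letters is onto, and its kernel is spanned by words.
  This is the presentation of a monomial algebra without a choice of relations; equivalently, the
  words with non-zero image have distinct images, which form a basis.\<close>

locale monomial_presentation = assoc_algebra K A
  for K :: "('k, 'm) ring_scheme" and A :: "('k, 'a) module" +
  fixes X :: "'x set" and x :: "'x \<Rightarrow> 'a"
  assumes finite_letters: "finite X"
    and letters_closed: "x \<in> X \<rightarrow> carrier A"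
    and word_eval_surj: "word_eval x ` carrier (free_algebra K X) = carrier A"
    and word_eval_kernel: "\<lbrakk>f \<in> carrier (free_algebra K X); word_eval x f = \<zero>\<^bsub>A\<^esub>; f w \<noteq> \<zero>\<^bsub>K\<^esub>\<rbrakk>
      \<Longrightarrow> word_image A x w = \<zero>\<^bsub>A\<^esub>"

text \<open>The composition of the projection from the free algebra with the given isomorphism is an
  algebra map that agrees with \<open>word_eval\<close> on letters, hence everywhere. Its kernel is an ideal
  generated by words.\<close>

lemma monomial_algebra_imp_presentation:
  fixes K :: "('k, 'm) ring_scheme" and A :: "('k, 'a) module" and X :: "'x set"
  assumes "monomial_algebra K X x A"
  shows "monomial_presentation K A X x"
proof -
  obtain Rel \<phi> where fin: "finite X" and alg: "assoc_algebra K A" and Rel: "Rel \<subseteq> lists X"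
    and \<phi>: "\<phi> \<in> algebra_iso K (quot_algebra (free_algebra K X) (monomial_relations K X Rel)) A"
    and \<phi>x: "\<And>i. i \<in> X \<Longrightarrow>
      \<phi> (monomial_relations K X Rel +>\<^bsub>free_algebra K X\<^esub> free_word K [i]) = x i"
    using assms unfolding monomial_algebra_def by blast
  interpret A: assoc_algebra K A by (rule alg)
  interpret F: assoc_algebra K "free_algebra K X" by (rule A.free_algebra_assoc_algebra)
  define I where "I = monomial_relations K X Rel"
  have gen: "free_word K ` Rel \<subseteq> carrier (free_algebra K X)"
    by (intro image_subsetI A.free_word_carrier subsetD[OF Rel])
  have I: "ideal I (free_algebra K X)"
    unfolding I_def monomial_relations_def using F.genideal_ideal[OF gen] .
  interpret Q: algebra_epi K "free_algebra K X" "quot_algebra (free_algebra K X) I"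
    "(+>\<^bsub>free_algebra K X\<^esub>) I"
    by (rule F.quot_algebra_epi[OF I])
  have iso: "\<phi> \<in> ring_hom (quot_algebra (free_algebra K X) I) A"
    "bij_betw \<phi> (carrier (quot_algebra (free_algebra K X) I)) (carrier A)"
    and lin: "\<And>c a. \<lbrakk>c \<in> carrier K; a \<in> carrier (quot_algebra (free_algebra K X) I)\<rbrakk> \<Longrightarrow>
      \<phi> (c \<odot>\<^bsub>quot_algebra (free_algebra K X) I\<^esub> a) = c \<odot>\<^bsub>A\<^esub> \<phi> a"
    using \<phi> unfolding algebra_iso_def ring_iso_def I_def by auto
  define h where "h = (\<lambda>f. \<phi> (I +>\<^bsub>free_algebra K X\<^esub> f))"
  have \<phi>0: "\<phi> \<zero>\<^bsub>quot_algebra (free_algebra K X) I\<^esub> = \<zero>\<^bsub>A\<^esub>"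
    using lin[of "\<zero>\<^bsub>K\<^esub>" "\<zero>\<^bsub>quot_algebra (free_algebra K X) I\<^esub>"]
      iso(2)[THEN bij_betw_apply, of "\<zero>\<^bsub>quot_algebra (free_algebra K X) I\<^esub>"] by simp
  interpret h: algebra_epi K "free_algebra K X" A h
  proof (rule algebra_image)
    show "assoc_algebra K (free_algebra K X)" by (rule A.free_algebra_assoc_algebra)
    have "h ` carrier (free_algebra K X)
        = \<phi> ` ((+>\<^bsub>free_algebra K X\<^esub>) I ` carrier (free_algebra K X))"
      by (simp only: h_def image_image)
    then show "h ` carrier (free_algebra K X) = carrier A"
      using Q.surj iso(2) by (simp only: bij_betw_def)
    show "h \<zero>\<^bsub>free_algebra K X\<^esub> = \<zero>\<^bsub>A\<^esub>" using \<phi>0 Q.zero unfolding h_def by (simp only:)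
    show "h \<one>\<^bsub>free_algebra K X\<^esub> = \<one>\<^bsub>A\<^esub>"
      using ring_hom_memE(4)[OF iso(1)] Q.one unfolding h_def by (simp only:)
    show "h (a \<oplus>\<^bsub>free_algebra K X\<^esub> b) = h a \<oplus>\<^bsub>A\<^esub> h b"
      if "a \<in> carrier (free_algebra K X)" "b \<in> carrier (free_algebra K X)" for a b
      using ring_hom_memE(3)[OF iso(1) Q.closed Q.closed, OF that] Q.add[OF that]
      unfolding h_def by (simp only:)
    show "h (a \<otimes>\<^bsub>free_algebra K X\<^esub> b) = h a \<otimes>\<^bsub>A\<^esub> h b"
      if "a \<in> carrier (free_algebra K X)" "b \<in> carrier (free_algebra K X)" for a b
      using ring_hom_memE(2)[OF iso(1) Q.closed Q.closed, OF that] Q.mult[OF that]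
      unfolding h_def by (simp only:)
    show "h (c \<odot>\<^bsub>free_algebra K X\<^esub> a) = c \<odot>\<^bsub>A\<^esub> h a"
      if "c \<in> carrier K" "a \<in> carrier (free_algebra K X)" for c a
      using lin[OF that(1) Q.closed[OF that(2)]] Q.smult[OF that] unfolding h_def by (simp only:)
  qed
  have hx: "h (free_word K [i]) = x i" if "i \<in> X" for i
    using \<phi>x[OF that] unfolding h_def I_def .
  have x: "x \<in> X \<rightarrow> carrier A"
    using hx h.closed[OF A.free_word_carrier] by (metis Pi_I lists.Cons lists.Nil)
  have h_word: "h (free_word K u) = word_image A x u" if "u \<in> lists X" for u
    using that
  proof (induction u rule: lists.induct)
    case Nil
    then show ?case using h.one by simp
  next
    case (Cons i u)
    have i: "free_word K [i] \<in> carrier (free_algebra K X)" "free_word K u \<in> carrier (free_algebra K X)"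
      using Cons by (intro A.free_word_carrier; simp)+
    have "free_word K (i # u) = free_word K [i] \<otimes>\<^bsub>free_algebra K X\<^esub> free_word K u"
      by (simp add: A.conv_words)
    then show ?case using h.mult[OF i] Cons hx by simp
  qed
  have h_eval: "h f = A.word_eval x f" if "f \<in> carrier (free_algebra K X)" for f
    using that
  proof (induction rule: A.free_algebra_linear_induct)
    case zero
    then show ?case using h.zero by (simp add: A.word_eval_zero[OF x])
  next
    case (add f g)
    then show ?case using h.add[of f g] by (simp add: A.word_eval_add[OF x])
  next
    case (smult c f)
    then show ?case using h.smult[of c f] by (simp add: A.word_eval_smult[OF x])
  next
    case (word u)
    then show ?case using h_word A.word_eval_word[OF x] by simp
  qed
  have ker: "word_image A x w = \<zero>\<^bsub>A\<^esub>"
    if f: "f \<in> carrier (free_algebra K X)" and z: "A.word_eval x f = \<zero>\<^bsub>A\<^esub>" and w: "f w \<noteq> \<zero>\<^bsub>K\<^esub>" for f w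
  proof -
    have "\<phi> (I +>\<^bsub>free_algebra K X\<^esub> f) = \<phi> \<zero>\<^bsub>quot_algebra (free_algebra K X) I\<^esub>"
      using h_eval[OF f] z \<phi>0 by (simp add: h_def)
    then have "I +>\<^bsub>free_algebra K X\<^esub> f = \<zero>\<^bsub>quot_algebra (free_algebra K X) I\<^esub>"
      using iso(2) Q.closed[OF f] Q.B.M.zero_closed unfolding bij_betw_def inj_on_def by blast
    then have "f \<in> I" using F.coset_eq_zero_iff[OF I f] by simp
    then have "free_word K w \<in> I" unfolding I_def using A.monomial_relations_support[where f=f, OF Rel _ w] by blast
    moreover have wX: "w \<in> lists X" using f w by (simp add: A.free_algebra_carrier)
    ultimately have "h (free_word K w) = \<zero>\<^bsub>A\<^esub>"
      using F.coset_eq_zero_iff[OF I A.free_word_carrier[OF wX]] \<phi>0 by (simp add: h_def)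
    then show ?thesis using h_word[OF wX] by simp
  qed
  show ?thesis
  proof unfold_locales
    show "A.word_eval x ` carrier (free_algebra K X) = carrier A"
      using h.surj h_eval by (metis image_cong)
  qed (use fin x ker in auto)
qed

text \<open>All words with image zero serve as relations: they generate the kernel of the evaluation.\<close>

lemma (in monomial_presentation) monomial_algebra: "monomial_algebra K X x A"
proof -
  define Rel where "Rel = {w \<in> lists X. word_image A x w = \<zero>\<^bsub>A\<^esub>}"
  define I where "I = monomial_relations K X Rel"
  have Rel: "Rel \<subseteq> lists X" by (auto simp: Rel_def)
  interpret F: assoc_algebra K "free_algebra K X" by (rule free_algebra_assoc_algebra)
  note x = letters_closed
  interpret ev: algebra_epi K "free_algebra K X" A "word_eval x"
  proof (rule algebra_image)
    show "assoc_algebra K (free_algebra K X)" by (rule free_algebra_assoc_algebra)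
    show "word_eval x \<one>\<^bsub>free_algebra K X\<^esub> = \<one>\<^bsub>A\<^esub>" using word_eval_word[OF x, of "[]"] by simp
  qed (simp_all add: word_eval_surj word_eval_add[OF x] word_eval_mult[OF x] word_eval_zero[OF x]
      word_eval_smult[OF x])
  have gen: "free_word K ` Rel \<subseteq> carrier (free_algebra K X)"
    by (intro image_subsetI free_word_carrier subsetD[OF Rel])
  have I: "ideal I (free_algebra K X)"
    unfolding I_def monomial_relations_def using F.genideal_ideal[OF gen] .
  interpret evh: ring_hom_ring "free_algebra K X" A "word_eval x" by (rule ev.ring_hom_ring)
  have ker: "a_kernel (free_algebra K X) A (word_eval x) = I"
  proof
    show "I \<subseteq> a_kernel (free_algebra K X) A (word_eval x)"
      unfolding I_def monomial_relations_def
    proof (rule F.genideal_minimal[OF evh.kernel_is_ideal])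
      show "free_word K ` Rel \<subseteq> a_kernel (free_algebra K X) A (word_eval x)"
      proof
        fix f assume "f \<in> free_word K ` Rel"
        then obtain w where w: "w \<in> Rel" "f = free_word K w" by blast
        then have "word_eval x f = \<zero>\<^bsub>A\<^esub>" using word_eval_word[OF x, of w] by (simp add: Rel_def)
        then show "f \<in> a_kernel (free_algebra K X) A (word_eval x)"
          using subsetD[OF gen] w(1) unfolding w(2) a_kernel_def' by blast
      qed
    qed
    show "a_kernel (free_algebra K X) A (word_eval x) \<subseteq> I"
    proof
      fix f assume "f \<in> a_kernel (free_algebra K X) A (word_eval x)"
      then have f: "f \<in> carrier (free_algebra K X)" "word_eval x f = \<zero>\<^bsub>A\<^esub>"
        unfolding a_kernel_def' by blast+
      have "free_word K w \<in> I" if w: "f w \<noteq> \<zero>\<^bsub>K\<^esub>" for w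
      proof -
        have "w \<in> Rel" using w f(1) word_eval_kernel[OF f w] by (simp add: Rel_def free_algebra_carrier)
        then show ?thesis
          unfolding I_def monomial_relations_def using F.genideal_self[OF gen] by blast
      qed
      then show "f \<in> I"
        using F.ideal_imp_subspace[OF I] f(1) by (intro free_algebra_in_subspace[OF _ f(1)]) auto
    qed
  qed
  let ?Q = "quot_algebra (free_algebra K X) I" and ?\<psi> = "\<lambda>Y. the_elem (word_eval x ` Y)"
  interpret Q: algebra_epi K "free_algebra K X" ?Q "(+>\<^bsub>free_algebra K X\<^esub>) I"
    by (rule F.quot_algebra_epi[OF I])
  have \<psi>: "?\<psi> (I +>\<^bsub>free_algebra K X\<^esub> f) = word_eval x f" if "f \<in> carrier (free_algebra K X)" for f
    using evh.the_elem_simp[OF that] unfolding ker .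
  have "?\<psi> \<in> ring_iso (free_algebra K X Quot I) A"
    using evh.FactRing_iso_set[OF word_eval_surj] unfolding ker .
  then have "?\<psi> \<in> ring_iso ?Q A"
    unfolding ring_iso_def ring_hom_def quot_algebra_def by simp
  moreover have "?\<psi> (c \<odot>\<^bsub>?Q\<^esub> a) = c \<odot>\<^bsub>A\<^esub> ?\<psi> a" if c: "c \<in> carrier K" and a: "a \<in> carrier ?Q" for c a
  proof -
    obtain f where f: "f \<in> carrier (free_algebra K X)" "a = I +>\<^bsub>free_algebra K X\<^esub> f"
      using a Q.surj by blast
    have "c \<odot>\<^bsub>?Q\<^esub> a = I +>\<^bsub>free_algebra K X\<^esub> (c \<odot>\<^bsub>free_algebra K X\<^esub> f)"
      using Q.smult[OF c f(1)] f(2) by (simp only:)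
    then have "?\<psi> (c \<odot>\<^bsub>?Q\<^esub> a) = word_eval x (c \<odot>\<^bsub>free_algebra K X\<^esub> f)"
      using \<psi>[OF F.smult_closed[OF c f(1)]] by (simp only:)
    also have "\<dots> = c \<odot>\<^bsub>A\<^esub> ?\<psi> a" using ev.smult[OF c f(1)] \<psi>[OF f(1)] f(2) by (simp only:)
    finally show ?thesis .
  qed
  ultimately have iso: "?\<psi> \<in> algebra_iso K ?Q A" by (simp add: algebra_iso_def)
  have "?\<psi> (I +>\<^bsub>free_algebra K X\<^esub> free_word K [i]) = x i" if "i \<in> X" for i
  proof -
    have "[i] \<in> lists X" using that by simp
    then show ?thesis
      using \<psi>[OF free_word_carrier] word_eval_word[OF x] Pi_mem[OF letters_closed that] by simp
  qed
  then show ?thesis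
    unfolding monomial_algebra_def
    using finite_letters assoc_algebra_axioms Rel iso[unfolded I_def]
    by (intro conjI exI[of _ Rel] bexI[of _ ?\<psi>]) (simp_all add: I_def)
qed


section \<open>Leading words\<close>

text \<open>A total order on words, given by an injective key, for which multiplication on the right is
  strictly increasing. The key reads a word as a numeral in base \<open>card X + 1\<close> without the digit zero;
  appending a letter acts on keys as a strictly increasing function.\<close>

lemma word_order_exists:
  assumes "finite X"
  obtains key :: "'x list \<Rightarrow> nat" where "inj_on key (lists X)"
    "\<And>u v w. key u < key v \<Longrightarrow> key (u @ w) < key (v @ w)"
proof -
  obtain f :: "'x \<Rightarrow> nat" and n where f: "f ` X = {i. i < n}" "inj_on f X"
    using finite_imp_inj_to_nat_seg[OF assms] by metis
  define key where "key = foldl (\<lambda>a i. a * Suc n + Suc (f i)) 0"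
  have mono: "key u < key v \<Longrightarrow> key (u @ w) < key (v @ w)" for u v w
  proof (induction w rule: rev_induct)
    case (snoc i w)
    then have "Suc (key (u @ w)) * Suc n \<le> key (v @ w) * Suc n"
      by (intro mult_le_mono1) simp
    then have "key (u @ w) * Suc n < key (v @ w) * Suc n" by simp
    then show ?case by (simp add: key_def)
  qed simp
  have "u = v" if "u \<in> lists X" "v \<in> lists X" "key u = key v" for u v
    using that
  proof (induction u arbitrary: v rule: rev_induct)
    case Nil
    then show ?case by (cases v rule: rev_cases) (auto simp: key_def)
  next
    case (snoc i u)
    have "key v \<noteq> 0" using snoc.prems(3) by (simp add: key_def)
    then obtain v' j where v: "v = v' @ [j]" by (cases v rule: rev_cases) (auto simp: key_def)
    have ij: "f i < n" "f j < n" "i \<in> X" "j \<in> X" "u \<in> lists X" "v' \<in> lists X"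
      using v snoc.prems f(1) by auto
    have eq: "key u * Suc n + f i = key v' * Suc n + f j"
      using snoc.prems(3) v by (simp add: key_def)
    have fij: "f i = f j"
      using arg_cong[OF eq, of "\<lambda>k. k mod Suc n"] ij by (simp del: mult_Suc_right)
    then have "key u * Suc n = key v' * Suc n" using eq by linarith
    then have "key u = key v'" by (simp only: mult_cancel2) simp
    then have "u = v'" using snoc.IH[OF ij(5,6)] by simp
    moreover have "i = j" using fij f(2) ij(3,4) by (auto simp: inj_on_def)
    ultimately show ?case using v by simp
  qed
  then have "inj_on key (lists X)" by (auto simp: inj_on_def simp del: in_lists_conv_set)
  then show ?thesis using mono that by blast
qed

context monomial_presentation
begin

abbreviation mon :: "'x list \<Rightarrow> 'a" where
  "mon \<equiv> word_image A x"

definition nonzero_words :: "'x list set" where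
  "nonzero_words = {w \<in> lists X. mon w \<noteq> \<zero>\<^bsub>A\<^esub>}"

lemma nonzero_words_lists: "w \<in> nonzero_words \<Longrightarrow> w \<in> lists X"
  by (simp add: nonzero_words_def)

lemma mon_closed: "u \<in> lists X \<Longrightarrow> mon u \<in> carrier A"
  by (rule word_image_closed[OF _ letters_closed])

lemma mons_closed: "U \<subseteq> lists X \<Longrightarrow> mon ` U \<subseteq> carrier A"
  using mon_closed by blast

lemma nonzero_words_closed: "U \<subseteq> nonzero_words \<Longrightarrow> mon ` U \<subseteq> carrier A"
  using mons_closed nonzero_words_lists by blast

text \<open>The coefficients of an element in the basis of words with non-zero image.\<close>

definition coord :: "'a \<Rightarrow> 'x list \<Rightarrow> 'k" where
  "coord a = (THE f. f \<in> carrier (free_algebra K X) \<and> {w. f w \<noteq> \<zero>\<^bsub>K\<^esub>} \<subseteq> nonzero_words \<and>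
     word_eval x f = a)"

lemma word_eval_restrict:
  assumes f: "f \<in> carrier (free_algebra K X)"
  defines "g \<equiv> (\<lambda>w. if w \<in> nonzero_words then f w else \<zero>\<^bsub>K\<^esub>)"
  shows "g \<in> carrier (free_algebra K X)" "word_eval x g = word_eval x f"
proof -
  let ?T = "{w. f w \<noteq> \<zero>\<^bsub>K\<^esub>}"
  have T: "finite ?T" "?T \<subseteq> lists X" using f by (auto simp: free_algebra_carrier)
  have gT: "{w. g w \<noteq> \<zero>\<^bsub>K\<^esub>} \<subseteq> ?T" by (auto simp: g_def)
  then show g: "g \<in> carrier (free_algebra K X)"
    using f finite_subset[OF gT T(1)] by (auto simp: free_algebra_carrier g_def)
  have "g w \<odot>\<^bsub>A\<^esub> mon w = f w \<odot>\<^bsub>A\<^esub> mon w" if w: "w \<in> ?T" for w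
  proof (cases "w \<in> nonzero_words")
    case False
    then have "mon w = \<zero>\<^bsub>A\<^esub>" using w T(2) by (auto simp: nonzero_words_def)
    then show ?thesis using f g by (simp add: free_algebra_carrier)
  qed (simp add: g_def)
  moreover have "f w \<odot>\<^bsub>A\<^esub> mon w \<in> carrier A" if "w \<in> ?T" for w
    using f mon_closed[of w] that T(2) by (auto simp: free_algebra_carrier)
  ultimately have "(\<Oplus>\<^bsub>A\<^esub>w\<in>?T. g w \<odot>\<^bsub>A\<^esub> mon w) = (\<Oplus>\<^bsub>A\<^esub>w\<in>?T. f w \<odot>\<^bsub>A\<^esub> mon w)"
    by (intro finsum_cong') auto
  then show "word_eval x g = word_eval x f"
    using word_eval_superset[OF letters_closed g T(1) gT T(2)]
      word_eval_superset[OF letters_closed f T(1) order_refl T(2)] by simp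
qed

text \<open>The difference of two such functions is in the kernel of the evaluation, so it is supported on
  words with image zero; but it is also supported on \<^const>\<open>nonzero_words\<close>.\<close>

lemma coord_unique:
  assumes f: "f \<in> carrier (free_algebra K X)" "{w. f w \<noteq> \<zero>\<^bsub>K\<^esub>} \<subseteq> nonzero_words"
    and a: "word_eval x f = a"
  shows "coord a = f"
  unfolding coord_def
proof (rule the_equality)
  interpret F: assoc_algebra K "free_algebra K X" by (rule free_algebra_assoc_algebra)
  fix g assume "g \<in> carrier (free_algebra K X) \<and> {w. g w \<noteq> \<zero>\<^bsub>K\<^esub>} \<subseteq> nonzero_words \<and> word_eval x g = a"
  then have g: "g \<in> carrier (free_algebra K X)" "{w. g w \<noteq> \<zero>\<^bsub>K\<^esub>} \<subseteq> nonzero_words" "word_eval x g = a"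
    by auto
  let ?d = "\<lambda>w. g w \<oplus>\<^bsub>K\<^esub> \<ominus>\<^bsub>K\<^esub> \<one>\<^bsub>K\<^esub> \<otimes>\<^bsub>K\<^esub> f w"
  have m: "(\<lambda>w. \<ominus>\<^bsub>K\<^esub> \<one>\<^bsub>K\<^esub> \<otimes>\<^bsub>K\<^esub> f w) \<in> carrier (free_algebra K X)"
    using F.smult_closed[of "\<ominus>\<^bsub>K\<^esub> \<one>\<^bsub>K\<^esub>" f] f by simp
  have d: "?d \<in> carrier (free_algebra K X)"
    using F.M.a_closed[OF g(1) m] by simp
  have ac: "a \<in> carrier A" using word_eval_closed[OF letters_closed f(1)] a by simp
  have "word_eval x ?d = a \<oplus>\<^bsub>A\<^esub> (\<ominus>\<^bsub>K\<^esub> \<one>\<^bsub>K\<^esub>) \<odot>\<^bsub>A\<^esub> a"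
    using word_eval_add[OF letters_closed g(1) m] word_eval_smult[OF letters_closed _ f(1)] a g(3) by simp
  then have z: "word_eval x ?d = \<zero>\<^bsub>A\<^esub>"
    using ac smult_minus_1[OF ac] r_neg[OF ac] by simp
  have k: "f w \<in> carrier K" "g w \<in> carrier K" for w using f(1) g(1) by (auto simp: free_algebra_carrier)
  show "g = f"
  proof
    fix w
    show "g w = f w"
    proof (cases "w \<in> nonzero_words")
      case True
      then have "?d w = \<zero>\<^bsub>K\<^esub>" using word_eval_kernel[OF d z, of w] by (auto simp: nonzero_words_def)
      then have "g w \<oplus>\<^bsub>K\<^esub> \<ominus>\<^bsub>K\<^esub> (f w) = \<zero>\<^bsub>K\<^esub>" using k[of w] by (simp add: R.l_minus)
      then show ?thesis using k[of w] by (metis R.minus_equality R.minus_minus R.a_inv_closed)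
    next
      case False
      then show ?thesis using f(2) g(2) by (metis (mono_tags) mem_Collect_eq subsetD)
    qed
  qed
qed (use assms in auto)

lemma coord_word_eval:
  assumes f: "f \<in> carrier (free_algebra K X)"
  shows "coord (word_eval x f) = (\<lambda>w. if w \<in> nonzero_words then f w else \<zero>\<^bsub>K\<^esub>)"
  by (rule coord_unique) (use word_eval_restrict[OF f] in auto)

lemma coord:
  assumes "a \<in> carrier A"
  shows "coord a \<in> carrier (free_algebra K X)" "coord a w \<noteq> \<zero>\<^bsub>K\<^esub> \<Longrightarrow> w \<in> nonzero_words"
    "word_eval x (coord a) = a"
proof -
  obtain f where f: "f \<in> carrier (free_algebra K X)" "a = word_eval x f"
    using assms word_eval_surj by blast
  show "coord a \<in> carrier (free_algebra K X)" "coord a w \<noteq> \<zero>\<^bsub>K\<^esub> \<Longrightarrow> w \<in> nonzero_words"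
    "word_eval x (coord a) = a"
    using coord_word_eval[OF f(1)] word_eval_restrict[OF f(1)] f(2) by (auto split: if_splits)
qed

lemma coord_closed: "a \<in> carrier A \<Longrightarrow> coord a w \<in> carrier K"
  using coord(1) by (simp add: free_algebra_carrier)

lemma finite_coord: "a \<in> carrier A \<Longrightarrow> finite {w. coord a w \<noteq> \<zero>\<^bsub>K\<^esub>}"
  using coord(1) by (simp add: free_algebra_carrier)

lemma coord_add:
  assumes a: "a \<in> carrier A" and b: "b \<in> carrier A"
  shows "coord (a \<oplus>\<^bsub>A\<^esub> b) w = coord a w \<oplus>\<^bsub>K\<^esub> coord b w"
proof -
  interpret F: assoc_algebra K "free_algebra K X" by (rule free_algebra_assoc_algebra)
  have "{w. coord a w \<oplus>\<^bsub>K\<^esub> coord b w \<noteq> \<zero>\<^bsub>K\<^esub>} \<subseteq> {w. coord a w \<noteq> \<zero>\<^bsub>K\<^esub>} \<union> {w. coord b w \<noteq> \<zero>\<^bsub>K\<^esub>}"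
    by auto
  also have "\<dots> \<subseteq> nonzero_words" using coord(2)[OF a] coord(2)[OF b] by blast
  finally have "coord (a \<oplus>\<^bsub>A\<^esub> b) = (\<lambda>w. coord a w \<oplus>\<^bsub>K\<^esub> coord b w)"
    using F.M.a_closed[OF coord(1)[OF a] coord(1)[OF b]]
      word_eval_add[OF letters_closed coord(1)[OF a] coord(1)[OF b]] coord(3)[OF a] coord(3)[OF b]
    by (intro coord_unique) auto
  then show ?thesis by simp
qed

lemma coord_smult:
  assumes c: "c \<in> carrier K" and a: "a \<in> carrier A"
  shows "coord (c \<odot>\<^bsub>A\<^esub> a) w = c \<otimes>\<^bsub>K\<^esub> coord a w"
proof -
  interpret F: assoc_algebra K "free_algebra K X" by (rule free_algebra_assoc_algebra)
  have "{w. c \<otimes>\<^bsub>K\<^esub> coord a w \<noteq> \<zero>\<^bsub>K\<^esub>} \<subseteq> {w. coord a w \<noteq> \<zero>\<^bsub>K\<^esub>}" using c by auto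
  also have "\<dots> \<subseteq> nonzero_words" using coord(2)[OF a] by blast
  finally have "coord (c \<odot>\<^bsub>A\<^esub> a) = (\<lambda>w. c \<otimes>\<^bsub>K\<^esub> coord a w)"
    using F.smult_closed[OF c coord(1)[OF a]]
      word_eval_smult[OF letters_closed c coord(1)[OF a]] coord(3)[OF a]
    by (intro coord_unique) auto
  then show ?thesis by simp
qed

lemma coord_zero: "coord \<zero>\<^bsub>A\<^esub> w = \<zero>\<^bsub>K\<^esub>"
  using coord_smult[of "\<zero>\<^bsub>K\<^esub>" "\<zero>\<^bsub>A\<^esub>" w] coord_closed[of "\<zero>\<^bsub>A\<^esub>" w] by simp

lemma coord_nonzero:
  assumes "a \<in> carrier A" "a \<noteq> \<zero>\<^bsub>A\<^esub>"
  shows "\<exists>w. coord a w \<noteq> \<zero>\<^bsub>K\<^esub>"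
proof (rule ccontr)
  assume "\<not> ?thesis"
  then have "coord a = (\<lambda>w. \<zero>\<^bsub>K\<^esub>)" by auto
  then show False using coord(3)[OF assms(1)] assms(2) word_eval_zero[OF letters_closed] by simp
qed

lemma coord_word:
  assumes "u \<in> nonzero_words"
  shows "coord (mon u) = free_word K u"
proof -
  have u: "u \<in> lists X" using assms by (rule nonzero_words_lists)
  show ?thesis
    by (rule coord_unique[OF free_word_carrier[OF u] _ word_eval_word[OF letters_closed u]])
       (use assms in \<open>auto simp: free_word_def\<close>)
qed

lemma coord_subspace: "subspace K {a \<in> carrier A. coord a w = \<zero>\<^bsub>K\<^esub>} A"
  by (rule subspaceI) (auto simp: coord_zero coord_add coord_smult)

lemma coord_span_words:
  assumes U: "U \<subseteq> lists X" and a: "a \<in> span (mon ` U)" and w: "coord a w \<noteq> \<zero>\<^bsub>K\<^esub>"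
  shows "w \<in> U"
proof -
  obtain f where f: "f \<in> carrier (free_algebra K X)" "{w. f w \<noteq> \<zero>\<^bsub>K\<^esub>} \<subseteq> U" "word_eval x f = a"
    using in_span_words[OF letters_closed U a] .
  show ?thesis using coord_word_eval[OF f(1)] f(2,3) w by (auto split: if_splits)
qed

definition word_key :: "'x list \<Rightarrow> nat" where
  "word_key = (SOME key. inj_on key (lists X) \<and>
     (\<forall>u v w. key u < key v \<longrightarrow> key (u @ w) < key (v @ w)))"

lemma word_key: "inj_on word_key (lists X)" "word_key u < word_key v \<Longrightarrow> word_key (u @ w) < word_key (v @ w)"
proof -
  have "\<exists>key :: 'x list \<Rightarrow> nat. inj_on key (lists X) \<and> (\<forall>u v w. key u < key v \<longrightarrow> key (u @ w) < key (v @ w))"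
    using word_order_exists[OF finite_letters] by metis
  from someI_ex[OF this] show "inj_on word_key (lists X)"
    "word_key u < word_key v \<Longrightarrow> word_key (u @ w) < word_key (v @ w)"
    unfolding word_key_def by blast+
qed

definition lead :: "'a \<Rightarrow> 'x list" where
  "lead a = (SOME w. coord a w \<noteq> \<zero>\<^bsub>K\<^esub> \<and> (\<forall>v. coord a v \<noteq> \<zero>\<^bsub>K\<^esub> \<longrightarrow> word_key v \<le> word_key w))"

lemma lead:
  assumes "a \<in> carrier A" "a \<noteq> \<zero>\<^bsub>A\<^esub>"
  shows "coord a (lead a) \<noteq> \<zero>\<^bsub>K\<^esub>" "coord a v \<noteq> \<zero>\<^bsub>K\<^esub> \<Longrightarrow> word_key v \<le> word_key (lead a)"
    "lead a \<in> nonzero_words"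
proof -
  let ?T = "{w. coord a w \<noteq> \<zero>\<^bsub>K\<^esub>}"
  have "finite (word_key ` ?T)" "word_key ` ?T \<noteq> {}"
    using finite_coord[OF assms(1)] coord_nonzero[OF assms] by auto
  then have "Max (word_key ` ?T) \<in> word_key ` ?T" by (rule Max_in)
  then obtain w where w: "w \<in> ?T" "Max (word_key ` ?T) = word_key w" by blast
  have "word_key v \<le> word_key w" if "v \<in> ?T" for v
    using Max_ge[of "word_key ` ?T" "word_key v"] finite_coord[OF assms(1)] that w(2) by simp
  then have "\<exists>w. coord a w \<noteq> \<zero>\<^bsub>K\<^esub> \<and> (\<forall>v. coord a v \<noteq> \<zero>\<^bsub>K\<^esub> \<longrightarrow> word_key v \<le> word_key w)"
    using w(1) by blast
  from someI_ex[OF this] show 1: "coord a (lead a) \<noteq> \<zero>\<^bsub>K\<^esub>"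
    and "coord a v \<noteq> \<zero>\<^bsub>K\<^esub> \<Longrightarrow> word_key v \<le> word_key (lead a)"
    unfolding lead_def by blast+
  show "lead a \<in> nonzero_words" by (rule coord(2)[OF assms(1) 1])
qed

lemma lead_eqI:
  assumes a: "a \<in> carrier A" and w: "coord a w \<noteq> \<zero>\<^bsub>K\<^esub>"
    and max: "\<And>v. coord a v \<noteq> \<zero>\<^bsub>K\<^esub> \<Longrightarrow> word_key v \<le> word_key w"
  shows "a \<noteq> \<zero>\<^bsub>A\<^esub>" "lead a = w"
proof -
  show nz: "a \<noteq> \<zero>\<^bsub>A\<^esub>" using w coord_zero by auto
  have "word_key (lead a) = word_key w"
    using lead(2)[OF a nz w] max[OF lead(1)[OF a nz]] by simp
  moreover have "lead a \<in> lists X" "w \<in> lists X"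
    using lead(3)[OF a nz] coord(2)[OF a w] nonzero_words_lists by blast+
  ultimately show "lead a = w" using word_key(1) by (simp add: inj_on_def)
qed

lemma lead_word:
  assumes "u \<in> nonzero_words"
  shows "lead (mon u) = u"
proof (rule lead_eqI(2))
  have "\<one>\<^bsub>K\<^esub> \<noteq> \<zero>\<^bsub>K\<^esub>" by simp
  then show "coord (mon u) u \<noteq> \<zero>\<^bsub>K\<^esub>" by (simp add: coord_word[OF assms] free_word_def)
  show "word_key v \<le> word_key u" if "coord (mon u) v \<noteq> \<zero>\<^bsub>K\<^esub>" for v
    using that by (simp add: coord_word[OF assms] free_word_def split: if_splits)
qed (use mon_closed[OF nonzero_words_lists[OF assms]] in simp)

text \<open>Right multiplication by a word is strictly increasing on words, so the leading word of \<open>a\<close>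
  stays the leading one unless it is killed.\<close>

lemma lead_mult:
  assumes a: "a \<in> carrier A" "a \<noteq> \<zero>\<^bsub>A\<^esub>" and v: "v \<in> lists X" and nz: "lead a @ v \<in> nonzero_words"
  shows "a \<otimes>\<^bsub>A\<^esub> mon v \<noteq> \<zero>\<^bsub>A\<^esub>" "lead (a \<otimes>\<^bsub>A\<^esub> mon v) = lead a @ v"
proof -
  define f where "f = coord a"
  define g where "g = conv f (free_word K v)"
  have f: "f \<in> carrier (free_algebra K X)" unfolding f_def using coord(1)[OF a(1)] .
  have fv: "free_word K v \<in> carrier (free_algebra K X)" using free_word_carrier[OF v] .
  have k: "f w \<in> carrier K" for w using f by (simp add: free_algebra_carrier)
  have prod: "a \<otimes>\<^bsub>A\<^esub> mon v = word_eval x g"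
    unfolding g_def using word_eval_mult[OF letters_closed f fv] word_eval_word[OF letters_closed v]
      coord(3)[OF a(1)] by (simp add: f_def)
  have g: "g \<in> carrier (free_algebra K X)" unfolding g_def by (rule conv_closed[OF f fv])
  have coord_g: "coord (word_eval x g) = (\<lambda>w. if w \<in> nonzero_words then g w else \<zero>\<^bsub>K\<^esub>)"
    by (rule coord_word_eval[OF g])
  have g_app: "g (u @ v) = f u" for u
  proof -
    have "f (take i (u @ v)) \<otimes>\<^bsub>K\<^esub> free_word K v (drop i (u @ v)) =
        (if length u = i then f u else \<zero>\<^bsub>K\<^esub>)" if "i \<in> {..length (u @ v)}" for i
    proof (cases "length u = i")
      case False
      have "length (drop i (u @ v)) \<noteq> length v" using that False by auto
      then have "drop i (u @ v) \<noteq> v" by metis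
      then show ?thesis using False k by (simp add: free_word_def)
    qed (use k in \<open>auto simp: free_word_def\<close>)
    then have "g (u @ v) = (\<Oplus>\<^bsub>K\<^esub>i\<in>{..length (u @ v)}. if length u = i then f u else \<zero>\<^bsub>K\<^esub>)"
      unfolding g_def conv_def using k by (intro R.finsum_cong') auto
    then show ?thesis
      using R.finsum_singleton[of "length u" "{..length (u @ v)}" "\<lambda>_. f u"] k by simp
  qed
  have key: "word_key w \<le> word_key (lead a @ v)" if w: "coord (word_eval x g) w \<noteq> \<zero>\<^bsub>K\<^esub>" for w
  proof -
    have "g w \<noteq> \<zero>\<^bsub>K\<^esub>" using w by (auto simp: coord_g split: if_splits)
    then obtain i where i: "f (take i w) \<noteq> \<zero>\<^bsub>K\<^esub>" "free_word K v (drop i w) \<noteq> \<zero>\<^bsub>K\<^esub>"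
      unfolding g_def using conv_nonzero[OF _ f fv] by metis
    then have wv: "w = take i w @ v" by (metis append_take_drop_id free_word_def)
    have "word_key (take i w) \<le> word_key (lead a)" using lead(2)[OF a] i(1) by (simp add: f_def)
    moreover have "take i w \<in> lists X" "lead a \<in> lists X"
      using i(1) f nonzero_words_lists[OF lead(3)[OF a]] unfolding free_algebra_carrier by blast+
    ultimately have "take i w = lead a \<or> word_key (take i w) < word_key (lead a)"
      using word_key(1) unfolding inj_on_def by (metis le_neq_implies_less)
    then show ?thesis using wv word_key(2)[of "take i w" "lead a" v] by (metis less_imp_le order_refl)
  qed
  have "coord (word_eval x g) (lead a @ v) \<noteq> \<zero>\<^bsub>K\<^esub>"
    using nz g_app lead(1)[OF a] by (simp add: coord_g f_def)
  from lead_eqI[OF word_eval_closed[OF letters_closed g] this key]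
  show "a \<otimes>\<^bsub>A\<^esub> mon v \<noteq> \<zero>\<^bsub>A\<^esub>" "lead (a \<otimes>\<^bsub>A\<^esub> mon v) = lead a @ v"
    unfolding prod by auto
qed

definition lead_words :: "'a set \<Rightarrow> 'x list set" where
  "lead_words L = lead ` (L - {\<zero>\<^bsub>A\<^esub>})"

lemma lead_words_nonzero: "L \<subseteq> carrier A \<Longrightarrow> lead_words L \<subseteq> nonzero_words"
  using lead(3) by (auto simp: lead_words_def)

text \<open>The element with the largest leading word is not in the span of the others: their coordinates at
  that word vanish.\<close>

lemma lin_indpt_distinct_leads:
  assumes "finite F" "F \<subseteq> carrier A" "\<zero>\<^bsub>A\<^esub> \<notin> F" "inj_on lead F"
  shows "lin_indpt F"
  using assms
proof (induction "card F" arbitrary: F)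
  case 0
  then show ?case by (auto simp: lin_dep_def)
next
  case (Suc n)
  let ?k = "\<lambda>a. word_key (lead a)"
  have "F \<noteq> {}" using Suc.hyps(2) by auto
  then have "Max (?k ` F) \<in> ?k ` F" using Suc.prems(1) by simp
  then obtain v where v: "v \<in> F" "Max (?k ` F) = ?k v" by blast
  then have max: "?k u \<le> ?k v" if "u \<in> F" for u
    using Max_ge[of "?k ` F" "?k u"] Suc.prems(1) that by simp
  let ?S = "F - {v}"
  have vA: "v \<in> carrier A" "v \<noteq> \<zero>\<^bsub>A\<^esub>" using v Suc.prems by auto
  have li: "lin_indpt ?S"
  proof (rule Suc.hyps(1))
    show "n = card ?S" using Suc.hyps(2) v Suc.prems(1) by simp
    show "inj_on lead ?S" using Suc.prems(4) by (rule inj_on_diff)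
  qed (use Suc.prems in auto)
  have "coord u (lead v) = \<zero>\<^bsub>K\<^esub>" if u: "u \<in> ?S" for u
  proof (rule ccontr)
    assume nz: "coord u (lead v) \<noteq> \<zero>\<^bsub>K\<^esub>"
    have uA: "u \<in> carrier A" "u \<noteq> \<zero>\<^bsub>A\<^esub>" using u Suc.prems by auto
    have "?k u = ?k v" using lead(2)[OF uA nz] max[of u] u by simp
    then have "lead u = lead v"
      using word_key(1) nonzero_words_lists lead(3)[OF uA] lead(3)[OF vA] by (simp add: inj_on_def)
    then show False using Suc.prems(4) u v(1) by (auto simp: inj_on_def)
  qed
  then have "span ?S \<subseteq> {a \<in> carrier A. coord a (lead v) = \<zero>\<^bsub>K\<^esub>}"
    using Suc.prems(2) by (intro span_subset_subspace[OF coord_subspace]) auto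
  then have "v \<notin> span ?S" using lead(1)[OF vA] by auto
  then have "lin_indpt (?S \<union> {v})"
    using lin_dep_iff_in_span[OF _ li vA(1)] Suc.prems(2) by auto
  moreover have "?S \<union> {v} = F" using v(1) by auto
  ultimately show ?case by simp
qed

lemma lead_words_representatives:
  assumes "L \<subseteq> carrier A"
  obtains b where "\<forall>w\<in>lead_words L. b w \<in> L \<and> b w \<noteq> \<zero>\<^bsub>A\<^esub> \<and> lead (b w) = w"
    "\<forall>T. finite T \<and> T \<subseteq> lead_words L \<longrightarrow> lin_indpt (b ` T) \<and> card (b ` T) = card T"
proof -
  have "\<forall>w\<in>lead_words L. \<exists>a. a \<in> L \<and> a \<noteq> \<zero>\<^bsub>A\<^esub> \<and> lead a = w" by (auto simp: lead_words_def)
  then obtain b where b: "\<forall>w\<in>lead_words L. b w \<in> L \<and> b w \<noteq> \<zero>\<^bsub>A\<^esub> \<and> lead (b w) = w"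
    using bchoice by metis
  have "lin_indpt (b ` T) \<and> card (b ` T) = card T" if T: "finite T" "T \<subseteq> lead_words L" for T
  proof
    have "inj_on b T" using b T(2) by (metis inj_onI subsetD)
    then show "card (b ` T) = card T" by (rule card_image)
    show "lin_indpt (b ` T)"
    proof (rule lin_indpt_distinct_leads)
      show "inj_on lead (b ` T)" using b T(2) by (intro inj_onI) (metis imageE subsetD)
      show "b ` T \<subseteq> carrier A" using b T(2) assms by blast
      show "\<zero>\<^bsub>A\<^esub> \<notin> b ` T" using b T(2) by (metis imageE subsetD)
    qed (use T in simp)
  qed
  then show ?thesis using that[of b] b by blast
qed

text \<open>Elements with distinct leading words are independent, and subtracting a multiple of a
  representative lowers the leading word, so representatives of the leading words form a basis.\<close>

lemma sdim_lead_words: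
  assumes L: "fd_subspace K A L"
  shows "finite (lead_words L)" "card (lead_words L) = sdim K A L"
proof -
  have sub: "subspace K L A" using L by (rule fd_subspaceD)
  note LA = subspaceD(1)[OF sub]
  obtain b where b': "\<forall>w\<in>lead_words L. b w \<in> L \<and> b w \<noteq> \<zero>\<^bsub>A\<^esub> \<and> lead (b w) = w"
    "\<forall>T. finite T \<and> T \<subseteq> lead_words L \<longrightarrow> lin_indpt (b ` T) \<and> card (b ` T) = card T"
    using lead_words_representatives[OF LA] .
  have b: "b w \<in> L" "b w \<noteq> \<zero>\<^bsub>A\<^esub>" "lead (b w) = w" if "w \<in> lead_words L" for w
    using b'(1) that by auto
  have "card T \<le> sdim K A L" if T: "T \<subseteq> lead_words L" "finite T" for T
  proof -
    have "lin_indpt (b ` T)" "card (b ` T) = card T" using b'(2) T by auto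
    moreover have "b ` T \<subseteq> L" using b(1) T(1) by auto
    ultimately show ?thesis using lin_indpt_card_le_sdim(2)[OF L, of "b ` T"] by simp
  qed
  then have fin: "finite (lead_words L)" and le: "card (lead_words L) \<le> sdim K A L"
    using finite_if_finite_subsets_card_bdd[of "lead_words L" "sdim K A L"] by auto
  show "finite (lead_words L)" by (rule fin)
  let ?B = "b ` lead_words L"
  have B: "?B \<subseteq> carrier A" "?B \<subseteq> L" using b(1) LA by auto
  have sB: "subspace K (span ?B) A" using B by (simp add: span_is_subspace)
  have "a \<in> span ?B" if "a \<in> L" for a
    using that
  proof (induction "word_key (lead a)" arbitrary: a rule: less_induct)
    case less
    show ?case
    proof (cases "a = \<zero>\<^bsub>A\<^esub>")
      case True
      then show ?thesis using subspaceD(2)[OF sB] by simp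
    next
      case False
      have a: "a \<in> carrier A" using less.prems LA by blast
      let ?w = "lead a"
      have w: "?w \<in> lead_words L" using less.prems False by (auto simp: lead_words_def)
      have bA: "b ?w \<in> carrier A" using b(1)[OF w] LA by blast
      have bw: "coord (b ?w) ?w \<noteq> \<zero>\<^bsub>K\<^esub>" using lead(1)[OF bA b(2)[OF w]] b(3)[OF w] by simp
      define c where "c = coord a ?w \<otimes>\<^bsub>K\<^esub> inv\<^bsub>K\<^esub> (coord (b ?w) ?w)"
      have u: "coord (b ?w) ?w \<in> Units K" using bw coord_closed[OF bA] field_Units by auto
      have c: "c \<in> carrier K" unfolding c_def using u coord_closed[OF a] by (simp add: R.Units_inv_closed)
      have cb: "c \<otimes>\<^bsub>K\<^esub> coord (b ?w) ?w = coord a ?w"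
        unfolding c_def using u coord_closed[OF a] coord_closed[OF bA]
        by (simp add: R.m_assoc R.Units_inv_closed R.Units_l_inv)
      define d where "d = a \<oplus>\<^bsub>A\<^esub> (\<ominus>\<^bsub>K\<^esub> c) \<odot>\<^bsub>A\<^esub> b ?w"
      have dL: "d \<in> L"
        unfolding d_def using subspaceD(3,4)[OF sub] less.prems b(1)[OF w] c by simp
      then have dA: "d \<in> carrier A" using LA by blast
      have cd: "coord d v = coord a v \<oplus>\<^bsub>K\<^esub> \<ominus>\<^bsub>K\<^esub> c \<otimes>\<^bsub>K\<^esub> coord (b ?w) v" for v
        unfolding d_def using a bA c by (simp add: coord_add coord_smult)
      have "d \<in> span ?B"
      proof (cases "d = \<zero>\<^bsub>A\<^esub>")
        case True
        then show ?thesis using subspaceD(2)[OF sB] by simp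
      next
        case nz: False
        note ld = lead(1)[OF dA nz]
        have "coord d ?w = \<zero>\<^bsub>K\<^esub>"
          unfolding cd using c cb coord_closed[OF a] coord_closed[OF bA]
          by (simp add: R.l_minus R.r_neg)
        then have ne: "lead d \<noteq> ?w" using ld by auto
        have "coord a (lead d) \<noteq> \<zero>\<^bsub>K\<^esub> \<or> coord (b ?w) (lead d) \<noteq> \<zero>\<^bsub>K\<^esub>"
          using ld c unfolding cd by auto
        then have "word_key (lead d) \<le> word_key ?w"
          using lead(2)[OF a False] lead(2)[OF bA b(2)[OF w]] b(3)[OF w] by auto
        moreover have "word_key (lead d) \<noteq> word_key ?w"
          using ne inj_onD[OF word_key(1), of "lead d" ?w]
            nonzero_words_lists[OF lead(3)[OF dA nz]] nonzero_words_lists[OF lead(3)[OF a False]] by blast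
        ultimately show ?thesis using less.hyps[of d] dL by simp
      qed
      moreover have "c \<odot>\<^bsub>A\<^esub> b ?w \<in> span ?B"
        using subspaceD(4)[OF sB c] in_own_span[OF B(1)] w by blast
      ultimately have "d \<oplus>\<^bsub>A\<^esub> c \<odot>\<^bsub>A\<^esub> b ?w \<in> span ?B" using subspaceD(3)[OF sB] by blast
      moreover have "d \<oplus>\<^bsub>A\<^esub> c \<odot>\<^bsub>A\<^esub> b ?w = a"
        unfolding d_def using a bA c by (simp add: a_assoc smult_l_distr[symmetric] R.l_neg)
      ultimately show ?thesis by simp
    qed
  qed
  then have "L = span ?B" using span_subset_subspace[OF sub B(2)] by blast
  then have "sdim K A L \<le> card ?B" using fd_subspace_span(2)[of ?B] B(1) fin by simp
  then show "card (lead_words L) = sdim K A L" using le card_image_le[OF fin, of b] by simp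
qed

lemma sdim_span_words:
  assumes "finite U" "U \<subseteq> nonzero_words"
  shows "fd_subspace K A (span (mon ` U))"
    "sdim K A (span (mon ` U)) = card U"
proof -
  have lists: "U \<subseteq> lists X" using assms(2) nonzero_words_lists by blast
  have UA: "finite (mon ` U)" "mon ` U \<subseteq> carrier A"
    using assms mons_closed[OF lists] by auto
  show "fd_subspace K A (span (mon ` U))" by (rule fd_subspace_span(1)[OF UA])
  have inj: "inj_on (mon) U" using lead_word assms(2) by (metis inj_onI subsetD)
  have "lin_indpt (mon ` U)"
  proof (rule lin_indpt_distinct_leads[OF UA])
    show "\<zero>\<^bsub>A\<^esub> \<notin> mon ` U" using assms(2) by (auto simp: nonzero_words_def)
    show "inj_on lead (mon ` U)"
      using lead_word assms(2) by (intro inj_onI) (metis imageE subsetD)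
  qed
  then show "sdim K A (span (mon ` U)) = card U"
    using sdim_span_lin_indpt[OF UA] card_image[OF inj] by simp
qed

lemma infinite_words_imp_not_fin_dim:
  assumes "infinite U" "U \<subseteq> nonzero_words" "subspace K L A" "mon ` U \<subseteq> L"
  shows "\<not> sfin_dim K A L"
proof
  assume "sfin_dim K A L"
  then have L: "fd_subspace K A L" using assms(3) by (simp add: fd_subspace_def)
  have "U \<subseteq> lead_words L"
  proof
    fix u assume u: "u \<in> U"
    then have "mon u \<noteq> \<zero>\<^bsub>A\<^esub>" "lead (mon u) = u"
      using assms(2) lead_word[of u] unfolding nonzero_words_def by blast+
    then show "u \<in> lead_words L" using u assms(4) unfolding lead_words_def by force
  qed
  then show False using sdim_lead_words(1)[OF L] assms(1) finite_subset by blast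
qed

section \<open>Folner sequences of monomial subspaces\<close>

lemma fd_subspace_in_words:
  assumes "fd_subspace K A V"
  obtains T where "finite T" "T \<subseteq> nonzero_words" "V \<subseteq> span (mon ` T)"
proof -
  obtain F where F: "finite F" "F \<subseteq> carrier A" "span F = V" using fd_subspace_basis[OF assms] .
  define T where "T = (\<Union>a\<in>F. {w. coord a w \<noteq> \<zero>\<^bsub>K\<^esub>})"
  have T: "finite T" "T \<subseteq> nonzero_words"
    unfolding T_def using F finite_coord coord(2) by auto
  have TX: "T \<subseteq> lists X" using T(2) nonzero_words_lists by blast
  have "F \<subseteq> span (mon ` T)"
  proof
    fix a assume a: "a \<in> F"
    then have aA: "a \<in> carrier A" using F by blast
    have "word_eval x (coord a) \<in> span (mon ` T)"
      by (rule word_eval_in_span[OF letters_closed coord(1)[OF aA] _ TX]) (use a in \<open>auto simp: T_def\<close>)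
    then show "a \<in> span (mon ` T)" using coord(3)[OF aA] by simp
  qed
  then have "V \<subseteq> span (mon ` T)"
    using span_subset_subspace[OF span_is_subspace[OF mons_closed[OF TX]]] F(3) by blast
  then show ?thesis using that T by blast
qed

text \<open>A leading word of \<open>L\<close> times a word of \<open>V\<close> is zero or a leading word of \<open>L V\<close>. Hence passing to leading
  words does not make the product with \<open>V\<close> larger.\<close>

lemma lead_words_prod:
  assumes L: "subspace K L A" and T: "T \<subseteq> lists X"
  shows "prodsp (span (mon ` lead_words L)) (span (mon ` T))
    \<subseteq> span (mon ` lead_words (prodsp L (span (mon ` T))))"
proof -
  note LA = subspaceD(1)[OF L]
  let ?V = "span (mon ` T)"
  have VA: "?V \<subseteq> carrier A" using mons_closed[OF T] by (rule span_is_subset2)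
  have PA: "prodsp L ?V \<subseteq> carrier A" using prodsp_carrier[OF LA VA] by (rule subspaceD(1))
  have leadA: "mon ` lead_words L \<subseteq> carrier A"
    by (rule nonzero_words_closed[OF lead_words_nonzero[OF LA]])
  have MA: "mon ` lead_words (prodsp L ?V) \<subseteq> carrier A"
    by (rule nonzero_words_closed[OF lead_words_nonzero[OF PA]])
  show ?thesis
  proof (rule prodsp_span_subset[OF span_is_subspace[OF MA] leadA mons_closed[OF T]])
    fix f g assume "f \<in> mon ` lead_words L" "g \<in> mon ` T"
    then obtain a t where a: "a \<in> L" "a \<noteq> \<zero>\<^bsub>A\<^esub>" "f = mon (lead a)"
      and t: "t \<in> T" "g = mon t" by (auto simp: lead_words_def)
    have aA: "a \<in> carrier A" and tX: "t \<in> lists X" using a LA t T by auto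
    have lX: "lead a \<in> lists X" using nonzero_words_lists[OF lead(3)[OF aA a(2)]] .
    have fg: "f \<otimes>\<^bsub>A\<^esub> g = mon (lead a @ t)"
      using word_image_append[OF lX tX letters_closed] a t by simp
    show "f \<otimes>\<^bsub>A\<^esub> g \<in> span (mon ` lead_words (prodsp L ?V))"
    proof (cases "lead a @ t \<in> nonzero_words")
      case False
      then have "f \<otimes>\<^bsub>A\<^esub> g = \<zero>\<^bsub>A\<^esub>"
        using fg lX tX unfolding nonzero_words_def by simp
      then show ?thesis using subspaceD(2)[OF span_is_subspace[OF MA]] by simp
    next
      case True
      note lm = lead_mult[OF aA a(2) tX True]
      have "mon t \<in> ?V" using in_own_span[OF mons_closed[OF T]] t by blast
      then have "a \<otimes>\<^bsub>A\<^esub> mon t \<in> prodsp L ?V"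
        using mult_in_prodsp[OF LA VA a(1)] by blast
      then have "lead a @ t \<in> lead_words (prodsp L ?V)"
        using lm unfolding lead_words_def by (metis DiffI image_eqI singletonD)
      then show ?thesis using in_own_span[OF MA] fg by auto
    qed
  qed
qed

text \<open>\<open>V\<close> is enlarged to a space spanned by words before the almost invariant subspace is chosen, so that
  its leading words can be compared with those of the product. The words in \<open>U\<close> survive because each is
  its own leading word.\<close>

lemma monomial_almost_invariant_subspace:
  assumes am: "exhaustively_amenable_module K A A (mult A)"
    and V: "fd_subspace K A V" and \<epsilon>: "\<epsilon> > 0" and U: "finite U" "U \<subseteq> nonzero_words"
  obtains T where "finite T" "U \<subseteq> T" "T \<subseteq> nonzero_words"
    "real (sdim K A (prodsp (span (mon ` T)) V)) < (1 + \<epsilon>) * real (sdim K A (span (mon ` T)))"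
proof -
  obtain T0 where T0: "finite T0" "T0 \<subseteq> nonzero_words" "V \<subseteq> span (mon ` T0)"
    using fd_subspace_in_words[OF V] .
  have T0X: "T0 \<subseteq> lists X" using T0(2) nonzero_words_lists by blast
  let ?V = "span (mon ` T0)"
  have V1: "fd_subspace K A ?V" by (rule sdim_span_words(1)[OF T0(1,2)])
  have VA: "?V \<subseteq> carrier A" using mons_closed[OF T0X] by (rule span_is_subset2)
  obtain L where L: "fd_subspace K A L" "span (mon ` U) \<subseteq> L"
    "real (sdim K A (prodsp L ?V)) < (1 + \<epsilon>) * real (sdim K A L)"
    using am V1 \<epsilon> sdim_span_words(1)[OF U]
    unfolding exhaustively_amenable_module_def almost_invariant_def by blast
  have sub: "subspace K L A" and LA: "L \<subseteq> carrier A" using fd_subspaceD[OF L(1)] subspaceD(1) by blast+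
  let ?T = "lead_words L" and ?P = "lead_words (prodsp L ?V)"
  note nz = lead_words_nonzero[OF LA]
  have fdP: "fd_subspace K A (prodsp L ?V)" by (rule fd_prodsp[OF L(1) V1])
  have PA: "prodsp L ?V \<subseteq> carrier A" using fd_subspaceD[OF fdP] by (rule subspaceD(1))
  note P = sdim_lead_words[OF fdP] and T = sdim_lead_words[OF L(1)]
  have TA: "span (mon ` ?T) \<subseteq> carrier A"
    by (rule span_is_subset2[OF nonzero_words_closed[OF nz]])
  have "prodsp (span (mon ` ?T)) V \<subseteq> prodsp (span (mon ` ?T)) ?V"
    by (rule prodsp_mono[OF TA VA order_refl T0(3)])
  also have "\<dots> \<subseteq> span (mon ` ?P)" by (rule lead_words_prod[OF sub T0X])
  finally have "prodsp (span (mon ` ?T)) V \<subseteq> span (mon ` ?P)" .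
  moreover have "V \<subseteq> carrier A" using T0(3) VA by blast
  ultimately have "sdim K A (prodsp (span (mon ` ?T)) V) \<le> sdim K A (span (mon ` ?P))"
    using fd_subspace_mono(2)[OF sdim_span_words(1)[OF P(1) lead_words_nonzero[OF PA]]
        prodsp_carrier[OF TA]] by blast
  then have "sdim K A (prodsp (span (mon ` ?T)) V) \<le> sdim K A (prodsp L ?V)"
    using sdim_span_words(2)[OF P(1) lead_words_nonzero[OF PA]] P(2) by simp
  moreover have "sdim K A (span (mon ` ?T)) = sdim K A L"
    using sdim_span_words(2)[OF T(1) nz] T(2) by simp
  ultimately have "real (sdim K A (prodsp (span (mon ` ?T)) V))
      < (1 + \<epsilon>) * real (sdim K A (span (mon ` ?T)))" using L(3) by simp
  moreover have "U \<subseteq> ?T"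
  proof
    fix u assume u: "u \<in> U"
    then have "mon u \<in> L" using in_own_span[OF nonzero_words_closed[OF U(2)]] L(2) by blast
    moreover have "mon u \<noteq> \<zero>\<^bsub>A\<^esub>" "lead (mon u) = u"
      using u U(2) lead_word[of u] unfolding nonzero_words_def by blast+
    ultimately show "u \<in> ?T" unfolding lead_words_def by force
  qed
  ultimately show ?thesis using that T(1) nz by blast
qed

text \<open>The sets of words are chosen one after the other; the \<open>n\<close>-th contains its predecessor and all
  non-zero words of length at most \<open>n\<close>, which makes the spans exhaust \<open>A\<close>, and grows by a factor below
  \<open>1 + 1 / (n + 1)\<close>.\<close>

lemma exhaustively_amenable_imp_monomial_folner:
  assumes am: "exhaustively_amenable_module K A A (mult A)" and nontriv: "carrier A \<noteq> {\<zero>\<^bsub>A\<^esub>}"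
    and V: "fd_subspace K A V" and V1: "\<one>\<^bsub>A\<^esub> \<in> V"
  shows "has_monomial_folner_sequence K X x A V"
proof -
  let ?L = "\<lambda>T. span (mon ` T)" and ?S = "\<lambda>n. {w \<in> nonzero_words. length w \<le> n}"
  define P where "P n T \<longleftrightarrow> finite T \<and> T \<subseteq> nonzero_words \<and> ?S n \<subseteq> T \<and>
    real (sdim K A (prodsp (?L T) V)) < (1 + 1 / real (Suc n)) * real (sdim K A (?L T))" for n T
  have S: "finite (?S n)" for n
  proof (rule finite_subset)
    show "?S n \<subseteq> {w. set w \<subseteq> X \<and> length w \<le> n}" using nonzero_words_lists by auto
  qed (rule finite_lists_length_le[OF finite_letters])
  have step: "\<exists>T'. P n T' \<and> T \<subseteq> T'" if "finite T" "T \<subseteq> nonzero_words" for n T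
  proof -
    have eps: "1 / real (Suc n) > 0" by simp
    have TS: "finite (T \<union> ?S n)" "T \<union> ?S n \<subseteq> nonzero_words" using that S by auto
    obtain T' where "finite T'" "T \<union> ?S n \<subseteq> T'" "T' \<subseteq> nonzero_words"
      "real (sdim K A (prodsp (?L T') V)) < (1 + 1 / real (Suc n)) * real (sdim K A (?L T'))"
      using monomial_almost_invariant_subspace[OF am V eps TS] .
    then show ?thesis unfolding P_def by blast
  qed
  have "\<exists>T. P 0 T" using step[of "{}" 0] by blast
  moreover have "\<exists>T'. P (Suc n) T' \<and> T \<subseteq> T'" if "P n T" for T n
    using step[of T "Suc n"] that unfolding P_def by blast
  ultimately obtain T where T: "\<And>n. P n (T n)" "\<And>n. T n \<subseteq> T (Suc n)"
    using dependent_nat_choice[of P "\<lambda>_ T T'. T \<subseteq> T'"] by metis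
  define L where "L = (\<lambda>n. ?L (T n))"
  have Tn: "finite (T n)" "T n \<subseteq> nonzero_words" "?S n \<subseteq> T n" for n using T(1)[of n] by (auto simp: P_def)
  have fd: "fd_subspace K A (L n)" for n unfolding L_def by (rule sdim_span_words(1)[OF Tn(1,2)])
  have LA: "L n \<subseteq> carrier A" for n using fd_subspaceD[OF fd] by (rule subspaceD(1))
  have VA: "V \<subseteq> carrier A" using fd_subspaceD[OF V] by (rule subspaceD(1))
  have one: "\<one>\<^bsub>A\<^esub> \<noteq> \<zero>\<^bsub>A\<^esub>" using nontriv one_zeroD by blast
  then have "[] \<in> T n" for n using Tn(3)[of n] by (auto simp: nonzero_words_def)
  then have "\<one>\<^bsub>A\<^esub> \<in> L n" for n
    using in_own_span[OF nonzero_words_closed[OF Tn(2)]] unfolding L_def by force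
  then have Lnz: "L n \<noteq> {\<zero>\<^bsub>A\<^esub>}" for n using one by blast
  have pos: "real (sdim K A (L n)) > 0" for n using sdim_pos[OF fd Lnz] by simp
  have "incseq L" unfolding L_def using T(2) by (intro incseq_SucI span_is_monotone image_mono)
  moreover have "(\<Union>n. L n) = carrier A"
  proof
    show "carrier A \<subseteq> (\<Union>n. L n)"
    proof
      fix a assume a: "a \<in> carrier A"
      define n where "n = Max (length ` {w. coord a w \<noteq> \<zero>\<^bsub>K\<^esub>})"
      have "length w \<le> n" if "coord a w \<noteq> \<zero>\<^bsub>K\<^esub>" for w
        unfolding n_def using finite_coord[OF a] that by (intro Max_ge) auto
      then have "{w. coord a w \<noteq> \<zero>\<^bsub>K\<^esub>} \<subseteq> T n" using coord(2)[OF a] Tn(3) by blast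
      then have "word_eval x (coord a) \<in> L n"
        unfolding L_def using Tn(2)[of n] nonzero_words_lists
        by (intro word_eval_in_span[OF letters_closed coord(1)[OF a]]) blast+
      then show "a \<in> (\<Union>n. L n)" using coord(3)[OF a] by auto
    qed
  qed (use LA in blast)
  moreover have "(\<lambda>n. real (sdim K A (prodsp (L n) V)) / real (sdim K A (L n))) \<longlonglongrightarrow> 1"
  proof (rule real_tendsto_sandwich)
    have "1 \<le> real (sdim K A (prodsp (L n) V)) / real (sdim K A (L n))" for n
    proof -
      have "sdim K A (L n) \<le> sdim K A (prodsp (L n) V)"
        using fd_subspace_mono(2)[OF fd_prodsp[OF fd V] fd_subspaceD[OF fd]] subset_prodsp[OF LA VA V1] .
      then show ?thesis using pos[of n] by simp
    qed
    then show "\<forall>\<^sub>F n in sequentially. 1 \<le> real (sdim K A (prodsp (L n) V)) / real (sdim K A (L n))"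
      by simp
    have "real (sdim K A (prodsp (L n) V)) / real (sdim K A (L n)) \<le> 1 + 1 / real (Suc n)" for n
      using T(1)[of n] pos[of n] unfolding P_def L_def[symmetric] by (simp add: L_def divide_simps)
    then show "\<forall>\<^sub>F n in sequentially. real (sdim K A (prodsp (L n) V)) / real (sdim K A (L n))
        \<le> 1 + 1 / real (Suc n)" by simp
    show "(\<lambda>n. 1 + 1 / real (Suc n)) \<longlonglongrightarrow> 1"
      using tendsto_add[OF tendsto_const LIMSEQ_inverse_real_of_nat, of 1] by (simp add: inverse_eq_divide)
  qed simp
  ultimately have "folner_sequence K A V L" unfolding folner_sequence_def using fd Lnz by blast
  moreover have "spanned_by_monomials K X x A (L n)" for n
    unfolding spanned_by_monomials_def monomials_def L_def using Tn(2)[of n] nonzero_words_lists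
    by (intro exI[of _ "mon ` T n"]) blast
  ultimately show ?thesis unfolding has_monomial_folner_sequence_def by blast
qed

end


section \<open>A Folner sequence makes an algebra exhaustively amenable\<close>

text \<open>Right multiplication by \<open>V\<close> enlarges \<open>L n\<close> by \<open>o(dim (L n))\<close> dimensions. Elements with this property
  are closed under linear combinations and products, since the new vectors produced by the first
  factor produce at most as many under the second. As \<open>V\<close> generates \<open>A\<close>, all elements have it, and so do
  finite sets of elements.\<close>

lemma (in assoc_algebra) folner_sequence_imp_exhaustively_amenable:
  assumes V: "generating_subspace K A V" and L: "folner_sequence K A V L"
  shows "exhaustively_amenable_module K A A (mult A)"
proof -
  define d where "d n = real (sdim K A (L n))" for n
  have fdV: "fd_subspace K A V" and V1: "\<one>\<^bsub>A\<^esub> \<in> V"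
    and gen: "\<And>B. \<lbrakk>subspace K B A; \<one>\<^bsub>A\<^esub> \<in> B; \<And>a b. a \<in> B \<Longrightarrow> b \<in> B \<Longrightarrow> a \<otimes>\<^bsub>A\<^esub> b \<in> B; V \<subseteq> B\<rbrakk>
      \<Longrightarrow> B = carrier A"
    using V unfolding generating_subspace_def by blast+
  have fdL: "fd_subspace K A (L n)" and Lnz: "L n \<noteq> {\<zero>\<^bsub>A\<^esub>}" and inc: "incseq L"
    and cover: "(\<Union>n. L n) = carrier A"
    and lim: "(\<lambda>n. real (sdim K A (prodsp (L n) V)) / d n) \<longlonglongrightarrow> 1" for n
    using L unfolding folner_sequence_def d_def by auto
  have pos: "d n > 0" for n unfolding d_def using sdim_pos[OF fdL Lnz] by simp
  have subL: "subspace K (L n) A" for n by (rule fd_subspaceD[OF fdL])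
  have LA: "L n \<subseteq> carrier A" for n by (rule subspaceD(1)[OF subL])
  have VA: "V \<subseteq> carrier A" by (rule subspaceD(1)[OF fd_subspaceD[OF fdV]])
  \<comment> \<open>The vectors by which \<open>L n G\<close> exceeds \<open>L n\<close> are described by a finite set \<open>F\<close> rather than by a dimension;
     such sets can be united and multiplied.\<close>
  define small where "small G \<longleftrightarrow> (\<forall>\<epsilon>>0. \<exists>N. \<forall>n\<ge>N. \<exists>F. finite F \<and> F \<subseteq> carrier A \<and>
    real (card F) \<le> \<epsilon> * d n \<and> (\<forall>l\<in>L n. \<forall>g\<in>G. l \<otimes>\<^bsub>A\<^esub> g \<in> span (L n \<union> F)))" for G
  have smallD: "\<exists>N. \<forall>n\<ge>N. \<exists>F. finite F \<and> F \<subseteq> carrier A \<and> real (card F) \<le> \<epsilon> * d n \<and>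
    (\<forall>l\<in>L n. \<forall>g\<in>G. l \<otimes>\<^bsub>A\<^esub> g \<in> span (L n \<union> F))" if "small G" "\<epsilon> > 0" for G and \<epsilon> :: real
    using that unfolding small_def by blast
  have LF: "subspace K (span (L n \<union> F)) A" "L n \<subseteq> span (L n \<union> F)" "F \<subseteq> span (L n \<union> F)"
    if "F \<subseteq> carrier A" for F n
    using that LA[of n] in_own_span[of "L n \<union> F"] span_is_subspace[of "L n \<union> F"] by auto
  have smallI: "small G"
    if "\<And>n. \<forall>l\<in>L n. \<forall>g\<in>G. l \<otimes>\<^bsub>A\<^esub> g \<in> span (L n)" for G
    unfolding small_def
  proof (intro allI impI)
    fix \<epsilon> :: real assume "\<epsilon> > 0"
    then have "real (card {}) \<le> \<epsilon> * d n" for n using pos[of n] by simp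
    then show "\<exists>N. \<forall>n\<ge>N. \<exists>F. finite F \<and> F \<subseteq> carrier A \<and> real (card F) \<le> \<epsilon> * d n \<and>
        (\<forall>l\<in>L n. \<forall>g\<in>G. l \<otimes>\<^bsub>A\<^esub> g \<in> span (L n \<union> F))"
      using that by (intro exI[of _ 0] allI impI exI[of _ "{}"]) auto
  qed
  have small_Un: "small (G \<union> H)" if G: "small G" and H: "small H" for G H
    unfolding small_def
  proof (intro allI impI)
    fix \<epsilon> :: real assume \<epsilon>: "\<epsilon> > 0"
    obtain N where N: "\<forall>n\<ge>N. \<exists>F. finite F \<and> F \<subseteq> carrier A \<and> real (card F) \<le> \<epsilon> / 2 * d n \<and>
        (\<forall>l\<in>L n. \<forall>g\<in>G. l \<otimes>\<^bsub>A\<^esub> g \<in> span (L n \<union> F))" using smallD[OF G, of "\<epsilon> / 2"] \<epsilon> by auto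
    obtain N' where N': "\<forall>n\<ge>N'. \<exists>F. finite F \<and> F \<subseteq> carrier A \<and> real (card F) \<le> \<epsilon> / 2 * d n \<and>
        (\<forall>l\<in>L n. \<forall>g\<in>H. l \<otimes>\<^bsub>A\<^esub> g \<in> span (L n \<union> F))" using smallD[OF H, of "\<epsilon> / 2"] \<epsilon> by auto
    show "\<exists>N. \<forall>n\<ge>N. \<exists>F. finite F \<and> F \<subseteq> carrier A \<and> real (card F) \<le> \<epsilon> * d n \<and>
        (\<forall>l\<in>L n. \<forall>g\<in>G \<union> H. l \<otimes>\<^bsub>A\<^esub> g \<in> span (L n \<union> F))"
    proof (intro exI[of _ "max N N'"] allI impI)
      fix n assume n: "max N N' \<le> n"
      obtain F where F: "finite F" "F \<subseteq> carrier A" "real (card F) \<le> \<epsilon> / 2 * d n"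
        "\<forall>l\<in>L n. \<forall>g\<in>G. l \<otimes>\<^bsub>A\<^esub> g \<in> span (L n \<union> F)" using N n by auto
      obtain F' where F': "finite F'" "F' \<subseteq> carrier A" "real (card F') \<le> \<epsilon> / 2 * d n"
        "\<forall>l\<in>L n. \<forall>g\<in>H. l \<otimes>\<^bsub>A\<^esub> g \<in> span (L n \<union> F')" using N' n by auto
      have "span (L n \<union> F) \<subseteq> span (L n \<union> (F \<union> F'))" "span (L n \<union> F') \<subseteq> span (L n \<union> (F \<union> F'))"
        by (intro span_is_monotone; blast)+
      then have "\<forall>l\<in>L n. \<forall>g\<in>G \<union> H. l \<otimes>\<^bsub>A\<^esub> g \<in> span (L n \<union> (F \<union> F'))"
        using F(4) F'(4) by blast
      moreover have "real (card (F \<union> F')) \<le> \<epsilon> * d n"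
        using card_Un_le[of F F'] F(3) F'(3) by (simp add: field_simps)
      ultimately show "\<exists>F. finite F \<and> F \<subseteq> carrier A \<and> real (card F) \<le> \<epsilon> * d n \<and>
          (\<forall>l\<in>L n. \<forall>g\<in>G \<union> H. l \<otimes>\<^bsub>A\<^esub> g \<in> span (L n \<union> F))"
        using F(1,2) F'(1,2) by (intro exI[of _ "F \<union> F'"]) auto
    qed
  qed
  have small_mono: "small H"
    if G: "small G"
      and GH: "\<And>n F h l. F \<subseteq> carrier A \<Longrightarrow> \<forall>l\<in>L n. \<forall>g\<in>G. l \<otimes>\<^bsub>A\<^esub> g \<in> span (L n \<union> F) \<Longrightarrow>
        l \<in> L n \<Longrightarrow> h \<in> H \<Longrightarrow> l \<otimes>\<^bsub>A\<^esub> h \<in> span (L n \<union> F)" for G H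
    unfolding small_def
  proof (intro allI impI)
    fix \<epsilon> :: real assume \<epsilon>: "\<epsilon> > 0"
    obtain N where N: "\<forall>n\<ge>N. \<exists>F. finite F \<and> F \<subseteq> carrier A \<and> real (card F) \<le> \<epsilon> * d n \<and>
        (\<forall>l\<in>L n. \<forall>g\<in>G. l \<otimes>\<^bsub>A\<^esub> g \<in> span (L n \<union> F))" using smallD[OF G \<epsilon>] by auto
    show "\<exists>N. \<forall>n\<ge>N. \<exists>F. finite F \<and> F \<subseteq> carrier A \<and> real (card F) \<le> \<epsilon> * d n \<and>
        (\<forall>l\<in>L n. \<forall>h\<in>H. l \<otimes>\<^bsub>A\<^esub> h \<in> span (L n \<union> F))"
    proof (intro exI[of _ N] allI impI)
      fix n assume "N \<le> n"
      then obtain F where F: "finite F" "F \<subseteq> carrier A" "real (card F) \<le> \<epsilon> * d n"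
        "\<forall>l\<in>L n. \<forall>g\<in>G. l \<otimes>\<^bsub>A\<^esub> g \<in> span (L n \<union> F)" using N by auto
      then show "\<exists>F. finite F \<and> F \<subseteq> carrier A \<and> real (card F) \<le> \<epsilon> * d n \<and>
        (\<forall>l\<in>L n. \<forall>h\<in>H. l \<otimes>\<^bsub>A\<^esub> h \<in> span (L n \<union> F))"
        using GH[OF F(2,4)] by (intro exI[of _ F]) simp
    qed
  qed
  have small_mult: "small {a \<otimes>\<^bsub>A\<^esub> b}"
    if a: "small {a}" "a \<in> carrier A" and b: "small {b}" "b \<in> carrier A" for a b
    unfolding small_def
  proof (intro allI impI)
    fix \<epsilon> :: real assume \<epsilon>: "\<epsilon> > 0"
    obtain N where N: "\<forall>n\<ge>N. \<exists>F. finite F \<and> F \<subseteq> carrier A \<and> real (card F) \<le> \<epsilon> / 2 * d n \<and>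
        (\<forall>l\<in>L n. \<forall>g\<in>{a}. l \<otimes>\<^bsub>A\<^esub> g \<in> span (L n \<union> F))" using smallD[OF a(1), of "\<epsilon> / 2"] \<epsilon> by auto
    obtain N' where N': "\<forall>n\<ge>N'. \<exists>F. finite F \<and> F \<subseteq> carrier A \<and> real (card F) \<le> \<epsilon> / 2 * d n \<and>
        (\<forall>l\<in>L n. \<forall>g\<in>{b}. l \<otimes>\<^bsub>A\<^esub> g \<in> span (L n \<union> F))" using smallD[OF b(1), of "\<epsilon> / 2"] \<epsilon> by auto
    show "\<exists>N. \<forall>n\<ge>N. \<exists>F. finite F \<and> F \<subseteq> carrier A \<and> real (card F) \<le> \<epsilon> * d n \<and>
        (\<forall>l\<in>L n. \<forall>g\<in>{a \<otimes>\<^bsub>A\<^esub> b}. l \<otimes>\<^bsub>A\<^esub> g \<in> span (L n \<union> F))"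
    proof (intro exI[of _ "max N N'"] allI impI)
      fix n assume n: "max N N' \<le> n"
      obtain F where F: "finite F" "F \<subseteq> carrier A" "real (card F) \<le> \<epsilon> / 2 * d n"
        "\<forall>l\<in>L n. \<forall>g\<in>{a}. l \<otimes>\<^bsub>A\<^esub> g \<in> span (L n \<union> F)" using N n by auto
      obtain F' where F': "finite F'" "F' \<subseteq> carrier A" "real (card F') \<le> \<epsilon> / 2 * d n"
        "\<forall>l\<in>L n. \<forall>g\<in>{b}. l \<otimes>\<^bsub>A\<^esub> g \<in> span (L n \<union> F')" using N' n by auto
      let ?H = "F' \<union> (\<lambda>f. f \<otimes>\<^bsub>A\<^esub> b) ` F"
      have H: "finite ?H" "?H \<subseteq> carrier A" using F F' b by auto
      have "span (L n \<union> F) \<subseteq> {z \<in> carrier A. z \<otimes>\<^bsub>A\<^esub> b \<in> span (L n \<union> ?H)}"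
      proof (rule span_subset_subspace[OF subspace_left_transporter[OF LF(1)[OF H(2)] b(2)]])
        have "span (L n \<union> F') \<subseteq> span (L n \<union> ?H)" by (intro span_is_monotone) blast
        then show "L n \<union> F \<subseteq> {z \<in> carrier A. z \<otimes>\<^bsub>A\<^esub> b \<in> span (L n \<union> ?H)}"
          using F'(4) LF(3)[OF H(2), of n] LA F(2) by blast
      qed
      then have "l \<otimes>\<^bsub>A\<^esub> (a \<otimes>\<^bsub>A\<^esub> b) \<in> span (L n \<union> ?H)" if l: "l \<in> L n" for l
      proof -
        have "(l \<otimes>\<^bsub>A\<^esub> a) \<otimes>\<^bsub>A\<^esub> b \<in> span (L n \<union> ?H)"
          using \<open>span (L n \<union> F) \<subseteq> _\<close> F(4) l by blast
        then show ?thesis using m_assoc[of l a b] LA[of n] l a(2) b(2) by auto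
      qed
      then have "\<forall>l\<in>L n. \<forall>g\<in>{a \<otimes>\<^bsub>A\<^esub> b}. l \<otimes>\<^bsub>A\<^esub> g \<in> span (L n \<union> ?H)"
        by blast
      moreover have "real (card ?H) \<le> \<epsilon> * d n"
      proof -
        have "card ?H \<le> card F' + card F"
          using card_Un_le[of F'] card_image_le[OF F(1), of "\<lambda>f. f \<otimes>\<^bsub>A\<^esub> b"] by (meson add_left_mono order_trans)
        then show ?thesis using F(3) F'(3) by (simp add: field_simps)
      qed
      ultimately show "\<exists>F. finite F \<and> F \<subseteq> carrier A \<and> real (card F) \<le> \<epsilon> * d n \<and>
          (\<forall>l\<in>L n. \<forall>g\<in>{a \<otimes>\<^bsub>A\<^esub> b}. l \<otimes>\<^bsub>A\<^esub> g \<in> span (L n \<union> F))"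
        using H by (intro exI[of _ ?H]) simp
    qed
  qed
  have small_V: "small V"
    unfolding small_def
  proof (intro allI impI)
    fix \<epsilon> :: real assume \<epsilon>: "\<epsilon> > 0"
    have "\<forall>\<^sub>F n in sequentially. real (sdim K A (prodsp (L n) V)) / d n < 1 + \<epsilon>"
      using order_tendstoD(2)[OF lim, of "1 + \<epsilon>"] \<epsilon> by simp
    then obtain N where N: "\<forall>n\<ge>N. real (sdim K A (prodsp (L n) V)) / d n < 1 + \<epsilon>"
      unfolding eventually_sequentially by blast
    show "\<exists>N. \<forall>n\<ge>N. \<exists>F. finite F \<and> F \<subseteq> carrier A \<and> real (card F) \<le> \<epsilon> * d n \<and>
        (\<forall>l\<in>L n. \<forall>g\<in>V. l \<otimes>\<^bsub>A\<^esub> g \<in> span (L n \<union> F))"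
    proof (intro exI[of _ N] allI impI)
      fix n assume n: "N \<le> n"
      have "real (sdim K A (prodsp (L n) V)) / d n < 1 + \<epsilon>" using N n by blast
      then have lt: "real (sdim K A (prodsp (L n) V)) < (1 + \<epsilon>) * d n"
        by (simp only: pos_divide_less_eq[OF pos])
      have sub: "L n \<subseteq> prodsp (L n) V" by (rule subset_prodsp[OF LA VA V1])
      obtain F where F: "finite F" "F \<subseteq> carrier A"
        "card F \<le> sdim K A (prodsp (L n) V) - sdim K A (L n)" "span (L n \<union> F) = prodsp (L n) V"
        using fd_subspace_extend[OF fd_prodsp[OF fdL fdV] fdL sub] .
      have "sdim K A (L n) \<le> sdim K A (prodsp (L n) V)"
        using fd_subspace_mono(2)[OF fd_prodsp[OF fdL fdV] subL sub] .
      then have "real (card F) \<le> \<epsilon> * d n" using F(3) lt unfolding d_def by (simp add: algebra_simps)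
      moreover have "\<forall>l\<in>L n. \<forall>g\<in>V. l \<otimes>\<^bsub>A\<^esub> g \<in> span (L n \<union> F)"
        using F(4) mult_in_prodsp[OF LA VA] by simp
      ultimately show "\<exists>F. finite F \<and> F \<subseteq> carrier A \<and> real (card F) \<le> \<epsilon> * d n \<and>
        (\<forall>l\<in>L n. \<forall>g\<in>V. l \<otimes>\<^bsub>A\<^esub> g \<in> span (L n \<union> F))" using F(1,2) by blast
    qed
  qed
  let ?B = "{a \<in> carrier A. small {a}}"
  have "?B = carrier A"
  proof (rule gen)
    show "subspace K ?B A"
    proof (rule subspaceI)
      show "\<zero>\<^bsub>A\<^esub> \<in> ?B"
        using smallI[of "{\<zero>\<^bsub>A\<^esub>}"] LA span_zero by (auto simp: subset_iff)
      show "a \<oplus>\<^bsub>A\<^esub> b \<in> ?B" if "a \<in> ?B" "b \<in> ?B" for a b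
      proof -
        have ab: "small ({a} \<union> {b})" "a \<in> carrier A" "b \<in> carrier A" using that small_Un[of "{a}" "{b}"] by blast+
        have "small {a \<oplus>\<^bsub>A\<^esub> b}"
        proof (rule small_mono[OF ab(1)])
          fix n F h l
          assume F: "F \<subseteq> carrier A" "\<forall>l\<in>L n. \<forall>g\<in>{a} \<union> {b}. l \<otimes>\<^bsub>A\<^esub> g \<in> span (L n \<union> F)"
            and l: "l \<in> L n" and h: "h \<in> {a \<oplus>\<^bsub>A\<^esub> b}"
          have "l \<otimes>\<^bsub>A\<^esub> h = l \<otimes>\<^bsub>A\<^esub> a \<oplus>\<^bsub>A\<^esub> l \<otimes>\<^bsub>A\<^esub> b" using h l LA[of n] ab by (auto simp: r_distr)
          then show "l \<otimes>\<^bsub>A\<^esub> h \<in> span (L n \<union> F)" using F(2) l subspaceD(3)[OF LF(1)[OF F(1)]] by auto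
        qed
        then show ?thesis using ab by simp
      qed
      show "c \<odot>\<^bsub>A\<^esub> a \<in> ?B" if c: "c \<in> carrier K" and aB: "a \<in> ?B" for c a
      proof -
        have a: "small {a}" "a \<in> carrier A" using aB by auto
        have "small {c \<odot>\<^bsub>A\<^esub> a}"
        proof (rule small_mono[OF a(1)])
          fix n F h l
          assume F: "F \<subseteq> carrier A" "\<forall>l\<in>L n. \<forall>g\<in>{a}. l \<otimes>\<^bsub>A\<^esub> g \<in> span (L n \<union> F)"
            and l: "l \<in> L n" and h: "h \<in> {c \<odot>\<^bsub>A\<^esub> a}"
          have "l \<otimes>\<^bsub>A\<^esub> h = c \<odot>\<^bsub>A\<^esub> (l \<otimes>\<^bsub>A\<^esub> a)" using h l LA[of n] a c by (auto simp: smult_mult_right)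
          then show "l \<otimes>\<^bsub>A\<^esub> h \<in> span (L n \<union> F)" using F(2) l subspaceD(4)[OF LF(1)[OF F(1)] c] by auto
        qed
        then show ?thesis using a c by simp
      qed
    qed auto
    show "\<one>\<^bsub>A\<^esub> \<in> ?B"
      using smallI[of "{\<one>\<^bsub>A\<^esub>}"] LA in_own_span[OF LA] by (auto simp: subset_iff)
    show "a \<otimes>\<^bsub>A\<^esub> b \<in> ?B" if "a \<in> ?B" "b \<in> ?B" for a b using that small_mult by simp
    show "V \<subseteq> ?B"
    proof
      fix v assume v: "v \<in> V"
      have "small {v}" by (rule small_mono[OF small_V]) (use v in auto)
      then show "v \<in> ?B" using v VA by blast
    qed
  qed
  then have small1: "small {a}" if "a \<in> carrier A" for a using that by blast
  have small_finite: "small G" if "finite G" "G \<subseteq> carrier A" for G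
    using that
  proof (induction G)
    case (insert a G)
    then have "small ({a} \<union> G)" by (intro small_Un small1) auto
    then show ?case by simp
  qed (auto intro: smallI)
  show ?thesis
    unfolding exhaustively_amenable_module_def
  proof (intro allI impI)
    fix V W :: "'a set" and \<epsilon> :: real
    assume "fd_subspace K A V \<and> \<epsilon> > 0 \<and> fd_subspace K A W"
    then have V: "fd_subspace K A V" and \<epsilon>: "\<epsilon> > 0" and W: "fd_subspace K A W" by auto
    obtain G where G: "finite G" "G \<subseteq> carrier A" "span G = V" using fd_subspace_basis[OF V] .
    obtain N where N: "\<forall>n\<ge>N. \<exists>F. finite F \<and> F \<subseteq> carrier A \<and> real (card F) \<le> \<epsilon> / 2 * d n \<and>
        (\<forall>l\<in>L n. \<forall>g\<in>G. l \<otimes>\<^bsub>A\<^esub> g \<in> span (L n \<union> F))"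
      using smallD[OF small_finite[OF G(1,2)], of "\<epsilon> / 2"] \<epsilon> by auto
    obtain N' where N': "\<forall>n\<ge>N'. W \<subseteq> L n" using fd_subspace_subset_UN[OF W inc subL cover] by blast
    define n where "n = max N N'"
    have n: "N \<le> n" "N' \<le> n" by (simp_all add: n_def)
    obtain F where F: "finite F" "F \<subseteq> carrier A" "real (card F) \<le> \<epsilon> / 2 * d n"
      "\<forall>l\<in>L n. \<forall>g\<in>G. l \<otimes>\<^bsub>A\<^esub> g \<in> span (L n \<union> F)"
      using N[THEN spec, THEN mp, OF n(1)] by (elim exE conjE)
    have "prodsp (span (L n)) (span G) \<subseteq> span (L n \<union> F)"
      by (rule prodsp_span_subset[OF LF(1)[OF F(2)] LA G(2)]) (use F(4) in blast)
    then have "prodsp (L n) V \<subseteq> span (L n \<union> F)" using span_subspace_id[OF subL] G(3) by simp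
    moreover have "subspace K (prodsp (L n) V) A" by (rule fd_subspaceD[OF fd_prodsp[OF fdL V]])
    ultimately have "sdim K A (prodsp (L n) V) \<le> sdim K A (L n) + card F"
      using fd_subspace_mono(2)[OF fd_subspace_span_Un(1)[OF fdL F(1,2)]]
        fd_subspace_span_Un(2)[OF fdL[of n] F(1,2)] by (meson order_trans)
    then have "real (sdim K A (prodsp (L n) V)) \<le> d n + \<epsilon> / 2 * d n"
      using F(3) unfolding d_def by linarith
    also have "\<dots> < (1 + \<epsilon>) * d n" using pos[of n] \<epsilon> by (simp add: algebra_simps)
    finally have "almost_invariant K A (mult A) V \<epsilon> (L n)"
      unfolding almost_invariant_def d_def using fdL by blast
    moreover have "W \<subseteq> L n" using N' n(2) by simp
    ultimately show "\<exists>L. almost_invariant K A (mult A) V \<epsilon> L \<and> W \<subseteq> L" by blast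
  qed
qed

section \<open>Exhaustive amenability and quotients by finite-dimensional ideals\<close>

context algebra_epi
begin

lemma image_subspace:
  assumes "subspace K L A"
  shows "subspace K (h ` L) B"
proof (rule B.subspaceI)
  note L = A.subspaceD[OF assms]
  show "h ` L \<subseteq> carrier B" using L(1) by auto
  show "\<zero>\<^bsub>B\<^esub> \<in> h ` L" using L(2) zero by (metis image_eqI)
  show "v \<oplus>\<^bsub>B\<^esub> w \<in> h ` L" if v: "v \<in> h ` L" and w: "w \<in> h ` L" for v w
  proof -
    obtain a b where "a \<in> L" "b \<in> L" "v = h a" "w = h b" using v w by blast
    then show ?thesis using add[of a b] L(1,3) by (metis image_eqI subsetD)
  qed
  show "c \<odot>\<^bsub>B\<^esub> v \<in> h ` L" if c: "c \<in> carrier K" and v: "v \<in> h ` L" for c v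
  proof -
    obtain a where "a \<in> L" "v = h a" using v by blast
    then show ?thesis using smult[of c a] L(1,4) c by (metis image_eqI subsetD)
  qed
qed

lemma preimage_subspace:
  assumes "subspace K M B"
  shows "subspace K {a \<in> carrier A. h a \<in> M} A"
  using B.subspaceD[OF assms] by (intro A.subspaceI) (auto simp: zero add smult)

lemma image_span:
  assumes "F \<subseteq> carrier A"
  shows "h ` A.span F = B.span (h ` F)"
proof
  have hF: "h ` F \<subseteq> carrier B" using assms by auto
  have "A.span F \<subseteq> {a \<in> carrier A. h a \<in> B.span (h ` F)}"
    using assms B.in_own_span[OF hF]
    by (intro A.span_subset_subspace[OF preimage_subspace[OF B.span_is_subspace[OF hF]]]) auto
  then show "h ` A.span F \<subseteq> B.span (h ` F)" by auto
  show "B.span (h ` F) \<subseteq> h ` A.span F"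
    using A.in_own_span[OF assms]
    by (intro B.span_subset_subspace[OF image_subspace[OF A.span_is_subspace[OF assms]]]) auto
qed

lemma fd_image:
  assumes "fd_subspace K A L"
  shows "fd_subspace K B (h ` L)" "sdim K B (h ` L) \<le> sdim K A L"
proof -
  obtain F where F: "finite F" "F \<subseteq> carrier A" "A.span F = L" "card F = sdim K A L"
    using A.fd_subspace_basis[OF assms] by metis
  have hF: "finite (h ` F)" "h ` F \<subseteq> carrier B" using F by auto
  show "fd_subspace K B (h ` L)" "sdim K B (h ` L) \<le> sdim K A L"
    using B.fd_subspace_span[OF hF] image_span[OF F(2)] F(3,4) card_image_le[OF F(1), of h] by auto
qed

lemma lift_finite:
  assumes "finite G" "G \<subseteq> h ` L"
  obtains F where "finite F" "F \<subseteq> L" "h ` F = G" "card F = card G"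
proof -
  obtain F where "F \<subseteq> L" "finite F" "G = h ` F" "inj_on h F"
    using assms by (metis finite_imageD subset_image_inj)
  then show ?thesis using that card_image by metis
qed

lemma lift_fd_subspace:
  assumes "fd_subspace K B W"
  obtains V where "fd_subspace K A V" "h ` V = W"
proof -
  obtain G where G: "finite G" "G \<subseteq> carrier B" "B.span G = W" using B.fd_subspace_basis[OF assms] .
  obtain F where F: "finite F" "F \<subseteq> carrier A" "h ` F = G"
    using lift_finite[OF G(1), of "carrier A"] G(2) surj by metis
  show ?thesis using that[OF A.fd_subspace_span(1)[OF F(1,2)]] image_span[OF F(2)] F(3) G(3) by simp
qed

text \<open>\<open>L\<close> is contained in the sum of the kernel and the span of lifts of a basis of \<open>h ` L\<close>.\<close>

lemma fd_if_fd_image: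
  assumes ker: "fd_subspace K A {a \<in> carrier A. h a = \<zero>\<^bsub>B\<^esub>}" (is "fd_subspace K A ?N")
    and L: "subspace K L A" and hL: "fd_subspace K B (h ` L)"
  shows "fd_subspace K A L" "sdim K A L \<le> sdim K B (h ` L) + sdim K A ?N"
proof -
  note LA = A.subspaceD(1)[OF L]
  obtain G where G: "finite G" "G \<subseteq> h ` L" "B.span G = h ` L" "card G = sdim K B (h ` L)"
    using B.fd_subspace_basis[OF hL] by metis
  obtain F where F: "finite F" "F \<subseteq> L" "h ` F = G" "card F = card G" using lift_finite[OF G(1,2)] .
  have FA: "F \<subseteq> carrier A" using F(2) LA by blast
  have NF: "?N \<union> F \<subseteq> carrier A" using FA by auto
  note NFs = A.span_is_subspace[OF NF]
  have "L \<subseteq> A.span (?N \<union> F)"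
  proof
    fix a assume a: "a \<in> L"
    then have aA: "a \<in> carrier A" using LA by blast
    have "h a \<in> h ` A.span F" using a image_span[OF FA] F(3) G(3) by auto
    then obtain b where b: "b \<in> A.span F" "h a = h b" by blast
    have bA: "b \<in> carrier A" using b(1) A.span_is_subset2[OF FA] by blast
    have "h (a \<ominus>\<^bsub>A\<^esub> b) = \<zero>\<^bsub>B\<^esub>"
    proof -
      have "a \<ominus>\<^bsub>A\<^esub> b = a \<oplus>\<^bsub>A\<^esub> (\<ominus>\<^bsub>K\<^esub> \<one>\<^bsub>K\<^esub>) \<odot>\<^bsub>A\<^esub> b"
        using A.smult_minus_1[OF bA] by (simp add: a_minus_def)
      then have "h (a \<ominus>\<^bsub>A\<^esub> b) = h b \<oplus>\<^bsub>B\<^esub> (\<ominus>\<^bsub>K\<^esub> \<one>\<^bsub>K\<^esub>) \<odot>\<^bsub>B\<^esub> h b"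
        using aA bA b(2) by (simp add: add smult)
      then show ?thesis using B.smult_minus_1[OF closed[OF bA]] bA by (simp add: B.r_neg)
    qed
    then have "a \<ominus>\<^bsub>A\<^esub> b \<in> A.span (?N \<union> F)" using A.in_own_span[OF NF] aA bA by auto
    moreover have "b \<in> A.span (?N \<union> F)" using b(1) A.span_is_monotone[of F "?N \<union> F"] by blast
    ultimately have "a \<ominus>\<^bsub>A\<^esub> b \<oplus>\<^bsub>A\<^esub> b \<in> A.span (?N \<union> F)" by (rule A.subspaceD(3)[OF NFs])
    then show "a \<in> A.span (?N \<union> F)" using aA bA by (simp add: a_minus_def A.a_assoc A.l_neg)
  qed
  note mono = A.fd_subspace_mono[OF A.fd_subspace_span_Un(1)[OF ker F(1) FA] L this]
  show "fd_subspace K A L" by (rule mono(1))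
  show "sdim K A L \<le> sdim K B (h ` L) + sdim K A ?N"
    using mono(2) A.fd_subspace_span_Un(2)[OF ker F(1) FA] F(4) G(4) by simp
qed

lemma image_prodsp:
  assumes "L \<subseteq> carrier A" "V \<subseteq> carrier A"
  shows "h ` A.prodsp L V = B.prodsp (h ` L) (h ` V)"
proof -
  have P: "{l \<otimes>\<^bsub>A\<^esub> v | l v. l \<in> L \<and> v \<in> V} \<subseteq> carrier A" using assms by auto
  have "h ` {l \<otimes>\<^bsub>A\<^esub> v | l v. l \<in> L \<and> v \<in> V} = {l \<otimes>\<^bsub>B\<^esub> v | l v. l \<in> h ` L \<and> v \<in> h ` V}" (is "h ` ?P = ?Q")
  proof
    show "h ` ?P \<subseteq> ?Q"
    proof
      fix z assume "z \<in> h ` ?P"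
      then obtain l v where lv: "l \<in> L" "v \<in> V" "z = h (l \<otimes>\<^bsub>A\<^esub> v)" by blast
      then have "z = h l \<otimes>\<^bsub>B\<^esub> h v" using mult[of l v] assms by blast
      then show "z \<in> ?Q" using lv(1,2) by blast
    qed
    show "?Q \<subseteq> h ` ?P"
    proof
      fix z assume "z \<in> ?Q"
      then obtain l v where lv: "l \<in> L" "v \<in> V" "z = h l \<otimes>\<^bsub>B\<^esub> h v" by blast
      then have "z = h (l \<otimes>\<^bsub>A\<^esub> v)" using mult[of l v] assms by (metis subsetD)
      then show "z \<in> h ` ?P" using lv(1,2) by blast
    qed
  qed
  then show ?thesis unfolding subspace_prod_def using image_span[OF P] by simp
qed

text \<open>A subspace and its image, and the corresponding products, differ in dimension by at most the
  dimension \<open>s\<close> of the kernel. Exhaustive amenability allows the invariant subspace to contain a prescribed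
  subspace \<open>U\<close> so large that \<open>(1 + \<epsilon> / 2) s \<le> \<epsilon> / 2 * dim U\<close>; then \<open>\<epsilon> / 2\<close>-invariance on one side gives
  \<open>\<epsilon>\<close>-invariance on the other.\<close>

theorem exhaustively_amenable_iff:
  assumes ker: "fd_subspace K A {a \<in> carrier A. h a = \<zero>\<^bsub>B\<^esub>}" (is "fd_subspace K A ?N")
    and large: "\<And>m. \<exists>D. fd_subspace K B D \<and> m \<le> sdim K B D"
  shows "exhaustively_amenable_module K A A (mult A) \<longleftrightarrow> exhaustively_amenable_module K B B (mult B)"
proof -
  define s where "s = real (sdim K A ?N)"
  have bound: "\<exists>U. fd_subspace K B U \<and> W \<subseteq> U \<and> (1 + \<epsilon> / 2) * s \<le> \<epsilon> / 2 * real (sdim K B U)"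
    if W: "fd_subspace K B W" and \<epsilon>: "\<epsilon> > 0" for W and \<epsilon> :: real
  proof -
    obtain m :: nat where m: "(1 + \<epsilon> / 2) * s < real m * (\<epsilon> / 2)"
      using reals_Archimedean3[of "\<epsilon> / 2"] \<epsilon> by auto
    obtain D where D: "fd_subspace K B D" "m \<le> sdim K B D" using large by blast
    obtain F where F: "finite F" "F \<subseteq> carrier B" "B.span F = D" using B.fd_subspace_basis[OF D(1)] .
    let ?U = "B.span (W \<union> F)"
    have WF: "W \<union> F \<subseteq> carrier B" using F(2) B.subspaceD(1)[OF B.fd_subspaceD[OF W]] by blast
    have U: "fd_subspace K B ?U" by (rule B.fd_subspace_span_Un(1)[OF W F(1,2)])
    have "D \<subseteq> ?U" using F(3) B.span_is_monotone[of F "W \<union> F"] by blast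
    then have "m \<le> sdim K B ?U"
      using B.fd_subspace_mono(2)[OF U B.fd_subspaceD[OF D(1)]] D(2) by simp
    then have "real m * (\<epsilon> / 2) \<le> \<epsilon> / 2 * real (sdim K B ?U)" using \<epsilon> by simp
    then show ?thesis using m U B.in_own_span[OF WF] by (intro exI[of _ ?U]) auto
  qed
  show ?thesis
  proof
    assume am: "exhaustively_amenable_module K A A (mult A)"
    show "exhaustively_amenable_module K B B (mult B)"
      unfolding exhaustively_amenable_module_def
    proof (intro allI impI)
      fix V W :: "'b set" and \<epsilon> :: real
      assume "fd_subspace K B V \<and> \<epsilon> > 0 \<and> fd_subspace K B W"
      then have V: "fd_subspace K B V" and \<epsilon>: "\<epsilon> > 0" and W: "fd_subspace K B W" by auto
      obtain U where U: "fd_subspace K B U" "W \<subseteq> U" "(1 + \<epsilon> / 2) * s \<le> \<epsilon> / 2 * real (sdim K B U)"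
        using bound[OF W \<epsilon>] by blast
      obtain V' where V': "fd_subspace K A V'" "h ` V' = V" using lift_fd_subspace[OF V] .
      obtain U' where U': "fd_subspace K A U'" "h ` U' = U" using lift_fd_subspace[OF U(1)] .
      obtain L where L: "fd_subspace K A L" "U' \<subseteq> L"
        "real (sdim K A (A.prodsp L V')) < (1 + \<epsilon> / 2) * real (sdim K A L)"
        using am V'(1) U'(1) \<epsilon> unfolding exhaustively_amenable_module_def almost_invariant_def
        by (metis half_gt_zero)
      have hL: "fd_subspace K B (h ` L)" by (rule fd_image(1)[OF L(1)])
      have UL: "U \<subseteq> h ` L" using L(2) U'(2) by blast
      have "(1 + \<epsilon> / 2) * s \<le> \<epsilon> / 2 * real (sdim K B (h ` L))"
        using U(3) B.fd_subspace_mono(2)[OF hL B.fd_subspaceD[OF U(1)] UL] \<epsilon>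
        by (smt (verit) half_gt_zero mult_left_mono of_nat_mono)
      moreover have "real (sdim K A L) \<le> real (sdim K B (h ` L)) + s"
        using fd_if_fd_image(2)[OF ker A.fd_subspaceD[OF L(1)] hL] unfolding s_def by simp
      then have "(1 + \<epsilon> / 2) * real (sdim K A L) \<le> (1 + \<epsilon> / 2) * (real (sdim K B (h ` L)) + s)"
        using \<epsilon> by (intro mult_left_mono) auto
      moreover have "sdim K B (B.prodsp (h ` L) V) \<le> sdim K A (A.prodsp L V')"
        using fd_image(2)[OF A.fd_prodsp[OF L(1) V'(1)]] V'(2)
          image_prodsp[OF A.subspaceD(1)[OF A.fd_subspaceD[OF L(1)]] A.subspaceD(1)[OF A.fd_subspaceD[OF V'(1)]]]
        by simp
      ultimately have "real (sdim K B (B.prodsp (h ` L) V)) < (1 + \<epsilon>) * real (sdim K B (h ` L))"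
        using L(3) by (simp add: algebra_simps)
      then show "\<exists>L. almost_invariant K B (mult B) V \<epsilon> L \<and> W \<subseteq> L"
        using hL UL U(2) unfolding almost_invariant_def by blast
    qed
  next
    assume am: "exhaustively_amenable_module K B B (mult B)"
    show "exhaustively_amenable_module K A A (mult A)"
      unfolding exhaustively_amenable_module_def
    proof (intro allI impI)
      fix V W :: "'a set" and \<epsilon> :: real
      assume "fd_subspace K A V \<and> \<epsilon> > 0 \<and> fd_subspace K A W"
      then have V: "fd_subspace K A V" and \<epsilon>: "\<epsilon> > 0" and W: "fd_subspace K A W" by auto
      note VA = A.subspaceD(1)[OF A.fd_subspaceD[OF V]] and WA = A.subspaceD(1)[OF A.fd_subspaceD[OF W]]
      obtain U where U: "fd_subspace K B U" "h ` W \<subseteq> U" "(1 + \<epsilon> / 2) * s \<le> \<epsilon> / 2 * real (sdim K B U)"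
        using bound[OF fd_image(1)[OF W] \<epsilon>] by blast
      obtain L where L: "fd_subspace K B L" "U \<subseteq> L"
        "real (sdim K B (B.prodsp L (h ` V))) < (1 + \<epsilon> / 2) * real (sdim K B L)"
        using am fd_image(1)[OF V] U(1) \<epsilon> unfolding exhaustively_amenable_module_def almost_invariant_def
        by (metis half_gt_zero)
      note Ls = B.fd_subspaceD[OF L(1)]
      let ?M = "{a \<in> carrier A. h a \<in> L}"
      have hM: "h ` ?M = L"
      proof
        show "L \<subseteq> h ` ?M"
        proof
          fix l assume l: "l \<in> L"
          then obtain a where "a \<in> carrier A" "l = h a" using B.subspaceD(1)[OF Ls] surj by blast
          then show "l \<in> h ` ?M" using l by blast
        qed
      qed auto
      have M: "subspace K ?M A" by (rule preimage_subspace[OF Ls])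
      have fdM: "fd_subspace K A ?M" using fd_if_fd_image(1)[OF ker M] hM L(1) by simp
      have "sdim K B L \<le> sdim K A ?M" using fd_image(2)[OF fdM] hM by simp
      then have le: "(1 + \<epsilon>) * real (sdim K B L) \<le> (1 + \<epsilon>) * real (sdim K A ?M)"
        using \<epsilon> by (intro mult_left_mono) auto
      have P: "h ` A.prodsp ?M V = B.prodsp L (h ` V)"
        using image_prodsp[OF A.subspaceD(1)[OF M] VA] hM by simp
      have "sdim K A (A.prodsp ?M V) \<le> sdim K B (B.prodsp L (h ` V)) + sdim K A ?N"
        using fd_if_fd_image(2)[OF ker A.prodsp_carrier[OF A.subspaceD(1)[OF M] VA]] P
          B.fd_prodsp[OF L(1) fd_image(1)[OF V]] by simp
      then have "real (sdim K A (A.prodsp ?M V)) \<le> real (sdim K B (B.prodsp L (h ` V))) + s"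
        unfolding s_def by linarith
      moreover have "s \<le> \<epsilon> / 2 * real (sdim K B L)"
      proof -
        have "s \<le> (1 + \<epsilon> / 2) * s" using \<epsilon> unfolding s_def by (simp add: algebra_simps)
        also note U(3)
        also have "\<epsilon> / 2 * real (sdim K B U) \<le> \<epsilon> / 2 * real (sdim K B L)"
          using B.fd_subspace_mono(2)[OF L(1) B.fd_subspaceD[OF U(1)] L(2)] \<epsilon> by simp
        finally show ?thesis .
      qed
      ultimately have "real (sdim K A (A.prodsp ?M V)) < (1 + \<epsilon>) * real (sdim K A ?M)"
        using L(3) le by (simp add: algebra_simps)
      moreover have "W \<subseteq> ?M" using U(2) L(2) WA by blast
      ultimately show "\<exists>L. almost_invariant K A (mult A) V \<epsilon> L \<and> W \<subseteq> L"
        using fdM unfolding almost_invariant_def by blast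
    qed
  qed
qed

end


section \<open>The ideal of finitely prolongable monomials\<close>

context monomial_presentation
begin

definition dead_words :: "'x list set" where
  "dead_words = {w \<in> nonzero_words. \<not> inf_right_prolongable_monomial A X x (mon w)}"

lemma dead_words_nonzero: "dead_words \<subseteq> nonzero_words"
  by (auto simp: dead_words_def)

lemma dead_words_lists: "dead_words \<subseteq> lists X"
  using dead_words_nonzero nonzero_words_lists by blast

lemma dead_monomials:
  "{u \<in> monomials A X x. u \<noteq> \<zero>\<^bsub>A\<^esub> \<and> \<not> inf_right_prolongable_monomial A X x u}
    = mon ` dead_words"
  unfolding monomials_def dead_words_def nonzero_words_def
  by (auto simp del: in_lists_conv_set)

lemma word_append:
  "u \<in> lists X \<Longrightarrow> v \<in> lists X \<Longrightarrow> mon (u @ v) = mon u \<otimes>\<^bsub>A\<^esub> mon v"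
  by (rule word_image_append[OF _ _ letters_closed])

lemma append_lists: "u \<in> lists X \<Longrightarrow> v \<in> lists X \<Longrightarrow> u @ v \<in> lists X"
  by simp

lemma carrier_eq_span_words: "carrier A = span (mon ` lists X)"
proof
  show "carrier A \<subseteq> span (mon ` lists X)"
  proof
    fix a assume "a \<in> carrier A"
    then obtain f where f: "f \<in> carrier (free_algebra K X)" "a = word_eval x f"
      using word_eval_surj by blast
    have "{w. f w \<noteq> \<zero>\<^bsub>K\<^esub>} \<subseteq> lists X" using f(1) unfolding free_algebra_carrier by blast
    then show "a \<in> span (mon ` lists X)"
      using word_eval_in_span[OF letters_closed f(1)] f(2) by blast
  qed
qed (rule span_is_subset2[OF mons_closed[OF order_refl]])

lemma dead_append_right:
  assumes d: "d \<in> dead_words" and v: "v \<in> lists X" and nz: "d @ v \<in> nonzero_words"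
  shows "d @ v \<in> dead_words"
proof -
  have dX: "d \<in> lists X" using d dead_words_lists by blast
  have "inf_right_prolongable_monomial A X x (mon d)"
    if inf: "inf_right_prolongable_monomial A X x (mon (d @ v))"
    unfolding inf_right_prolongable_monomial_def
  proof
    fix n
    obtain w where w: "w \<in> lists X" "n \<le> length w" "mon (d @ v) \<otimes>\<^bsub>A\<^esub> mon w \<noteq> \<zero>\<^bsub>A\<^esub>"
      using inf unfolding inf_right_prolongable_monomial_def by blast
    have "mon d \<otimes>\<^bsub>A\<^esub> mon (v @ w) = mon (d @ v) \<otimes>\<^bsub>A\<^esub> mon w"
      using word_append dX v w(1) mon_closed by (simp add: m_assoc del: in_lists_conv_set)
    then show "\<exists>w\<in>lists X. n \<le> length w \<and> mon d \<otimes>\<^bsub>A\<^esub> mon w \<noteq> \<zero>\<^bsub>A\<^esub>"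
      using w append_lists[OF v w(1)] by (intro bexI[of _ "v @ w"]) auto
  qed
  then show ?thesis using d nz unfolding dead_words_def by blast
qed

lemma dead_append_left:
  assumes d: "d \<in> dead_words" and v: "v \<in> lists X" and nz: "v @ d \<in> nonzero_words"
  shows "v @ d \<in> dead_words"
proof -
  have dX: "d \<in> lists X" using d dead_words_lists by blast
  have "inf_right_prolongable_monomial A X x (mon d)"
    if inf: "inf_right_prolongable_monomial A X x (mon (v @ d))"
    unfolding inf_right_prolongable_monomial_def
  proof
    fix n
    obtain w where w: "w \<in> lists X" "n \<le> length w" "mon (v @ d) \<otimes>\<^bsub>A\<^esub> mon w \<noteq> \<zero>\<^bsub>A\<^esub>"
      using inf unfolding inf_right_prolongable_monomial_def by blast
    have "mon (v @ d) \<otimes>\<^bsub>A\<^esub> mon w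
        = mon v \<otimes>\<^bsub>A\<^esub> (mon d \<otimes>\<^bsub>A\<^esub> mon w)"
      using word_append[OF v dX] dX v w(1) mon_closed by (simp add: m_assoc del: in_lists_conv_set)
    then have "mon d \<otimes>\<^bsub>A\<^esub> mon w \<noteq> \<zero>\<^bsub>A\<^esub>" using w(3) mon_closed[OF v] by auto
    then show "\<exists>w\<in>lists X. n \<le> length w \<and> mon d \<otimes>\<^bsub>A\<^esub> mon w \<noteq> \<zero>\<^bsub>A\<^esub>"
      using w by blast
  qed
  then show ?thesis using d nz unfolding dead_words_def by blast
qed

definition dead_ideal :: "'a set" where
  "dead_ideal = span (mon ` dead_words)"

lemma dead_monomials_closed: "mon ` dead_words \<subseteq> carrier A"
  by (rule mons_closed[OF dead_words_lists])

lemma dead_ideal_subspace: "subspace K dead_ideal A"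
  unfolding dead_ideal_def by (rule span_is_subspace[OF dead_monomials_closed])

lemma mon_in_dead_ideal:
  assumes "w \<in> lists X" "w \<in> nonzero_words \<Longrightarrow> w \<in> dead_words"
  shows "mon w \<in> dead_ideal"
proof (cases "w \<in> nonzero_words")
  case True
  then show ?thesis
    using assms(2) in_own_span[OF dead_monomials_closed] unfolding dead_ideal_def by blast
next
  case False
  then have "mon w = \<zero>\<^bsub>A\<^esub>" using assms(1) unfolding nonzero_words_def by blast
  then show ?thesis using subspaceD(2)[OF dead_ideal_subspace] by simp
qed

lemma mon_in_dead_ideal_iff:
  assumes "w \<in> nonzero_words"
  shows "mon w \<in> dead_ideal \<longleftrightarrow> w \<in> dead_words"
proof
  assume "mon w \<in> dead_ideal"
  moreover have "\<one>\<^bsub>K\<^esub> \<noteq> \<zero>\<^bsub>K\<^esub>" by simp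
  then have "coord (mon w) w \<noteq> \<zero>\<^bsub>K\<^esub>" by (simp add: coord_word[OF assms] free_word_def)
  ultimately show "w \<in> dead_words"
    unfolding dead_ideal_def by (rule coord_span_words[OF dead_words_lists])
qed (use mon_in_dead_ideal nonzero_words_lists[OF assms] in blast)

lemma dead_ideal: "ideal dead_ideal A"
proof (rule subspace_imp_ideal[OF dead_ideal_subspace])
  fix a i assume a: "a \<in> carrier A" and i: "i \<in> dead_ideal"
  have a': "a \<in> span (mon ` lists X)" using a carrier_eq_span_words by simp
  have X: "mon ` lists X \<subseteq> carrier A" by (rule mons_closed[OF order_refl])
  show "a \<otimes>\<^bsub>A\<^esub> i \<in> dead_ideal"
  proof (rule span_mult_in_subspace[OF dead_ideal_subspace X dead_monomials_closed _ a' i[unfolded dead_ideal_def]])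
    fix f g assume "f \<in> mon ` lists X" "g \<in> mon ` dead_words"
    then obtain v d where vd: "v \<in> lists X" "d \<in> dead_words" "f = mon v" "g = mon d"
      by blast
    then have dX: "d \<in> lists X" using dead_words_lists by blast
    have "mon (v @ d) \<in> dead_ideal"
      by (rule mon_in_dead_ideal[OF append_lists[OF vd(1) dX]]) (rule dead_append_left[OF vd(2,1)])
    then show "f \<otimes>\<^bsub>A\<^esub> g \<in> dead_ideal" using word_append[OF vd(1) dX] vd by simp
  qed
  show "i \<otimes>\<^bsub>A\<^esub> a \<in> dead_ideal"
  proof (rule span_mult_in_subspace[OF dead_ideal_subspace dead_monomials_closed X _ i[unfolded dead_ideal_def] a'])
    fix g f assume "f \<in> mon ` lists X" "g \<in> mon ` dead_words"
    then obtain v d where vd: "v \<in> lists X" "d \<in> dead_words" "f = mon v" "g = mon d"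
      by blast
    then have dX: "d \<in> lists X" using dead_words_lists by blast
    have "mon (d @ v) \<in> dead_ideal"
      by (rule mon_in_dead_ideal[OF append_lists[OF dX vd(1)]]) (rule dead_append_right[OF vd(2,1)])
    then show "g \<otimes>\<^bsub>A\<^esub> f \<in> dead_ideal" using word_append[OF dX vd(1)] vd by simp
  qed
qed

lemma dead_quotient_epi:
  "algebra_epi K A (quot_algebra A dead_ideal) ((+>\<^bsub>A\<^esub>) dead_ideal)"
  by (rule quot_algebra_epi[OF dead_ideal])

lemma dead_quotient_zero_iff:
  "a \<in> carrier A \<Longrightarrow> dead_ideal +>\<^bsub>A\<^esub> a = \<zero>\<^bsub>quot_algebra A dead_ideal\<^esub> \<longleftrightarrow> a \<in> dead_ideal"
  by (rule coset_eq_zero_iff[OF dead_ideal])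

lemma dead_quotient_word:
  "w \<in> lists X \<Longrightarrow> word_image (quot_algebra A dead_ideal) (\<lambda>i. dead_ideal +>\<^bsub>A\<^esub> x i) w
     = dead_ideal +>\<^bsub>A\<^esub> mon w"
  using algebra_epi.word_image[OF dead_quotient_epi _ letters_closed, of w] by (simp add: comp_def)

text \<open>If \<open>word_eval x f\<close> lies in the ideal, then each word of \<open>f\<close> is dead or has image zero, by uniqueness
  of coordinates. This is the kernel condition for the quotient.\<close>

lemma dead_quotient_presentation:
  "monomial_presentation K (quot_algebra A dead_ideal) X (\<lambda>i. dead_ideal +>\<^bsub>A\<^esub> x i)"
    (is "monomial_presentation K ?B X ?y")
proof -
  interpret Q: algebra_epi K A ?B "(+>\<^bsub>A\<^esub>) dead_ideal" by (rule dead_quotient_epi)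
  interpret F: assoc_algebra K "free_algebra K X" by (rule free_algebra_assoc_algebra)
  have y: "?y \<in> X \<rightarrow> carrier ?B" using letters_closed Q.closed by blast
  have ev: "Q.B.word_eval ?y f = dead_ideal +>\<^bsub>A\<^esub> word_eval x f"
    if "f \<in> carrier (free_algebra K X)" for f
    using that
  proof (induction rule: free_algebra_linear_induct)
    case zero
    then show ?case using Q.zero word_eval_zero[OF letters_closed] Q.B.word_eval_zero[OF y] by simp
  next
    case (add f g)
    then show ?case
      using Q.add[OF word_eval_closed[OF letters_closed] word_eval_closed[OF letters_closed], of f g]
        word_eval_add[OF letters_closed] Q.B.word_eval_add[OF y] by simp
  next
    case (smult c f)
    then show ?case
      using Q.smult[OF _ word_eval_closed[OF letters_closed], of c f]
        word_eval_smult[OF letters_closed] Q.B.word_eval_smult[OF y] by simp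
  next
    case (word u)
    then show ?case
      using dead_quotient_word[OF word] word_eval_word[OF letters_closed word] Q.B.word_eval_word[OF y word]
      by simp
  qed
  show ?thesis
  proof unfold_locales
    have "Q.B.word_eval ?y ` carrier (free_algebra K X)
        = (+>\<^bsub>A\<^esub>) dead_ideal ` (word_eval x ` carrier (free_algebra K X))"
      using ev by (simp add: image_image)
    then show "Q.B.word_eval ?y ` carrier (free_algebra K X) = carrier ?B"
      using word_eval_surj Q.surj by simp
    fix f w
    assume f: "f \<in> carrier (free_algebra K X)" and z: "Q.B.word_eval ?y f = \<zero>\<^bsub>?B\<^esub>" and w: "f w \<noteq> \<zero>\<^bsub>K\<^esub>"
    have wX: "w \<in> lists X" using f w by (simp add: free_algebra_carrier)
    have "word_eval x f \<in> dead_ideal"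
      using dead_quotient_zero_iff[OF word_eval_closed[OF letters_closed f]] ev[OF f] z by simp
    then have "w \<in> dead_words" if "w \<in> nonzero_words"
      using coord_span_words[OF dead_words_lists, of "word_eval x f" w] coord_word_eval[OF f] that w
      by (simp add: dead_ideal_def)
    then have "mon w \<in> dead_ideal" by (rule mon_in_dead_ideal[OF wX])
    then show "word_image ?B ?y w = \<zero>\<^bsub>?B\<^esub>"
      using dead_quotient_word[OF wX] dead_quotient_zero_iff[OF mon_closed[OF wX]] by simp
  qed (use finite_letters y in auto)
qed

text \<open>Otherwise every \<open>u i\<close> has a bound on the length of its prolongations, and the maximum over the
  finitely many letters bounds those of \<open>u\<close>.\<close>

lemma inf_right_prolongable_step:
  assumes u: "u \<in> lists X" and inf: "inf_right_prolongable_monomial A X x (mon u)"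
  shows "\<exists>i\<in>X. inf_right_prolongable_monomial A X x (mon (u @ [i]))"
proof (rule ccontr)
  assume "\<not> ?thesis"
  then have "\<forall>i\<in>X. \<exists>n. \<forall>w\<in>lists X. n \<le> length w \<longrightarrow>
      mon (u @ [i]) \<otimes>\<^bsub>A\<^esub> mon w = \<zero>\<^bsub>A\<^esub>"
    unfolding inf_right_prolongable_monomial_def by blast
  then obtain n where n: "\<forall>i\<in>X. \<forall>w\<in>lists X. n i \<le> length w \<longrightarrow>
      mon (u @ [i]) \<otimes>\<^bsub>A\<^esub> mon w = \<zero>\<^bsub>A\<^esub>"
    using bchoice[of X] by metis
  define m where "m = Max (insert 0 (n ` X))"
  have m: "n i \<le> m" if "i \<in> X" for i unfolding m_def using that finite_letters by (intro Max_ge) auto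
  obtain v where v: "v \<in> lists X" "Suc m \<le> length v" "mon u \<otimes>\<^bsub>A\<^esub> mon v \<noteq> \<zero>\<^bsub>A\<^esub>"
    using inf unfolding inf_right_prolongable_monomial_def by blast
  then obtain i v' where iv: "v = i # v'" by (cases v) auto
  have i: "i \<in> X" "[i] \<in> lists X" "v' \<in> lists X" using v(1) iv by auto
  have "mon (u @ [i]) \<otimes>\<^bsub>A\<^esub> mon v' = mon (u @ [i] @ v')"
    using word_append[OF append_lists[OF u i(2)] i(3)] by simp
  also have "\<dots> = mon u \<otimes>\<^bsub>A\<^esub> mon v" using word_append[OF u v(1)] iv by simp
  finally have "mon (u @ [i]) \<otimes>\<^bsub>A\<^esub> mon v' \<noteq> \<zero>\<^bsub>A\<^esub>" using v(3) by simp
  moreover have "n i \<le> length v'" using m[OF i(1)] v(2) iv by simp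
  ultimately show False using n i by blast
qed

lemma inf_right_prolongable_imp_nonzero:
  assumes u: "u \<in> lists X" and inf: "inf_right_prolongable_monomial A X x (mon u)"
  shows "u \<in> nonzero_words"
proof -
  obtain v where v: "v \<in> lists X" "mon u \<otimes>\<^bsub>A\<^esub> mon v \<noteq> \<zero>\<^bsub>A\<^esub>"
    using inf unfolding inf_right_prolongable_monomial_def by blast
  then have "mon u \<noteq> \<zero>\<^bsub>A\<^esub>" using mon_closed[OF v(1)] by auto
  then show ?thesis using u by (simp add: nonzero_words_def)
qed

lemma dead_quotient_right_prolongable:
  "right_prolongable (quot_algebra A dead_ideal) X (\<lambda>i. dead_ideal +>\<^bsub>A\<^esub> x i)"
    (is "right_prolongable ?B X ?y")
  unfolding right_prolongable_def
proof (intro ballI impI)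
  interpret Q: algebra_epi K A ?B "(+>\<^bsub>A\<^esub>) dead_ideal" by (rule dead_quotient_epi)
  fix u assume "u \<in> monomials ?B X ?y" and nz: "u \<noteq> \<zero>\<^bsub>?B\<^esub>"
  then obtain w where w: "w \<in> lists X" "u = word_image ?B ?y w" unfolding monomials_def by blast
  then have "mon w \<notin> dead_ideal"
    using nz dead_quotient_word[OF w(1)] dead_quotient_zero_iff[OF mon_closed[OF w(1)]] by simp
  then have "w \<in> nonzero_words" "w \<notin> dead_words" using mon_in_dead_ideal[OF w(1)] by blast+
  then have "inf_right_prolongable_monomial A X x (mon w)" by (simp add: dead_words_def)
  then obtain i where i: "i \<in> X" "inf_right_prolongable_monomial A X x (mon (w @ [i]))"
    using inf_right_prolongable_step[OF w(1)] by blast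
  have iX: "[i] \<in> lists X" using i(1) by simp
  note wi = append_lists[OF w(1) iX]
  have "w @ [i] \<in> nonzero_words" using inf_right_prolongable_imp_nonzero[OF wi i(2)] .
  then have "mon (w @ [i]) \<notin> dead_ideal"
    using i(2) mon_in_dead_ideal_iff[of "w @ [i]"] unfolding dead_words_def by blast
  then have "word_image ?B ?y (w @ [i]) \<noteq> \<zero>\<^bsub>?B\<^esub>"
    using dead_quotient_word[OF wi] dead_quotient_zero_iff[OF mon_closed[OF wi]] by simp
  moreover have "word_image ?B ?y (w @ [i]) = u \<otimes>\<^bsub>?B\<^esub> word_image ?B ?y [i]"
    using monomial_presentation.word_append[OF dead_quotient_presentation w(1) iX] w(2) by simp
  ultimately show "right_prolongable_monomial ?B X ?y u"
    unfolding right_prolongable_monomial_def using iX by (intro bexI[of _ "[i]"]) auto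
qed

text \<open>A non-zero word of maximal length would not be prolongable.\<close>

lemma right_prolongable_imp_large_subspaces:
  assumes rp: "right_prolongable A X x" and nontriv: "carrier A \<noteq> {\<zero>\<^bsub>A\<^esub>}"
  shows "\<exists>D. fd_subspace K A D \<and> m \<le> sdim K A D"
proof -
  have "\<one>\<^bsub>A\<^esub> \<noteq> \<zero>\<^bsub>A\<^esub>" using nontriv one_zeroD by blast
  then have nil: "[] \<in> nonzero_words" by (simp add: nonzero_words_def)
  have "infinite nonzero_words"
  proof
    assume fin: "finite nonzero_words"
    have "Max (length ` nonzero_words) \<in> length ` nonzero_words"
      using fin nil by (intro Max_in) auto
    then obtain u where u: "u \<in> nonzero_words" "Max (length ` nonzero_words) = length u" by blast
    have uX: "u \<in> lists X" by (rule nonzero_words_lists[OF u(1)])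
    have "mon u \<in> monomials A X x" "mon u \<noteq> \<zero>\<^bsub>A\<^esub>"
      using u(1) unfolding monomials_def nonzero_words_def by auto
    then obtain v where v: "v \<in> lists X" "v \<noteq> []" "mon u \<otimes>\<^bsub>A\<^esub> mon v \<noteq> \<zero>\<^bsub>A\<^esub>"
      using rp unfolding right_prolongable_def right_prolongable_monomial_def by blast
    then have "u @ v \<in> nonzero_words"
      using word_append[OF uX v(1)] append_lists[OF uX v(1)] by (simp add: nonzero_words_def)
    then have "length (u @ v) \<in> length ` nonzero_words" by blast
    then have "length (u @ v) \<le> length u"
      using Max_ge[of "length ` nonzero_words" "length (u @ v)"] fin u(2) by simp
    then show False using v(2) by simp
  qed
  then obtain T where T: "finite T" "card T = m" "T \<subseteq> nonzero_words"
    using infinite_arbitrarily_large by metis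
  then show ?thesis using sdim_span_words[OF T(1,3)] by (intro exI[of _ "span (mon ` T)"]) simp
qed

text \<open>The prolongations of a dead word have bounded length, so it generates a finite-dimensional right
  ideal. The right ideal generated by \<open>m\<close> dead words has dimension at least \<open>m\<close>.\<close>

lemma infinite_dead_words_imp_exhaustively_amenable:
  assumes inf: "infinite dead_words"
  shows "exhaustively_amenable_module K A A (mult A)"
proof (rule large_invariant_subspaces_imp_exhaustively_amenable)
  fix m
  obtain D where D: "finite D" "card D = m" "D \<subseteq> dead_words"
    using infinite_arbitrarily_large[OF inf] by metis
  have "\<forall>d\<in>D. \<exists>n. \<forall>w\<in>lists X. n \<le> length w \<longrightarrow> mon d \<otimes>\<^bsub>A\<^esub> mon w = \<zero>\<^bsub>A\<^esub>"
    using D(3) unfolding dead_words_def inf_right_prolongable_monomial_def by blast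
  then obtain n where n: "\<forall>d\<in>D. \<forall>w\<in>lists X. n d \<le> length w \<longrightarrow>
      mon d \<otimes>\<^bsub>A\<^esub> mon w = \<zero>\<^bsub>A\<^esub>"
    using bchoice[of D] by metis
  define G where "G = {u \<in> nonzero_words. \<exists>d\<in>D. \<exists>w. u = d @ w}"
  have G: "G \<subseteq> nonzero_words" by (auto simp: G_def)
  have GA: "mon ` G \<subseteq> carrier A" by (rule nonzero_words_closed[OF G])
  have "finite G"
  proof (rule finite_subset)
    show "G \<subseteq> (\<Union>d\<in>D. (@) d ` {w. set w \<subseteq> X \<and> length w \<le> n d})"
    proof
      fix u assume "u \<in> G"
      then obtain d w where u: "u \<in> nonzero_words" "d \<in> D" "u = d @ w" unfolding G_def by blast
      have dw: "d \<in> lists X" "w \<in> lists X" using nonzero_words_lists[OF u(1)] u(3) by simp_all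
      have "mon d \<otimes>\<^bsub>A\<^esub> mon w \<noteq> \<zero>\<^bsub>A\<^esub>"
        using u(1,3) word_append[OF dw] by (simp add: nonzero_words_def)
      then have "length w \<le> n d" using n u(2) dw(2) by (meson linorder_le_cases)
      then show "u \<in> (\<Union>d\<in>D. (@) d ` {w. set w \<subseteq> X \<and> length w \<le> n d})" using u dw(2) by auto
    qed
  qed (use D(1) finite_lists_length_le[OF finite_letters] in auto)
  note L = sdim_span_words[OF this G]
  have "D \<subseteq> G" using D(3) dead_words_nonzero by (force simp: G_def)
  then have "m \<le> sdim K A (span (mon ` G))"
    using card_mono[OF \<open>finite G\<close> \<open>D \<subseteq> G\<close>] D(2) L(2) by simp
  moreover have "invariant_subspace K A (span (mon ` G))"
    unfolding invariant_subspace_def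
  proof (intro conjI ballI)
    note sub = span_is_subspace[OF GA]
    show "subspace K (span (mon ` G)) A" by (rule sub)
    fix l a assume l: "l \<in> span (mon ` G)" and a: "a \<in> carrier A"
    have a': "a \<in> span (mon ` lists X)" using a carrier_eq_span_words by simp
    show "l \<otimes>\<^bsub>A\<^esub> a \<in> span (mon ` G)"
    proof (rule span_mult_in_subspace[OF sub GA mons_closed[OF order_refl] _ l a'])
      fix f g assume "f \<in> mon ` G" "g \<in> mon ` lists X"
      then obtain u v where uv: "u \<in> G" "v \<in> lists X" "f = mon u" "g = mon v" by blast
      have uX: "u \<in> lists X" using uv(1) G nonzero_words_lists by blast
      have fg: "f \<otimes>\<^bsub>A\<^esub> g = mon (u @ v)" using word_append[OF uX uv(2)] uv by simp
      show "f \<otimes>\<^bsub>A\<^esub> g \<in> span (mon ` G)"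
      proof (cases "u @ v \<in> nonzero_words")
        case True
        obtain d w where dw: "d \<in> D" "u = d @ w" using uv(1) unfolding G_def by blast
        then have "u @ v = d @ (w @ v)" by simp
        then have "u @ v \<in> G" using True dw(1) unfolding G_def by blast
        then show ?thesis using in_own_span[OF GA] fg by auto
      next
        case False
        then have "f \<otimes>\<^bsub>A\<^esub> g = \<zero>\<^bsub>A\<^esub>"
          using fg append_lists[OF uX uv(2)] unfolding nonzero_words_def by simp
        then show ?thesis using subspaceD(2)[OF sub] by simp
      qed
    qed
  qed
  ultimately show "\<exists>L. invariant_subspace K A L \<and> fd_subspace K A L \<and> m \<le> sdim K A L"
    using L(1) by blast
qed

lemma dead_ideal_not_fin_dim: "infinite dead_words \<Longrightarrow> \<not> sfin_dim K A dead_ideal"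
  using infinite_words_imp_not_fin_dim[OF _ dead_words_nonzero dead_ideal_subspace]
    in_own_span[OF dead_monomials_closed] unfolding dead_ideal_def by blast

end

section \<open>Amenability of monomial algebras\<close>

lemma (in assoc_algebra) fd_imp_exhaustively_amenable:
  assumes fd: "fd_subspace K A (carrier A)"
  shows "exhaustively_amenable K A"
proof (cases "carrier A = {\<zero>\<^bsub>A\<^esub>}")
  case False
  have "exhaustively_amenable_module K A A (mult A)"
    unfolding exhaustively_amenable_module_def
  proof (intro allI impI)
    fix V W :: "'a set" and \<epsilon> :: real
    assume "fd_subspace K A V \<and> \<epsilon> > 0 \<and> fd_subspace K A W"
    then have V: "fd_subspace K A V" and \<epsilon>: "\<epsilon> > 0" and W: "fd_subspace K A W" by auto
    note P = fd_subspaceD[OF fd_prodsp[OF fd V]]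
    have "sdim K A (prodsp (carrier A) V) \<le> sdim K A (carrier A)"
      by (rule fd_subspace_mono(2)[OF fd P subspaceD(1)[OF P]])
    moreover have "real (sdim K A (carrier A)) < (1 + \<epsilon>) * real (sdim K A (carrier A))"
      using sdim_pos[OF fd False] \<epsilon> by simp
    ultimately have "almost_invariant K A (mult A) V \<epsilon> (carrier A)"
      unfolding almost_invariant_def using fd by linarith
    then show "\<exists>L. almost_invariant K A (mult A) V \<epsilon> L \<and> W \<subseteq> L"
      using subspaceD(1)[OF fd_subspaceD[OF W]] by blast
  qed
  then show ?thesis by (simp add: exhaustively_amenable_def)
qed (simp add: exhaustively_amenable_def)

context monomial_presentation
begin

text \<open>A zero quotient is treated apart: then \<open>A\<close> coincides with the finite-dimensional ideal. A non-zero quotient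
  is infinite-dimensional because it is right prolongable.\<close>

lemma exhaustively_amenable_dead_quotient_iff:
  assumes fin: "finite dead_words"
  shows "exhaustively_amenable K A \<longleftrightarrow> exhaustively_amenable K (quot_algebra A dead_ideal)"
    (is "_ \<longleftrightarrow> exhaustively_amenable K ?B")
proof -
  interpret Q: algebra_epi K A ?B "(+>\<^bsub>A\<^esub>) dead_ideal" by (rule dead_quotient_epi)
  have fd: "fd_subspace K A dead_ideal"
    unfolding dead_ideal_def by (rule fd_subspace_span(1)) (use fin dead_monomials_closed in auto)
  show ?thesis
  proof (cases "carrier ?B = {\<zero>\<^bsub>?B\<^esub>}")
    case True
    have "carrier A \<subseteq> dead_ideal"
    proof
      fix a assume a: "a \<in> carrier A"
      then have "dead_ideal +>\<^bsub>A\<^esub> a = \<zero>\<^bsub>?B\<^esub>" using Q.closed[OF a] True by simp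
      then show "a \<in> dead_ideal" using dead_quotient_zero_iff[OF a] by simp
    qed
    then have "exhaustively_amenable K A"
      using fd subspaceD(1)[OF dead_ideal_subspace] by (intro fd_imp_exhaustively_amenable) simp
    then show ?thesis using True by (simp add: exhaustively_amenable_def)
  next
    case False
    have nontriv: "carrier A \<noteq> {\<zero>\<^bsub>A\<^esub>}"
    proof
      assume "carrier A = {\<zero>\<^bsub>A\<^esub>}"
      then have "carrier ?B = {\<zero>\<^bsub>?B\<^esub>}" using Q.surj Q.zero by auto
      then show False using False by simp
    qed
    have "{a \<in> carrier A. dead_ideal +>\<^bsub>A\<^esub> a = \<zero>\<^bsub>?B\<^esub>} = dead_ideal"
      using dead_quotient_zero_iff subspaceD(1)[OF dead_ideal_subspace] by blast
    then have "exhaustively_amenable_module K A A (mult A) \<longleftrightarrow> exhaustively_amenable_module K ?B ?B (mult ?B)"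
      using fd monomial_presentation.right_prolongable_imp_large_subspaces[OF
          dead_quotient_presentation dead_quotient_right_prolongable False]
      by (intro Q.exhaustively_amenable_iff) simp_all
    then show ?thesis using nontriv False by (simp add: exhaustively_amenable_def)
  qed
qed

lemma exhaustively_amenable_iff_monomial_folner:
  assumes V: "generating_subspace K A V"
  shows "exhaustively_amenable K A \<longleftrightarrow> has_monomial_folner_sequence K X x A V"
proof (cases "carrier A = {\<zero>\<^bsub>A\<^esub>}")
  case True
  then show ?thesis by (simp add: exhaustively_amenable_def has_monomial_folner_sequence_def)
next
  case False
  have V': "fd_subspace K A V" "\<one>\<^bsub>A\<^esub> \<in> V" using V unfolding generating_subspace_def by blast+
  have "exhaustively_amenable_module K A A (mult A)" if "has_monomial_folner_sequence K X x A V"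
    using that False folner_sequence_imp_exhaustively_amenable[OF V]
    unfolding has_monomial_folner_sequence_def by blast
  then show ?thesis
    using exhaustively_amenable_imp_monomial_folner[OF _ False V'] False
    unfolding exhaustively_amenable_def by blast
qed

end

theorem lemma3p2:
  fixes K :: "('k, 'm) ring_scheme" and A :: "('k, 'a) module"
    and X :: "'x set" and x :: "'x \<Rightarrow> 'a" and S N :: "'a set"
    and B :: "('k, 'a set) module" and y :: "'x \<Rightarrow> 'a set"
  assumes "field K"
    and "monomial_algebra K X x A"
    and S: "S = {u \<in> monomials A X x. u \<noteq> \<zero>\<^bsub>A\<^esub> \<and> \<not> inf_right_prolongable_monomial A X x u}"
    and N: "N = lspan K A S"
    and B: "B = quot_algebra A N"
    and y: "y = (\<lambda>i. N +>\<^bsub>A\<^esub> x i)"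
  shows "ideal N A \<and> monomial_algebra K X y B \<and> right_prolongable B X y
    \<and> (infinite S \<longrightarrow>
         (\<exists>L. invariant_subspace K A L \<and> \<not> sfin_dim K A L \<and> spanned_by_monomials K X x A L)
         \<and> exhaustively_amenable K A)
    \<and> (finite S \<longrightarrow>
         (exhaustively_amenable K A \<longleftrightarrow> exhaustively_amenable K B)
         \<and> (\<forall>V V'. generating_subspace K A V \<and> generating_subspace K B V' \<longrightarrow>
              (exhaustively_amenable K A \<longleftrightarrow>
                 has_monomial_folner_sequence K X x A V
                 \<and> has_monomial_folner_sequence K X y B V')))"
proof -
  interpret monomial_presentation K A X x
    by (rule monomial_algebra_imp_presentation[OF assms(2)])
  have S_words: "S = mon ` dead_words" unfolding S by (rule dead_monomials)
  have N_eq: "N = dead_ideal" unfolding N S_words dead_ideal_def ..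
  interpret Q: monomial_presentation K B X y
    unfolding B y N_eq by (rule dead_quotient_presentation)
  have "inj_on (mon) dead_words"
    using lead_word dead_words_nonzero by (metis inj_onI subsetD)
  then have finite_iff: "finite S \<longleftrightarrow> finite dead_words"
    unfolding S_words by (rule finite_image_iff)
  have ideal: "ideal N A" unfolding N_eq by (rule dead_ideal)
  have rp: "right_prolongable B X y"
    unfolding B y N_eq by (rule dead_quotient_right_prolongable)
  have i: "(\<exists>L. invariant_subspace K A L \<and> \<not> sfin_dim K A L \<and> spanned_by_monomials K X x A L)
      \<and> exhaustively_amenable K A" if "infinite S"
  proof -
    have inf: "infinite dead_words" using that finite_iff by simp
    have "invariant_subspace K A N"
      unfolding invariant_subspace_def
      by (intro conjI ballI ideal_imp_subspace[OF ideal] ideal.I_r_closed[OF ideal])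
    moreover have "spanned_by_monomials K X x A N"
      unfolding spanned_by_monomials_def by (intro exI[of _ S] conjI N) (auto simp: S)
    moreover have "\<not> sfin_dim K A N" unfolding N_eq by (rule dead_ideal_not_fin_dim[OF inf])
    moreover have "exhaustively_amenable K A"
      using infinite_dead_words_imp_exhaustively_amenable[OF inf] by (simp add: exhaustively_amenable_def)
    ultimately show ?thesis by (intro conjI exI[of _ N])
  qed
  have iff: "exhaustively_amenable K A \<longleftrightarrow> exhaustively_amenable K B" if "finite S"
    unfolding B N_eq using that finite_iff by (intro exhaustively_amenable_dead_quotient_iff) simp
  show ?thesis
  proof (intro conjI impI allI)
    fix V V'
    assume "finite S" and VV': "generating_subspace K A V \<and> generating_subspace K B V'"
    then show "exhaustively_amenable K A \<longleftrightarrow>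
        has_monomial_folner_sequence K X x A V \<and> has_monomial_folner_sequence K X y B V'"
      using iff exhaustively_amenable_iff_monomial_folner[of V]
        Q.exhaustively_amenable_iff_monomial_folner[of V'] by simp
  qed (use ideal Q.monomial_algebra rp i iff in simp_all)
qed

end
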